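(* Let $k$ be a field and let $Q$ be a strongly locally finite quiver. Then the category $\overline{\mathrm{rep}}(Q)$ is Hom-finite (all Hom-spaces are finite dimensional over $k$) and Krull-Schmidt.
   Context: A quiver $Q=(Q_0,Q_1)$ is strongly locally finite if it is locally finite (each vertex is attached to finitely many arrows) and interval-finite (for all vertices $x,y$ the set $Q(x,y)$ of paths from $x$ to $y$, including trivial paths, is finite). $\mathrm{rep}(Q)$ is the abelian category of locally finite dimensional representations $M$ of $Q$ over $k$ ($M(x)$ is finite dimensional for every $x\in Q_0$). For $a\in Q_0$: $P_a$ is the representation with $P_a(x)$ the vector space with basis $Q(a,x)$, arrows acting by extending paths; $I_a$ is the representation with $I_a(x)$ the vector space with basis $Q(x,a)$, an arrow $\alpha:x\to y$ acting by the transpose of the map $kQ(y,a)\to kQ(x,a)$ given by multiplication by $\alpha$. $\mathrm{rep}^+(Q)$ is the full subcategory of $\mathrm{rep}(Q)$ of finitely presented representations: those $M$ with an exact sequence $0\to P'\to P\to M\to 0$ where $P,P'$ are finite direct sums of representations $P_x$. $\mathrm{rep}^-(Q)$ is the full subcategory of finitely co-presented representations: those $M$ with an exact sequence $0\to M\to I\to I'\to 0$ where $I,I'$ are finite direct sums of representations $I_x$. An arrow $\alpha$ supports $M$ if $M(\alpha)\neq 0$. A short exact sequence $0\to L\to M\to N\to 0$ in $\mathrm{rep}(Q)$ is called a finite extension of $N$ by $L$ (and $M$ a finite extension-representation of $N$ by $L$) if all but finitely many arrows supporting $M$ support $L\oplus N$. $\overline{\mathrm{rep}}(Q)$ is the full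 subcategory of $\mathrm{rep}(Q)$ of those $M$ which are finite extension-representations of $N$ by $L$ for some $L\in\mathrm{rep}^+(Q)$ and $N\in\mathrm{rep}^-(Q)$. Krull-Schmidt: every object decomposes uniquely (up to isomorphism and permutation) as a finite direct sum of objects having local endomorphism algebras. *)

theory Defs
  imports
    "HOL-Library.Function_Algebras"
    "HOL-Combinatorics.Permutations"
    "HOL-Algebra.Ideal"
    "Graph_Theory.Arc_Walk"
begin

section \<open>Strongly locally finite quivers\<close>

text \<open>
  A quiver is a (possibly infinite) multi-digraph, i.e. a \<^locale>\<open>wf_digraph\<close>; a path from \<open>x\<close> to
  \<open>y\<close> is an arc walk, written as the list of its arcs in the order in which they are traversed,
  starting at \<open>x\<close>. The trivial path at \<open>x\<close> is the empty list, regarded as a walk from \<open>x\<close> to \<open>x\<close>.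
\<close>

definition paths :: "('v, 'e) pre_digraph \<Rightarrow> 'v \<Rightarrow> 'v \<Rightarrow> 'e list set" where
  "paths Q x y = {p. pre_digraph.awalk Q x p y}"

locale strongly_locally_finite_quiver = wf_digraph Q for Q :: "('v, 'e) pre_digraph" +
  assumes locally_finite: "x \<in> verts Q \<Longrightarrow> finite (in_arcs Q x \<union> out_arcs Q x)"
    and interval_finite: "x \<in> verts Q \<Longrightarrow> y \<in> verts Q \<Longrightarrow> finite (paths Q x y)"

section \<open>Linear algebra on subspaces\<close>

definition fin_dim :: "('k::field \<Rightarrow> 'w::ab_group_add \<Rightarrow> 'w) \<Rightarrow> 'w set \<Rightarrow> bool" where
  "fin_dim s V \<longleftrightarrow> (\<exists>B. finite B \<and> module.span s B = V)"

definition linear_on ::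
  "('k::field \<Rightarrow> 'w::ab_group_add \<Rightarrow> 'w) \<Rightarrow> ('k \<Rightarrow> 'u::ab_group_add \<Rightarrow> 'u) \<Rightarrow> 'w set \<Rightarrow> ('w \<Rightarrow> 'u) \<Rightarrow> bool"
where
  "linear_on s t V f \<longleftrightarrow>
     (\<forall>u\<in>V. \<forall>v\<in>V. f (u + v) = f u + f v) \<and> (\<forall>c. \<forall>u\<in>V. f (s c u) = t c (f u))"

definition pointwise :: "('k \<Rightarrow> 'w \<Rightarrow> 'w) \<Rightarrow> 'k \<Rightarrow> ('i \<Rightarrow> 'w) \<Rightarrow> ('i \<Rightarrow> 'w)" where
  "pointwise s c u = (\<lambda>i. s c (u i))"

section \<open>Representations\<close>

text \<open>
  The spaces of a representation \<open>M\<close> are subspaces of one ambient \<open>k\<close>-vector space, given by its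
  type \<open>'w\<close> and its scalar multiplication \<open>s\<close>. This is no loss of generality, as any family of
  vector spaces embeds into its direct sum. Only the restriction of \<open>act M \<alpha>\<close> to the space at the
  tail of \<open>\<alpha>\<close> is meaningful.
\<close>

record ('v, 'e, 'w) quiver_rep =
  sp :: "'v \<Rightarrow> 'w set"
  act :: "'e \<Rightarrow> 'w \<Rightarrow> 'w"

definition rep ::
  "('v, 'e) pre_digraph \<Rightarrow> ('k::field \<Rightarrow> 'w::ab_group_add \<Rightarrow> 'w) \<Rightarrow> ('v, 'e, 'w) quiver_rep set"
where
  "rep Q s = {M.
     (\<forall>x\<in>verts Q. module.subspace s (sp M x) \<and> fin_dim s (sp M x)) \<and>
     (\<forall>\<alpha>\<in>arcs Q. act M \<alpha> ` sp M (tail Q \<alpha>) \<subseteq> sp M (head Q \<alpha>) \<and>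
        linear_on s s (sp M (tail Q \<alpha>)) (act M \<alpha>))}"

text \<open>
  A morphism is a family of linear maps compatible with the arrows. Its components are normalised to
  be zero wherever they are not determined, so that equality of morphisms is equality of functions
  and \<open>Hom Q s t M N\<close> is a subspace of the space of functions with pointwise operations.
\<close>

definition Hom ::
  "('v, 'e) pre_digraph \<Rightarrow> ('k::field \<Rightarrow> 'w::ab_group_add \<Rightarrow> 'w) \<Rightarrow> ('k \<Rightarrow> 'u::ab_group_add \<Rightarrow> 'u) \<Rightarrow>
   ('v, 'e, 'w) quiver_rep \<Rightarrow> ('v, 'e, 'u) quiver_rep \<Rightarrow> ('v \<Rightarrow> 'w \<Rightarrow> 'u) set"
where
  "Hom Q s t M N = {f.
     (\<forall>x\<in>verts Q. f x ` sp M x \<subseteq> sp N x \<and> linear_on s t (sp M x) (f x)) \<and>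
     (\<forall>\<alpha>\<in>arcs Q. \<forall>u\<in>sp M (tail Q \<alpha>). f (head Q \<alpha>) (act M \<alpha> u) = act N \<alpha> (f (tail Q \<alpha>) u)) \<and>
     (\<forall>x u. x \<notin> verts Q \<or> u \<notin> sp M x \<longrightarrow> f x u = 0)}"

definition comp_mor :: "('v \<Rightarrow> 'u \<Rightarrow> 'w) \<Rightarrow> ('v \<Rightarrow> 't \<Rightarrow> 'u) \<Rightarrow> 'v \<Rightarrow> 't \<Rightarrow> 'w" where
  "comp_mor g f = (\<lambda>x u. g x (f x u))"

definition id_mor ::
  "('v, 'e) pre_digraph \<Rightarrow> ('v, 'e, 'w::zero) quiver_rep \<Rightarrow> 'v \<Rightarrow> 'w \<Rightarrow> 'w" where
  "id_mor Q M = (\<lambda>x u. if x \<in> verts Q \<and> u \<in> sp M x then u else 0)"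

definition isomorphic ::
  "('v, 'e) pre_digraph \<Rightarrow> ('k::field \<Rightarrow> 'w::ab_group_add \<Rightarrow> 'w) \<Rightarrow> ('k \<Rightarrow> 'u::ab_group_add \<Rightarrow> 'u) \<Rightarrow>
   ('v, 'e, 'w) quiver_rep \<Rightarrow> ('v, 'e, 'u) quiver_rep \<Rightarrow> bool"
where
  "isomorphic Q s t M N \<longleftrightarrow>
     (\<exists>f\<in>Hom Q s t M N. \<exists>g\<in>Hom Q t s N M. comp_mor g f = id_mor Q M \<and> comp_mor f g = id_mor Q N)"

definition short_exact ::
  "('v, 'e) pre_digraph \<Rightarrow> ('k::field \<Rightarrow> 'a::ab_group_add \<Rightarrow> 'a) \<Rightarrow> ('k \<Rightarrow> 'b::ab_group_add \<Rightarrow> 'b) \<Rightarrow>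
   ('k \<Rightarrow> 'c::ab_group_add \<Rightarrow> 'c) \<Rightarrow> ('v, 'e, 'a) quiver_rep \<Rightarrow> ('v \<Rightarrow> 'a \<Rightarrow> 'b) \<Rightarrow>
   ('v, 'e, 'b) quiver_rep \<Rightarrow> ('v \<Rightarrow> 'b \<Rightarrow> 'c) \<Rightarrow> ('v, 'e, 'c) quiver_rep \<Rightarrow> bool"
where
  "short_exact Q r s t L f M g N \<longleftrightarrow>
     f \<in> Hom Q r s L M \<and> g \<in> Hom Q s t M N \<and>
     (\<forall>x\<in>verts Q. inj_on (f x) (sp L x) \<and> f x ` sp L x = {u \<in> sp M x. g x u = 0} \<and>
        g x ` sp M x = sp N x)"

text \<open>
  The finite direct sum of a list of representations; its ambient space is \<open>nat \<Rightarrow> 'w\<close> with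
  scalar multiplication \<open>pointwise s\<close>.
\<close>

definition direct_sum :: "('v, 'e, 'w::zero) quiver_rep list \<Rightarrow> ('v, 'e, nat \<Rightarrow> 'w) quiver_rep" where
  "direct_sum Ms = \<lparr>
     sp = (\<lambda>x. {u. (\<forall>i<length Ms. u i \<in> sp (Ms ! i) x) \<and> (\<forall>i\<ge>length Ms. u i = 0)}),
     act = (\<lambda>\<alpha> u i. if i < length Ms then act (Ms ! i) \<alpha> (u i) else 0)\<rparr>"

section \<open>Finitely presented and finitely co-presented representations\<close>

text \<open>
  The vector space with basis a set \<open>B\<close> of paths is the space of finitely supported functions on
  \<open>B\<close>, the basis vector of \<open>p \<in> B\<close> being its indicator function.
\<close>

definition free_space :: "'e list set \<Rightarrow> ('e list \<Rightarrow> 'k::field) set" where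
  "free_space B = {f. finite {p. f p \<noteq> 0} \<and> {p. f p \<noteq> 0} \<subseteq> B}"

text \<open>In \<open>P_rep Q a\<close> an arrow \<open>\<alpha>\<close> sends the basis vector of a path \<open>p\<close> to that of \<open>p @ [\<alpha>]\<close>.\<close>

definition P_rep :: "('v, 'e) pre_digraph \<Rightarrow> 'v \<Rightarrow> ('v, 'e, 'e list \<Rightarrow> 'k::field) quiver_rep" where
  "P_rep Q a = \<lparr>
     sp = (\<lambda>x. free_space (paths Q a x)),
     act = (\<lambda>\<alpha> f q. if q \<noteq> [] \<and> last q = \<alpha> then f (butlast q) else 0)\<rparr>"

text \<open>
  Multiplication by \<open>\<alpha> : x \<rightarrow> y\<close> sends a path \<open>p\<close> from \<open>y\<close> to \<open>a\<close> to the path \<open>\<alpha> # p\<close> from \<open>x\<close> to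
  \<open>a\<close>. The transpose, in coordinates with respect to the bases of paths, is precomposition.
\<close>

definition I_rep :: "('v, 'e) pre_digraph \<Rightarrow> 'v \<Rightarrow> ('v, 'e, 'e list \<Rightarrow> 'k::field) quiver_rep" where
  "I_rep Q a = \<lparr>
     sp = (\<lambda>x. free_space (paths Q x a)),
     act = (\<lambda>\<alpha> f p. f (\<alpha> # p))\<rparr>"

abbreviation path_scale :: "'k::field \<Rightarrow> (nat \<Rightarrow> 'e list \<Rightarrow> 'k) \<Rightarrow> nat \<Rightarrow> 'e list \<Rightarrow> 'k" where
  "path_scale \<equiv> pointwise (pointwise (*))"

definition rep_plus ::
  "('v, 'e) pre_digraph \<Rightarrow> ('k::field \<Rightarrow> 'w::ab_group_add \<Rightarrow> 'w) \<Rightarrow> ('v, 'e, 'w) quiver_rep set"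
where
  "rep_plus Q s = {M \<in> rep Q s. \<exists>as bs f g. set as \<subseteq> verts Q \<and> set bs \<subseteq> verts Q \<and>
     short_exact Q path_scale path_scale s
       (direct_sum (map (P_rep Q) bs)) f (direct_sum (map (P_rep Q) as)) g M}"

definition rep_minus ::
  "('v, 'e) pre_digraph \<Rightarrow> ('k::field \<Rightarrow> 'w::ab_group_add \<Rightarrow> 'w) \<Rightarrow> ('v, 'e, 'w) quiver_rep set"
where
  "rep_minus Q s = {M \<in> rep Q s. \<exists>as bs f g. set as \<subseteq> verts Q \<and> set bs \<subseteq> verts Q \<and>
     short_exact Q s path_scale path_scale
       M f (direct_sum (map (I_rep Q) as)) g (direct_sum (map (I_rep Q) bs))}"

section \<open>Finite extensions\<close>

definition supports :: "('v, 'e) pre_digraph \<Rightarrow> 'e \<Rightarrow> ('v, 'e, 'w::zero) quiver_rep \<Rightarrow> bool" where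
  "supports Q \<alpha> M \<longleftrightarrow> \<alpha> \<in> arcs Q \<and> (\<exists>u\<in>sp M (tail Q \<alpha>). act M \<alpha> u \<noteq> 0)"

definition finite_extension ::
  "('v, 'e) pre_digraph \<Rightarrow> ('k::field \<Rightarrow> 'w::ab_group_add \<Rightarrow> 'w) \<Rightarrow> ('v, 'e, 'w) quiver_rep \<Rightarrow>
   ('v \<Rightarrow> 'w \<Rightarrow> 'w) \<Rightarrow> ('v, 'e, 'w) quiver_rep \<Rightarrow> ('v \<Rightarrow> 'w \<Rightarrow> 'w) \<Rightarrow> ('v, 'e, 'w) quiver_rep \<Rightarrow> bool"
where
  "finite_extension Q s L f M g N \<longleftrightarrow>
     L \<in> rep Q s \<and> M \<in> rep Q s \<and> N \<in> rep Q s \<and> short_exact Q s s s L f M g N \<and>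
     finite {\<alpha>. supports Q \<alpha> M \<and> \<not> supports Q \<alpha> (direct_sum [L, N])}"

text \<open>
  Taking \<open>L\<close> and \<open>N\<close> in the same ambient space as \<open>M\<close> is no restriction: up to isomorphism, \<open>L\<close>
  is a subrepresentation of \<open>M\<close>, and each space of \<open>N\<close> can be placed on a complement of the
  corresponding space of \<open>L\<close> in that of \<open>M\<close>.
\<close>

definition rep_bar ::
  "('v, 'e) pre_digraph \<Rightarrow> ('k::field \<Rightarrow> 'w::ab_group_add \<Rightarrow> 'w) \<Rightarrow> ('v, 'e, 'w) quiver_rep set"
where
  "rep_bar Q s = {M \<in> rep Q s. \<exists>L\<in>rep_plus Q s. \<exists>N\<in>rep_minus Q s. \<exists>f g.
     finite_extension Q s L f M g N}"

section \<open>Hom-finite and Krull-Schmidt full subcategories\<close>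

text \<open>A full subcategory of \<open>rep Q s\<close> is given by its set \<open>C\<close> of objects.\<close>

definition hom_finite ::
  "('v, 'e) pre_digraph \<Rightarrow> ('k::field \<Rightarrow> 'w::ab_group_add \<Rightarrow> 'w) \<Rightarrow> ('v, 'e, 'w) quiver_rep set \<Rightarrow> bool"
where
  "hom_finite Q s C \<longleftrightarrow> (\<forall>M\<in>C. \<forall>N\<in>C. fin_dim (pointwise (pointwise s)) (Hom Q s s M N))"

definition End_ring ::
  "('v, 'e) pre_digraph \<Rightarrow> ('k::field \<Rightarrow> 'w::ab_group_add \<Rightarrow> 'w) \<Rightarrow> ('v, 'e, 'w) quiver_rep \<Rightarrow>
   ('v \<Rightarrow> 'w \<Rightarrow> 'w) ring"
where
  "End_ring Q s M = \<lparr>carrier = Hom Q s s M M, mult = comp_mor, one = id_mor Q M, zero = 0, add = (+)\<rparr>"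

text \<open>
  A not necessarily commutative ring is local if its non-units form a two-sided ideal. This excludes
  the zero ring, whose only element is a unit.
\<close>

definition is_local_ring :: "('a, 'm) ring_scheme \<Rightarrow> bool" where
  "is_local_ring R \<longleftrightarrow> ideal (carrier R - Units R) R"

definition KS_decomposition ::
  "('v, 'e) pre_digraph \<Rightarrow> ('k::field \<Rightarrow> 'w::ab_group_add \<Rightarrow> 'w) \<Rightarrow> ('v, 'e, 'w) quiver_rep set \<Rightarrow>
   ('v, 'e, 'w) quiver_rep \<Rightarrow> ('v, 'e, 'w) quiver_rep list \<Rightarrow> bool"
where
  "KS_decomposition Q s C M Ms \<longleftrightarrow>
     set Ms \<subseteq> C \<and> (\<forall>X\<in>set Ms. is_local_ring (End_ring Q s X)) \<and>
     isomorphic Q s (pointwise s) M (direct_sum Ms)"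

definition krull_schmidt ::
  "('v, 'e) pre_digraph \<Rightarrow> ('k::field \<Rightarrow> 'w::ab_group_add \<Rightarrow> 'w) \<Rightarrow> ('v, 'e, 'w) quiver_rep set \<Rightarrow> bool"
where
  "krull_schmidt Q s C \<longleftrightarrow> (\<forall>M\<in>C.
     (\<exists>Ms. KS_decomposition Q s C M Ms) \<and>
     (\<forall>Ms Ns. KS_decomposition Q s C M Ms \<longrightarrow> KS_decomposition Q s C M Ns \<longrightarrow>
        length Ms = length Ns \<and>
        (\<exists>\<pi>. \<pi> permutes {..<length Ms} \<and>
           (\<forall>i<length Ms. isomorphic Q s s (Ms ! i) (Ns ! \<pi> i)))))"

end

theory Submission
  imports Defs
begin

text \<open>
  For a vertex \<open>x\<close>, the arrows ending at \<open>x\<close> give a map from the direct sum of the \<open>M(y)\<close>, \<open>y \<rightarrow> x\<close>, to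
  \<open>M(x)\<close>. It is injective for \<open>P_a\<close>, and bijective if \<open>x \<noteq> a\<close>. Hence the finitely presented
  representations are those that are supported on the successors of a finite set and for which this
  map is bijective at all but finitely many vertices; dually for the finitely co-presented ones.
  Consequently \<open>M\<close> belongs to \<open>rep_bar\<close> iff, for the set \<open>S\<close> of successors of some finite set, \<open>M\<close>
  restricted to \<open>S\<close> and to its complement satisfies these two conditions and only finitely many
  arrows from the complement to \<open>S\<close> support \<open>M\<close>. This criterion passes to direct summands. It also
  shows that morphisms are determined by their values at finitely many vertices, so that Hom-spaces
  are finite dimensional. As idempotents split, a decomposition into summands with local
  endomorphism rings comes from Fitting's lemma, and it is unique by an exchange argument.
\<close>

section \<open>Linear algebra\<close>

text \<open>An endomorphism of \<open>M\<close> need not preserve the subobject \<open>L\<close> of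
  a given finite extension, so a decomposition of \<open>M\<close> cannot simply be restricted to
  \<open>L\<close> and \<open>N\<close>. The part of \<open>M\<close> living on the successor-closed
  set \<open>S\<close> takes the place of \<open>L\<close>: every morphism preserves it, and it
  differs from \<open>L\<close> at only finitely many vertices. Generation and cogeneration are then
  propagated along the arrows, which is well founded because only finitely many paths lead from a
  finite set to a given vertex, or from that vertex to a finite set. Cokernels are never formed: a
  quotient is represented by the subspace to be divided out together with linear forms vanishing on
  it. The Krull-Schmidt argument is carried out for abstract linear categories, whose objects have
  no direct sums given as such; \<open>direct_sum\<close> changes the ambient space of its summands
  and enters only through injections and projections.\<close>

lemma vector_space_pointwise:
  "vector_space s \<Longrightarrow> vector_space (pointwise s)"
  unfolding vector_space_def pointwise_def by (auto simp: fun_eq_iff)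

lemma vector_space_field: "vector_space ((*) :: 'k::field \<Rightarrow> _)"
  by unfold_locales (auto simp: algebra_simps)

lemma linear_on_add: "linear_on s t V f \<Longrightarrow> u \<in> V \<Longrightarrow> v \<in> V \<Longrightarrow> f (u + v) = f u + f v"
  and linear_on_scale: "linear_on s t V f \<Longrightarrow> u \<in> V \<Longrightarrow> f (s c u) = t c (f u)"
  by (simp_all add: linear_on_def)

lemma linear_on_subset: "linear_on s t V f \<Longrightarrow> U \<subseteq> V \<Longrightarrow> linear_on s t U f"
  unfolding linear_on_def by blast

context
  fixes s :: "'k::field \<Rightarrow> 'w::ab_group_add \<Rightarrow> 'w" and t :: "'k \<Rightarrow> 'u::ab_group_add \<Rightarrow> 'u"
    and V :: "'w set" and f :: "'w \<Rightarrow> 'u"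
  assumes s: "vector_space s" and t: "vector_space t"
    and V: "module.subspace s V" and f: "linear_on s t V f"
begin

interpretation s: vector_space s by (rule s)
interpretation t: vector_space t by (rule t)

lemma linear_on_zero: "f 0 = 0"
  using linear_on_scale[OF f s.subspace_0[OF V], of 0] by simp

lemma linear_on_diff:
  assumes "u \<in> V" "v \<in> V" shows "f (u - v) = f u - f v"
proof -
  have "f u = f (u - v) + f v"
    using linear_on_add[OF f s.subspace_diff[OF V assms] assms(2)] by simp
  then show ?thesis by simp
qed

lemma linear_on_sum:
  "(\<And>i. i \<in> I \<Longrightarrow> u i \<in> V) \<Longrightarrow> f (\<Sum>i\<in>I. u i) = (\<Sum>i\<in>I. f (u i))"
proof (induction I rule: infinite_finite_induct)
  case (insert i I)
  then show ?case
    by (simp add: linear_on_add[OF f] s.subspace_sum[OF V])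
qed (simp_all add: linear_on_zero)

lemma subspace_linear_image: "module.subspace t (f ` V)"
proof (rule t.subspaceI)
  show "0 \<in> f ` V" using linear_on_zero s.subspace_0[OF V] by (metis imageI)
next
  fix x y assume "x \<in> f ` V" "y \<in> f ` V"
  then obtain u v where uv: "u \<in> V" "v \<in> V" "x = f u" "y = f v" by blast
  then have "x + y = f (u + v)" using linear_on_add[OF f] by simp
  then show "x + y \<in> f ` V" using uv s.subspace_add[OF V] by blast
next
  fix c x assume "x \<in> f ` V"
  then obtain u where u: "u \<in> V" "x = f u" by blast
  then have "t c x = f (s c u)" using linear_on_scale[OF f] by simp
  then show "t c x \<in> f ` V" using u s.subspace_scale[OF V] by blast
qed

lemma subspace_linear_vimage:
  assumes "module.subspace t T" shows "module.subspace s {u \<in> V. f u \<in> T}"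
  by (rule s.subspaceI)
    (auto simp: linear_on_zero linear_on_add[OF f] linear_on_scale[OF f] s.subspace_0[OF V]
      s.subspace_add[OF V] s.subspace_scale[OF V] t.subspace_0[OF assms] t.subspace_add[OF assms]
      t.subspace_scale[OF assms])

lemma subspace_linear_kernel: "module.subspace s {u \<in> V. f u = 0}"
  using subspace_linear_vimage[OF t.subspace_single_0] by simp

end

context vector_space
begin

lemma fin_dimI: "V \<subseteq> span T \<Longrightarrow> finite T \<Longrightarrow> subspace V \<Longrightarrow> fin_dim scale V"
proof -
  assume V: "V \<subseteq> span T" "finite T" "subspace V"
  obtain B where B: "B \<subseteq> V" "independent B" "V \<subseteq> span B"
    using basis_exists by metis
  have "finite B"
    using independent_span_bound[OF V(2) B(2)] B(1) V(1) by auto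
  then show ?thesis
    unfolding fin_dim_def using B V(3) span_subspace by metis
qed

lemma fin_dim_subspace: "fin_dim scale V \<Longrightarrow> subspace U \<Longrightarrow> U \<subseteq> V \<Longrightarrow> fin_dim scale U"
  using fin_dimI[of U] by (auto simp: fin_dim_def)

lemma fin_dim_basis:
  assumes "fin_dim scale V" "subspace V"
  obtains B where "finite B" "B \<subseteq> V" "independent B" "span B = V"
proof -
  obtain T where T: "finite T" "span T = V" using assms(1) by (auto simp: fin_dim_def)
  obtain B where B: "B \<subseteq> V" "independent B" "V \<subseteq> span B"
    using basis_exists by metis
  have "finite B"
    using independent_span_bound[OF T(1) B(2)] B(1) T(2) by auto
  then show thesis using B assms(2) that span_subspace by metis
qed

lemma fin_dim_zero: "fin_dim scale {0}"
  unfolding fin_dim_def using span_empty by blast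

text \<open>Generators of the kernel together with preimages of a basis of the image span
  \<open>V\<close>. This replaces counting dimensions, as \<open>fin_dim\<close> only provides a
  finite spanning set.\<close>

lemma fin_dim_kernel_image:
  fixes t :: "'a \<Rightarrow> 'u::ab_group_add \<Rightarrow> 'u"
  assumes t: "vector_space t" and V: "subspace V" and f: "linear_on scale t V f"
    and ker: "fin_dim scale {v \<in> V. f v = 0}" and U: "fin_dim t U" "f ` V \<subseteq> U"
  shows "fin_dim scale V"
proof -
  interpret t: vector_space t by (rule t)
  have vs: "vector_space scale" by unfold_locales
  have im: "t.subspace (f ` V)" by (rule subspace_linear_image[OF vs t V f])
  have "fin_dim t (f ` V)"
  proof -
    obtain T where T: "finite T" "t.span T = U" using U by (auto simp: fin_dim_def)
    show ?thesis using t.fin_dimI[of "f ` V" T] T U(2) im by auto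
  qed
  then obtain B where B: "finite B" "B \<subseteq> f ` V" "t.independent B" "t.span B = f ` V"
    using t.fin_dim_basis im by metis
  obtain C where C: "C \<subseteq> V" "finite C" "B = f ` C"
    using B(1,2) by (meson finite_subset_image)
  obtain K where K: "finite K" "span K = {v \<in> V. f v = 0}" using ker by (auto simp: fin_dim_def)
  \<comment> \<open>Some combination \<open>u\<close> of the chosen preimages has the same value as
    \<open>v\<close>, so \<open>v - u\<close> lies in the kernel.\<close>
  have "v \<in> span (K \<union> C)" if v: "v \<in> V" for v
  proof -
    have "f v \<in> t.span (f ` C)" using B C v by auto
    then have "\<exists>u. u \<in> span C \<and> f u = f v"
    proof (induction rule: t.span_induct_alt)
      case base
      then show ?case using span_zero linear_on_zero[OF vs t V f] by auto
    next
      case (step c x y)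
      then obtain u w where "u \<in> span C" "f u = y" "w \<in> C" "f w = x" by auto
      moreover have "span C \<subseteq> V" using C V span_minimal by auto
      ultimately have "scale c w + u \<in> span C" "f (scale c w + u) = t c x + y"
        using C V f by (auto simp: span_add span_scale span_base linear_on_add subspace_scale
            linear_on_scale subsetD)
      then show ?case by blast
    qed
    then obtain u where u: "u \<in> span C" "f u = f v" by auto
    have uV: "u \<in> V" using u C V span_minimal by auto
    have "f (v - u) = 0" using linear_on_diff[OF vs t V f v uV] u by simp
    then have "v - u \<in> span K" using K uV v V subspace_diff by auto
    then have "(v - u) + u \<in> span (K \<union> C)"
      using u span_mono[of K "K \<union> C"] span_mono[of C "K \<union> C"] by (intro span_add) auto
    then show ?thesis by simp
  qed
  then show ?thesis using fin_dimI[of V "K \<union> C"] K C V by auto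
qed

text \<open>Induction on \<open>I\<close>: the kernel of one map \<open>f i\<close> satisfies the
  hypotheses for the remaining maps, and \<open>fin_dim_kernel_image\<close> passes from this kernel
  back to \<open>V\<close>. Later the maps are coordinate functions and evaluations.\<close>

lemma fin_dim_jointly_injective:
  fixes t :: "'a \<Rightarrow> 'u::ab_group_add \<Rightarrow> 'u"
  assumes t: "vector_space t" and I: "finite I" and V: "subspace V"
    and f: "\<And>i. i \<in> I \<Longrightarrow> linear_on scale t V (f i)"
    and U: "\<And>i. i \<in> I \<Longrightarrow> fin_dim t (U i) \<and> f i ` V \<subseteq> U i"
    and inj: "\<And>v. v \<in> V \<Longrightarrow> (\<And>i. i \<in> I \<Longrightarrow> f i v = 0) \<Longrightarrow> v = 0"
  shows "fin_dim scale V"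
  using I V f U inj
proof (induction I arbitrary: V)
  case empty
  then have "V = {0}" using subspace_0 by auto
  then show ?case using fin_dim_zero by simp
next
  case (insert i I)
  have vs: "vector_space scale" by unfold_locales
  let ?K = "{v \<in> V. f i v = 0}"
  have "fin_dim scale ?K"
  proof (rule insert.IH)
    show "subspace ?K" using subspace_linear_kernel[OF vs t insert.prems(1)] insert.prems(2) by auto
    fix j assume j: "j \<in> I"
    show "linear_on scale t ?K (f j)"
      by (rule linear_on_subset[of _ _ V]) (use insert.prems(2)[of j] j in auto)
    show "fin_dim t (U j) \<and> f j ` ?K \<subseteq> U j" using insert.prems(3)[of j] j by auto
  next
    fix v assume "v \<in> ?K" "\<And>j. j \<in> I \<Longrightarrow> f j v = 0"
    then show "v = 0" using insert.prems(4)[of v] by auto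
  qed
  then show ?case
    using fin_dim_kernel_image[OF t insert.prems(1), of "f i" "U i"] insert.prems(2,3)[of i] by simp
qed

text \<open>\<open>C\<close> is a basis of a complement of \<open>N\<close> in \<open>Z\<close>, and
  \<open>l\<close> consists of the dual coordinate forms, extended to all of \<open>V\<close>. Among
  the vectors of \<open>Z\<close> the forms detect membership in \<open>N\<close>, so they stand in
  for a basis of the dual of the quotient \<open>Z / N\<close>.\<close>

lemma fin_dim_relative_coordinates:
  assumes V: "fin_dim scale V" "subspace V" and N: "subspace N" and Z: "subspace Z"
    and NZ: "N \<subseteq> Z" "Z \<subseteq> V"
  obtains C l where "finite C" "C \<subseteq> Z" "\<And>c. linear_on scale (*) V (l c)"
    "\<And>c v. c \<in> C \<Longrightarrow> v \<in> N \<Longrightarrow> l c v = 0"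
    "\<And>c d. c \<in> C \<Longrightarrow> d \<in> C \<Longrightarrow> l c d = (if c = d then 1 else 0)"
    "\<And>z. z \<in> Z \<Longrightarrow> (\<And>c. c \<in> C \<Longrightarrow> l c z = 0) \<Longrightarrow> z \<in> N"
proof -
  \<comment> \<open>Nested bases \<open>B0\<close>, \<open>B1\<close>, \<open>B\<close> of
    \<open>N\<close>, \<open>Z\<close>, \<open>V\<close>: the coordinates at \<open>B1 - B0\<close>
    vanish on \<open>N\<close>, and a vector of \<open>Z\<close> on which they vanish has only
    coordinates from \<open>B0\<close>.\<close>
  obtain B0 where B0: "B0 \<subseteq> N" "independent B0" "N \<subseteq> span B0" using basis_exists by metis
  have "B0 \<subseteq> Z" using B0 NZ by auto
  then obtain B1 where B1: "B0 \<subseteq> B1" "B1 \<subseteq> Z" "independent B1" "Z \<subseteq> span B1"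
    using maximal_independent_subset_extend[of B0 Z] B0 by metis
  have "B1 \<subseteq> V" using B1 NZ by auto
  then obtain B where B: "B1 \<subseteq> B" "B \<subseteq> V" "independent B" "V \<subseteq> span B"
    using maximal_independent_subset_extend[of B1 V] B1 by metis
  have "finite B"
    using V(1) B(2,3) independent_span_bound unfolding fin_dim_def by metis
  let ?C = "B1 - B0" and ?l = "\<lambda>c v. representation B v c"
  show thesis
  proof
    show "finite ?C" using \<open>finite B\<close> B(1) finite_subset by auto
    show "?C \<subseteq> Z" using B1 by auto
    show "linear_on scale (*) V (?l c)" for c
      using B by (auto simp: linear_on_def subset_iff representation_add representation_scale)
    show "?l c v = 0" if "c \<in> ?C" "v \<in> N" for c v
    proof -
      have "representation B v = representation B0 v"
        using representation_extend[OF B(3), of v B0] B0 B1 B that by auto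
      then show ?thesis using that representation_ne_zero[of B0 v c] by auto
    qed
    show "?l c d = (if c = d then 1 else 0)" if "c \<in> ?C" "d \<in> ?C" for c d
      using representation_basis[OF B(3), of d] that B(1) by auto
    show "z \<in> N" if z: "z \<in> Z" and l: "\<And>c. c \<in> ?C \<Longrightarrow> ?l c z = 0" for z
    proof -
      have zB: "z \<in> span B1" "z \<in> span B" using z B1 B NZ by auto
      have "representation B z = representation B1 z"
        using representation_extend[OF B(3) zB(1) B(1)] .
      then have ne: "representation B z b \<noteq> 0 \<Longrightarrow> b \<in> B0" for b
        using l[of b] representation_ne_zero[of B1 z b] by auto
      have "z = (\<Sum>b\<in>B. scale (representation B z b) b)"
        using sum_representation_eq[OF B(3) zB(2) \<open>finite B\<close>] by simp
      also have "\<dots> \<in> N"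
      proof (rule subspace_sum[OF N])
        fix b
        show "scale (representation B z b) b \<in> N"
          using ne[of b] B0(1) N subspace_scale subspace_0 by (cases "representation B z b = 0") auto
      qed
      finally show ?thesis .
    qed
  qed
qed

end

section \<open>Krull--Schmidt decompositions in linear categories\<close>

text \<open>In a nonzero ring nilpotent elements have no one-sided inverses, so non-units are stable
  under multiplication from either side; they are stable under addition because the identity is not
  a sum of two nilpotent elements.\<close>

lemma (in ring) is_local_ring_if_units_or_nilpotent:
  assumes one: "\<one> \<noteq> \<zero>"
    and un: "\<And>a. a \<in> carrier R \<Longrightarrow> a \<notin> Units R \<Longrightarrow> \<exists>n::nat. a [^] n = \<zero>"
  shows "is_local_ring R"
proof -
  \<comment> \<open>A left inverse of \<open>a\<close> yields a left inverse of every power of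
    \<open>a\<close>, so no power of \<open>a\<close> can vanish.\<close>
  have pow1: "b [^] n \<otimes> a [^] n = \<one>"
    if "a \<in> carrier R" "b \<in> carrier R" "b \<otimes> a = \<one>" for a b and n :: nat
  proof (induction n)
    case (Suc n)
    have "b [^] Suc n \<otimes> a [^] Suc n = b [^] n \<otimes> (b \<otimes> a) \<otimes> a [^] n"
      using that(1,2) by (simp only: nat_pow_Suc2[OF that(1)]) (simp add: m_assoc)
    then show ?case using that Suc by simp
  qed simp
  have left: "r \<otimes> a \<notin> Units R" if a: "a \<in> carrier R" "a \<notin> Units R" and r: "r \<in> carrier R" for a r
  proof
    assume "r \<otimes> a \<in> Units R"
    then obtain u where u: "u \<in> carrier R" "u \<otimes> (r \<otimes> a) = \<one>" by (auto simp: Units_def)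
    obtain n :: nat where n: "a [^] n = \<zero>" using un a by blast
    show False using pow1[of a "u \<otimes> r" n] a r u n one by (simp add: m_assoc)
  qed
  have right: "a \<otimes> r \<notin> Units R" if a: "a \<in> carrier R" "a \<notin> Units R" and r: "r \<in> carrier R" for a r
  proof
    assume "a \<otimes> r \<in> Units R"
    then obtain u where u: "u \<in> carrier R" "a \<otimes> r \<otimes> u = \<one>" by (auto simp: Units_def)
    obtain n :: nat where n: "a [^] n = \<zero>" using un a by blast
    show False using pow1[of "r \<otimes> u" a n] a r u n one by (simp add: m_assoc)
  qed
  have zero: "\<zero> \<in> carrier R - Units R" using one by (auto simp: Units_def)
  have add: "a \<oplus> b \<notin> Units R"
    if a: "a \<in> carrier R" "a \<notin> Units R" and b: "b \<in> carrier R" "b \<notin> Units R" for a b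
  proof
    assume "a \<oplus> b \<in> Units R"
    then obtain u where u: "u \<in> carrier R" "u \<otimes> (a \<oplus> b) = \<one>" by (auto simp: Units_def)
    define c d where "c = u \<otimes> a" and "d = u \<otimes> b"
    have cd: "c \<in> carrier R" "d \<in> carrier R" "c \<oplus> d = \<one>"
      using a b u by (auto simp: c_def d_def r_distr[symmetric])
    have "\<exists>n::nat. c [^] n = \<zero>" "\<exists>n::nat. d [^] n = \<zero>"
      using un left a b u by (auto simp: c_def d_def)
    then obtain m :: nat where m: "d [^] m = \<zero>" and ex: "\<exists>n::nat. c [^] n = \<zero>" by blast
    \<comment> \<open>With \<open>n = Suc l\<close> the nilpotency index of \<open>c\<close>,
      multiplying \<open>c \<oplus> d = \<one>\<close> by \<open>c [^] l\<close> gives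
      \<open>c [^] l = c [^] l \<otimes> d\<close>. Iterating this contradicts the nilpotency of
      \<open>d\<close>.\<close>
    define n where "n = (LEAST n::nat. c [^] n = \<zero>)"
    have n: "c [^] n = \<zero>" unfolding n_def using ex by (rule LeastI_ex)
    then obtain l where l: "n = Suc l" using one by (cases n) auto
    have "c [^] l \<noteq> \<zero>" using l not_less_Least[of l "\<lambda>n. c [^] n = \<zero>"] unfolding n_def by auto
    have step: "c [^] l = c [^] l \<otimes> d"
    proof -
      have "c [^] l = c [^] l \<otimes> (c \<oplus> d)" using cd by simp
      also have "\<dots> = c [^] n \<oplus> c [^] l \<otimes> d" using cd(1,2) by (simp add: r_distr l)
      finally show ?thesis using n cd by simp
    qed
    have "c [^] l = c [^] l \<otimes> d [^] k" for k :: nat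
    proof (induction k)
      case (Suc k)
      have "c [^] l = c [^] l \<otimes> d [^] k \<otimes> d" using step Suc by simp
      then show ?case using cd by (simp add: m_assoc)
    qed (use cd in simp)
    from this[of m] \<open>c [^] l \<noteq> \<zero>\<close> show False using m cd by simp
  qed
  have neg: "\<ominus> a \<notin> Units R" if "a \<in> carrier R" "a \<notin> Units R" for a
    using left[OF that, of "\<ominus> \<one>"] that l_minus[of \<one> a] by simp
  show ?thesis
    unfolding is_local_ring_def
  proof (rule idealI)
    show "ring R" by (rule ring_axioms)
    show "subgroup (carrier R - Units R) (add_monoid R)"
      using zero add neg by unfold_locales (auto simp: a_inv_def)
  qed (use left right in auto)
qed

text \<open>All Hom-sets are subspaces of one vector space, on which composition is a total
  operation. Associativity and linearity in the left factor carry no side conditions, as they hold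
  for any pointwise composition of functions; linearity in the right factor relies on the left
  factor being linear, hence the membership hypotheses.\<close>

locale linear_category = vector_space scale
  for scale :: "'k::field \<Rightarrow> 'm::ab_group_add \<Rightarrow> 'm" (infixr \<open>*s\<close> 75) +
  fixes Ob :: "'o set" and H :: "'o \<Rightarrow> 'o \<Rightarrow> 'm set"
    and comp :: "'m \<Rightarrow> 'm \<Rightarrow> 'm" (infixl \<open>\<cdot>\<close> 70) and idt :: "'o \<Rightarrow> 'm"
  assumes subspace_H: "X \<in> Ob \<Longrightarrow> Y \<in> Ob \<Longrightarrow> subspace (H X Y)"
    and comp_H: "\<lbrakk>X \<in> Ob; Y \<in> Ob; Z \<in> Ob; f \<in> H X Y; g \<in> H Y Z\<rbrakk> \<Longrightarrow> g \<cdot> f \<in> H X Z"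
    and comp_assoc: "h \<cdot> g \<cdot> f = h \<cdot> (g \<cdot> f)"
    and add_comp: "(g + h) \<cdot> f = g \<cdot> f + h \<cdot> f"
    and comp_add: "\<lbrakk>X \<in> Ob; Y \<in> Ob; Z \<in> Ob; f \<in> H X Y; f' \<in> H X Y; g \<in> H Y Z\<rbrakk>
      \<Longrightarrow> g \<cdot> (f + f') = g \<cdot> f + g \<cdot> f'"
    and scale_comp: "(c *s g) \<cdot> f = c *s (g \<cdot> f)"
    and comp_scale: "\<lbrakk>X \<in> Ob; Y \<in> Ob; Z \<in> Ob; f \<in> H X Y; g \<in> H Y Z\<rbrakk>
      \<Longrightarrow> g \<cdot> (c *s f) = c *s (g \<cdot> f)"
    and idt_H: "X \<in> Ob \<Longrightarrow> idt X \<in> H X X"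
    and comp_idt: "\<lbrakk>X \<in> Ob; Y \<in> Ob; f \<in> H X Y\<rbrakk> \<Longrightarrow> f \<cdot> idt X = f"
    and idt_comp: "\<lbrakk>X \<in> Ob; Y \<in> Ob; f \<in> H X Y\<rbrakk> \<Longrightarrow> idt Y \<cdot> f = f"
begin

lemma zero_comp [simp]: "0 \<cdot> f = 0"
  using add_comp[of 0 0 f] by simp

lemma minus_comp: "(- g) \<cdot> f = - (g \<cdot> f)"
  using add_comp[of g "- g" f] by (simp add: eq_neg_iff_add_eq_0 add.commute)

lemma diff_comp: "(g - h) \<cdot> f = g \<cdot> f - h \<cdot> f"
  using add_comp[of g "- h" f] by (simp add: minus_comp)

lemma sum_comp: "(\<Sum>i\<in>A. g i) \<cdot> f = (\<Sum>i\<in>A. g i \<cdot> f)"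
  by (induction A rule: infinite_finite_induct) (auto simp: add_comp)

lemma zero_H: "X \<in> Ob \<Longrightarrow> Y \<in> Ob \<Longrightarrow> 0 \<in> H X Y"
  and add_H: "\<lbrakk>X \<in> Ob; Y \<in> Ob; f \<in> H X Y; g \<in> H X Y\<rbrakk> \<Longrightarrow> f + g \<in> H X Y"
  and diff_H: "\<lbrakk>X \<in> Ob; Y \<in> Ob; f \<in> H X Y; g \<in> H X Y\<rbrakk> \<Longrightarrow> f - g \<in> H X Y"
  and minus_H: "\<lbrakk>X \<in> Ob; Y \<in> Ob; f \<in> H X Y\<rbrakk> \<Longrightarrow> - f \<in> H X Y"
  and scale_H: "\<lbrakk>X \<in> Ob; Y \<in> Ob; f \<in> H X Y\<rbrakk> \<Longrightarrow> c *s f \<in> H X Y"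
  and sum_H: "\<lbrakk>X \<in> Ob; Y \<in> Ob; \<And>i. i \<in> A \<Longrightarrow> F i \<in> H X Y\<rbrakk> \<Longrightarrow> (\<Sum>i\<in>A. F i) \<in> H X Y"
  using subspace_H[of X Y] subspace_0 subspace_add subspace_diff subspace_neg subspace_scale
    subspace_sum[of "H X Y" A F] by auto

lemma comp_zero: "\<lbrakk>X \<in> Ob; Y \<in> Ob; Z \<in> Ob; g \<in> H Y Z\<rbrakk> \<Longrightarrow> g \<cdot> 0 = 0"
  using comp_add[of X Y Z 0 0 g] zero_H by simp

lemma comp_diff:
  assumes "X \<in> Ob" "Y \<in> Ob" "Z \<in> Ob" "f \<in> H X Y" "f' \<in> H X Y" "g \<in> H Y Z"
  shows "g \<cdot> (f - f') = g \<cdot> f - g \<cdot> f'"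
  using comp_add[of X Y Z "f - f'" f' g] assms diff_H by (simp add: eq_diff_eq)

lemma comp_sum:
  assumes "X \<in> Ob" "Y \<in> Ob" "Z \<in> Ob" "g \<in> H Y Z" "\<And>i. i \<in> A \<Longrightarrow> F i \<in> H X Y"
  shows "g \<cdot> (\<Sum>i\<in>A. F i) = (\<Sum>i\<in>A. g \<cdot> F i)"
  using assms(5)
proof (induction A rule: infinite_finite_induct)
  case (insert i A)
  then show ?case
    using assms(1-4) comp_add[OF assms(1-3) _ _ assms(4), of "F i" "sum F A"] sum_H[of X Y A F] by simp
qed (use assms comp_zero in auto)

definition End :: "'o \<Rightarrow> 'm ring" where
  "End X = \<lparr>carrier = H X X, mult = comp, one = idt X, zero = 0, add = (+)\<rparr>"

lemma End_simps [simp]: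
  "carrier (End X) = H X X" "mult (End X) = comp" "one (End X) = idt X" "zero (End X) = 0"
  "add (End X) = (+)"
  by (simp_all add: End_def)

lemma ring_End: "X \<in> Ob \<Longrightarrow> ring (End X)"
proof (intro ringI abelian_groupI monoidI)
  fix f assume "X \<in> Ob" "f \<in> carrier (End X)"
  then show "\<exists>y\<in>carrier (End X). y \<oplus>\<^bsub>End X\<^esub> f = \<zero>\<^bsub>End X\<^esub>"
    using minus_H by (intro bexI[of _ "- f"]) auto
qed (auto simp: zero_H add_H comp_H idt_H comp_idt idt_comp comp_assoc add_comp comp_add algebra_simps)

definition iso :: "'o \<Rightarrow> 'o \<Rightarrow> bool" where
  "iso X Y \<longleftrightarrow> (\<exists>f\<in>H X Y. \<exists>g\<in>H Y X. g \<cdot> f = idt X \<and> f \<cdot> g = idt Y)"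

lemma idt_nonzero_if_local:
  assumes "X \<in> Ob" "is_local_ring (End X)" shows "idt X \<noteq> 0"
proof
  assume "idt X = 0"
  then have "0 \<in> Units (End X)" using zero_H assms by (force simp: Units_def)
  then show False
    using assms(2) additive_subgroup.zero_closed[of "carrier (End X) - Units (End X)" "End X"]
    by (auto simp: is_local_ring_def ideal_def)
qed

text \<open>If all summands were non-units, so would be their sum, since the non-units form an
  ideal. This supplies the pivot of the exchange argument.\<close>

lemma unit_summand_if_local:
  assumes X: "X \<in> Ob" "is_local_ring (End X)" and A: "finite A"
    and f: "\<And>i. i \<in> A \<Longrightarrow> f i \<in> H X X" "(\<Sum>i\<in>A. f i) = idt X"
  shows "\<exists>i\<in>A. f i \<in> Units (End X)"
proof (rule ccontr)
  assume *: "\<not> ?thesis"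
  let ?N = "H X X - Units (End X)"
  have N: "additive_subgroup ?N (End X)" using X by (simp add: is_local_ring_def ideal_def)
  have "(\<Sum>i\<in>A. f i) \<in> ?N"
    using A f(1) *
  proof (induction A)
    case empty
    then show ?case using additive_subgroup.zero_closed[OF N] by simp
  next
    case (insert i A)
    then show ?case using additive_subgroup.a_closed[OF N, of "f i" "\<Sum>i\<in>A. f i"] by simp
  qed
  moreover have "idt X \<in> Units (End X)"
    using X idt_H comp_idt by (auto simp: Units_def)
  ultimately show False using f by simp
qed

text \<open>One of the complementary idempotents \<open>e\<close> and \<open>idt X - e\<close> is a
  unit, and an invertible idempotent is the identity.\<close>

lemma idempotent_if_local:
  assumes X: "X \<in> Ob" "is_local_ring (End X)" and e: "e \<in> H X X" "e \<cdot> e = e"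
  shows "e = 0 \<or> e = idt X"
proof -
  have unit: "f = idt X" if f: "f \<in> Units (End X)" "f \<cdot> f = f" for f
  proof -
    obtain g where g: "f \<in> H X X" "g \<in> H X X" "g \<cdot> f = idt X" using f by (auto simp: Units_def)
    then show ?thesis using f(2) comp_assoc[of g f f] idt_comp[of X X f] X by simp
  qed
  \<comment> \<open>The two truth values index the two summands of
    \<open>e + (idt X - e) = idt X\<close>.\<close>
  define f where "f b = (if b then e else idt X - e)" for b
  have "\<exists>b\<in>UNIV. f b \<in> Units (End X)"
    using X e by (intro unit_summand_if_local) (auto simp: f_def UNIV_bool diff_H idt_H)
  moreover have "(idt X - e) \<cdot> (idt X - e) = idt X - e"
    using X e by (simp add: diff_comp comp_diff[of X X X] idt_H idt_comp[of X X] comp_idt)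
  ultimately show ?thesis using unit[of e] unit[of "idt X - e"] e by (auto simp: f_def split: if_splits)
qed

text \<open>Fitting's lemma without kernels and images: finite dimension gives
  \<open>p m = p (Suc m) \<cdot> r\<close> for some power \<open>p m\<close> of \<open>f\<close> and
  some \<open>r\<close> commuting with \<open>f\<close>. Multiplying \<open>p m\<close> by the
  \<open>m\<close>-th power of \<open>r\<close> yields an idempotent \<open>e\<close> with
  \<open>p m \<cdot> e = p m\<close>. If \<open>e\<close> is zero, \<open>f\<close> is nilpotent; if
  \<open>e\<close> is the identity, \<open>f\<close> is invertible.\<close>

lemma is_local_ring_if_trivial_idempotents:
  assumes X: "X \<in> Ob" and fd: "fin_dim scale (H X X)" and nz: "idt X \<noteq> 0"
    and idem: "\<And>e. e \<in> H X X \<Longrightarrow> e \<cdot> e = e \<Longrightarrow> e = 0 \<or> e = idt X"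
  shows "is_local_ring (End X)"
proof -
  interpret R: ring "End X" by (rule ring_End[OF X])
  show ?thesis
  proof (rule R.is_local_ring_if_units_or_nilpotent)
    show "\<one>\<^bsub>End X\<^esub> \<noteq> \<zero>\<^bsub>End X\<^esub>" using nz by simp
  next
    fix f assume "f \<in> carrier (End X)" and nu: "f \<notin> Units (End X)"
    then have f: "f \<in> H X X" by simp
    define p where "p n = f [^]\<^bsub>End X\<^esub> n" for n :: nat
    have pH: "p n \<in> H X X" for n
      using R.nat_pow_closed[of f n] f by (simp add: p_def)
    have pp: "p m \<cdot> p n = p (m + n)" for m n
      using R.nat_pow_mult[of f m n] f by (simp add: p_def)
    have p0: "p 0 = idt X" and p1: "p 1 = f"
      using f X idt_comp[of X X f] by (simp_all add: p_def)
    \<comment> \<open>Otherwise adding the powers in descending order of exponents keeps them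
      independent, and \<open>Suc (card T)\<close> independent powers exceed the bound given by the
      spanning set \<open>T\<close>.\<close>
    have "\<exists>m. p m \<in> span (p ` {m<..})"
    proof (rule ccontr)
      assume *: "\<not> ?thesis"
      have ind: "independent (p ` {m..<N}) \<and> card (p ` {m..<N}) = N - m" if "m \<le> N" for m N
        using that
      proof (induction rule: inc_induct)
        case base
        then show ?case using independent_empty by simp
      next
        case (step m)
        have eq: "{m..<N} = insert m {Suc m..<N}" using step by auto
        have "p ` {Suc m..<N} \<subseteq> p ` {m<..}" by auto
        then have notin: "p m \<notin> span (p ` {Suc m..<N})" using * span_mono by blast
        then have "p m \<notin> p ` {Suc m..<N}" using span_base by blast
        then show ?case
          using step notin by (simp add: eq independent_insertI)
      qed
      obtain T where T: "finite T" "span T = H X X" using fd by (auto simp: fin_dim_def)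
      have "card (p ` {0..<Suc (card T)}) \<le> card T"
        using independent_span_bound[OF T(1)] ind[of 0 "Suc (card T)"] pH T(2) by blast
      then show False using ind[of 0 "Suc (card T)"] by simp
    qed
    then obtain m where m: "p m \<in> span (p ` {m<..})" by blast
    \<comment> \<open>The multiples of \<open>p (Suc m)\<close> by elements commuting with
      \<open>f\<close> form a subspace that contains all higher powers; hence a single
      \<open>r\<close> serves for their linear combination \<open>p m\<close>.\<close>
    let ?S = "{p (Suc m) \<cdot> r | r. r \<in> H X X \<and> r \<cdot> f = f \<cdot> r}"
    have "span (p ` {m<..}) \<subseteq> ?S"
    proof (rule span_minimal)
      show "p ` {m<..} \<subseteq> ?S"
      proof
        fix x assume "x \<in> p ` {m<..}"
        then obtain n where "n > m" "x = p n" by auto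
        then have "x = p (Suc m) \<cdot> p (n - Suc m)" by (simp add: pp)
        moreover have "p (n - Suc m) \<cdot> f = f \<cdot> p (n - Suc m)"
          using pp[of "n - Suc m" 1] pp[of 1 "n - Suc m"] unfolding p1 by simp
        ultimately show "x \<in> ?S" using pH by blast
      qed
      show "subspace ?S"
      proof (rule subspaceI)
        have "p (Suc m) \<cdot> 0 = 0" "f \<cdot> 0 = 0" using comp_zero[of X X X] X pH f by auto
        then show "0 \<in> ?S" using zero_H X by (auto intro!: exI[of _ 0])
      next
        fix x y assume "x \<in> ?S" "y \<in> ?S"
        then obtain r q where "r \<in> H X X" "r \<cdot> f = f \<cdot> r" "x = p (Suc m) \<cdot> r"
          "q \<in> H X X" "q \<cdot> f = f \<cdot> q" "y = p (Suc m) \<cdot> q" by blast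
        then show "x + y \<in> ?S"
          using X pH f comp_add[of X X X] add_H[of X X] by (auto simp: add_comp intro!: exI[of _ "r + q"])
      next
        fix c x assume "x \<in> ?S"
        then obtain r where "r \<in> H X X" "r \<cdot> f = f \<cdot> r" "x = p (Suc m) \<cdot> r" by blast
        then show "c *s x \<in> ?S"
          using X pH f comp_scale[of X X X] scale_H[of X X] by (auto simp: scale_comp intro!: exI[of _ "c *s r"])
      qed
    qed
    then obtain r where r: "r \<in> H X X" "r \<cdot> f = f \<cdot> r" and pm: "p m = p (Suc m) \<cdot> r" using m by blast
    define q where "q n = r [^]\<^bsub>End X\<^esub> n" for n :: nat
    have qH: "q n \<in> H X X" for n
      using R.nat_pow_closed[of r n] r by (simp add: q_def)
    have q0: "q 0 = idt X" and qS: "q (Suc n) = q n \<cdot> r" for n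
      by (simp_all add: q_def)
    have qq: "r \<cdot> q n = q n \<cdot> r" for n
      using R.nat_pow_Suc2[of r n] r by (simp add: q_def)
    have fr: "f \<cdot> q n = q n \<cdot> f" for n
      by (induction n) (use f X r in \<open>simp_all add: q0 qS comp_idt[of X X] idt_comp[of X X],
          metis comp_assoc r(2)\<close>)
    have pq: "p k \<cdot> q n = q n \<cdot> p k" for k n
    proof (induction k)
      case 0
      then show ?case using qH X by (simp add: p0 comp_idt[of X X] idt_comp[of X X])
    next
      case (Suc k)
      have "p (Suc k) = p k \<cdot> f" by (simp add: p_def)
      then show ?case by (metis Suc comp_assoc fr)
    qed
    \<comment> \<open>The relation \<open>p m = p (Suc m) \<cdot> r\<close> is substituted into
      itself \<open>k\<close> times; the case \<open>k = m\<close> is what makes \<open>e\<close>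
      idempotent.\<close>
    have pk: "p m = p (m + k) \<cdot> q k" for k
    proof (induction k)
      case 0
      then show ?case using pH X by (simp add: q0 comp_idt[of X X])
    next
      case (Suc k)
      have "p (m + k) = p k \<cdot> p (Suc m) \<cdot> r"
        using pp[of k m] pm by (simp add: add.commute comp_assoc)
      then have "p (m + k) = p (m + Suc k) \<cdot> r" by (simp add: pp add.commute)
      then show ?case using Suc by (simp add: qS qq[symmetric] comp_assoc)
    qed
    define e where "e = p m \<cdot> q m"
    have "p m \<cdot> e = p (m + m) \<cdot> q m" by (simp add: e_def comp_assoc[symmetric] pp)
    then have pe: "p m \<cdot> e = p m" using pk[of m] by simp
    have "e \<cdot> e = q m \<cdot> (p m \<cdot> e)" by (simp add: e_def pq comp_assoc)
    then have ee: "e \<cdot> e = e" using pe by (simp add: e_def pq)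
    have eH: "e \<in> H X X" using X pH qH comp_H by (auto simp: e_def)
    from idem[OF eH ee] show "\<exists>n::nat. f [^]\<^bsub>End X\<^esub> n = \<zero>\<^bsub>End X\<^esub>"
    proof
      assume "e = 0"
      then have "p m = 0" using pe comp_zero[of X X X "p m"] X pH by simp
      then show ?thesis by (auto simp: p_def)
    next
      assume e1: "e = idt X"
      \<comment> \<open>Moving one factor \<open>f\<close> out of \<open>p m\<close> gives
        \<open>e = f \<cdot> (e \<cdot> r)\<close>, so \<open>r\<close> inverts \<open>f\<close>;
        the inverse is two-sided because \<open>r\<close> commutes with \<open>f\<close>.\<close>
      have "p m = f \<cdot> (p m \<cdot> r)"
        using pm pp[of 1 m] unfolding p1 by (metis comp_assoc plus_1_eq_Suc)
      then have "e = f \<cdot> (p m \<cdot> r) \<cdot> q m" unfolding e_def by metis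
      also have "\<dots> = f \<cdot> (p m \<cdot> (q m \<cdot> r))" by (simp add: comp_assoc qq)
      also have "\<dots> = f \<cdot> (e \<cdot> r)" by (simp add: e_def comp_assoc)
      finally have "f \<cdot> r = idt X" using e1 X r by (simp add: idt_comp[of X X])
      then have "f \<in> Units (End X)" using f r by (auto simp: Units_def)
      then show ?thesis using nu by simp
    qed
  qed
qed

text \<open>
  Orthogonal nonzero idempotents of \<open>End M\<close> are linearly independent, so a family of such
  idempotents with sum \<open>1\<close> has bounded size; one of maximal size consists of primitive idempotents.
\<close>

lemma local_decomposition_exists:
  assumes M: "M \<in> Ob"
    and fd: "\<And>X. X \<in> Ob \<Longrightarrow> fin_dim scale (H X X)"
    and split: "\<And>e. e \<in> H M M \<Longrightarrow> e \<cdot> e = e \<Longrightarrow>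
      \<exists>Y\<in>Ob. \<exists>p\<in>H M Y. \<exists>i\<in>H Y M. p \<cdot> i = idt Y \<and> i \<cdot> p = e"
  shows "\<exists>n X i p. (\<forall>j<n::nat. X j \<in> Ob \<and> is_local_ring (End (X j)) \<and> i j \<in> H (X j) M \<and> p j \<in> H M (X j)) \<and>
    (\<forall>j<n. \<forall>l<n. p j \<cdot> i l = (if j = l then idt (X j) else 0)) \<and> (\<Sum>j<n. i j \<cdot> p j) = idt M"
proof -
  define ortho where "ortho E \<longleftrightarrow> finite E \<and> E \<subseteq> H M M \<and> 0 \<notin> E \<and>
    (\<forall>e\<in>E. \<forall>e'\<in>E. e \<cdot> e' = (if e = e' then e else 0)) \<and> \<Sum>E = idt M" for E
  obtain T where T: "finite T" "span T = H M M" using fd[OF M] by (auto simp: fin_dim_def)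
  have bound: "card E \<le> card T" if E: "ortho E" for E
  proof -
    have "independent E"
    proof (rule independent_if_scalars_zero)
      show "finite E" using E by (simp add: ortho_def)
      fix u e assume u: "(\<Sum>x\<in>E. u x *s x) = 0" and e: "e \<in> E"
      \<comment> \<open>By orthogonality, multiplying the relation by \<open>e\<close> on the right
        leaves only the term of \<open>e\<close>.\<close>
      have "0 = (\<Sum>x\<in>E. u x *s x) \<cdot> e" using u by simp
      also have "\<dots> = (\<Sum>x\<in>E. if x = e then u x *s x else 0)"
        using E e unfolding sum_comp scale_comp by (intro sum.cong) (auto simp: ortho_def)
      also have "\<dots> = u e *s e" using E e by (simp add: ortho_def)
      finally show "u e = 0" using E e by (auto simp: ortho_def)
    qed
    then show ?thesis using independent_span_bound[OF T(1)] T(2) E by (auto simp: ortho_def)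
  qed
  \<comment> \<open>Removing \<open>0\<close> covers a zero object \<open>M\<close>, which receives
    the empty decomposition.\<close>
  have "ortho ({idt M} - {0})"
    using M idt_H[OF M] comp_idt[OF M M idt_H[OF M]] by (cases "idt M = 0") (auto simp: ortho_def)
  then have "\<exists>E. ortho E \<and> (\<forall>E'. ortho E' \<longrightarrow> card E' \<le> card E)"
    using ex_has_greatest_nat[of ortho _ card "Suc (card T)"] bound by (metis le_imp_less_Suc)
  then obtain E where E: "ortho E" and max: "\<And>E'. ortho E' \<Longrightarrow> card E' \<le> card E" by blast
  have finE: "finite E" and EH: "\<And>e. e \<in> E \<Longrightarrow> e \<in> H M M" and E0: "0 \<notin> E"
    and Eo: "\<And>e e'. e \<in> E \<Longrightarrow> e' \<in> E \<Longrightarrow> e \<cdot> e' = (if e = e' then e else 0)"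
    and Es: "\<Sum>E = idt M"
    using E by (auto simp: ortho_def)
  \<comment> \<open>Replacing \<open>e\<close> by two nonzero orthogonal idempotents with sum
    \<open>e\<close> would enlarge the maximal family \<open>E\<close>.\<close>
  have prim: "a = 0 \<or> b = 0"
    if e: "e \<in> E" and ab: "a \<in> H M M" "b \<in> H M M" "a \<cdot> a = a" "b \<cdot> b = b" "a \<cdot> b = 0" "b \<cdot> a = 0" "a + b = e"
    for e a b
  proof (rule ccontr)
    assume nz: "\<not> (a = 0 \<or> b = 0)"
    have ea: "e \<cdot> a = a" "a \<cdot> e = a" "e \<cdot> b = b" "b \<cdot> e = b"
      using ab M by (auto simp: ab(7)[symmetric] add_comp comp_add[of M M M])
    have orth: "x \<cdot> e' = 0" "e' \<cdot> x = 0" if "e' \<in> E - {e}" "x = a \<or> x = b" for x e'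
    proof -
      have x: "e \<cdot> x = x" "x \<cdot> e = x" "x \<in> H M M" using that ea ab by auto
      have "e \<cdot> e' = 0" "e' \<cdot> e = 0" using Eo[of e e'] Eo[of e' e] e that by auto
      then show "x \<cdot> e' = 0" "e' \<cdot> x = 0"
        using x comp_assoc[of x e e'] comp_assoc[of e' e x] comp_zero[of M M M x] M by auto
    qed
    have notin: "a \<notin> E - {e}" "b \<notin> E - {e}" "a \<noteq> b"
      using orth(1)[of a a] orth(1)[of b b] ab nz by auto
    let ?E' = "insert a (insert b (E - {e}))"
    have "ortho ?E'"
      unfolding ortho_def
    proof (intro conjI ballI)
      show "\<Sum>?E' = idt M"
        using notin finE e Es ab(7) by (simp add: sum_diff1 algebra_simps)
      fix x y assume "x \<in> ?E'" "y \<in> ?E'"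
      then show "x \<cdot> y = (if x = y then x else 0)"
        using orth ab notin Eo by (elim insertE) auto
    qed (use finE EH E0 ab nz in auto)
    moreover have "card ?E' = Suc (card E)"
      using notin finE e by (simp add: card_Suc_Diff1 del: card_Diff_insert card_Diff_singleton)
    ultimately show False using max[of ?E'] by simp
  qed
  have "\<forall>e\<in>E. \<exists>Y p i. Y \<in> Ob \<and> p \<in> H M Y \<and> i \<in> H Y M \<and> p \<cdot> i = idt Y \<and> i \<cdot> p = e"
    using split EH Eo by (metis (full_types))
  then obtain Y p i where Y: "\<And>e. e \<in> E \<Longrightarrow> Y e \<in> Ob \<and> p e \<in> H M (Y e) \<and> i e \<in> H (Y e) M \<and>
      p e \<cdot> i e = idt (Y e) \<and> i e \<cdot> p e = e"
    by metis
  \<comment> \<open>An idempotent \<open>g\<close> of the summand and its complement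
    \<open>h\<close> transport to \<open>?i \<cdot> g \<cdot> ?p\<close> and
    \<open>?i \<cdot> h \<cdot> ?p\<close>, which split \<open>e\<close>. By \<open>prim\<close> one
    of these vanishes, and composing it with \<open>?p\<close> and \<open>?i\<close> shows that
    \<open>g\<close> or \<open>h\<close> is zero.\<close>
  have loc: "is_local_ring (End (Y e))" if e: "e \<in> E" for e
  proof (rule is_local_ring_if_trivial_idempotents)
    let ?p = "p e" and ?i = "i e"
    show YO: "Y e \<in> Ob" and "fin_dim scale (H (Y e) (Y e))" using Y e fd by auto
    have pH: "?p \<in> H M (Y e)" and iH: "?i \<in> H (Y e) M" and pi: "?p \<cdot> ?i = idt (Y e)" and ip: "?i \<cdot> ?p = e"
      using Y e by auto
    show "idt (Y e) \<noteq> 0"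
    proof
      assume "idt (Y e) = 0"
      then have "?p = 0" using idt_comp[OF M YO pH] by simp
      then have "e = 0" using ip comp_zero[OF M YO M iH] by simp
      then show False using e E0 by simp
    qed
    fix g assume g: "g \<in> H (Y e) (Y e)" "g \<cdot> g = g"
    define h where "h = idt (Y e) - g"
    have h: "h \<in> H (Y e) (Y e)" "h \<cdot> h = h" "g \<cdot> h = 0" "h \<cdot> g = 0" "g + h = idt (Y e)"
      using g YO by (auto simp: h_def diff_H idt_H diff_comp comp_diff[of "Y e" "Y e" "Y e"]
          idt_comp[of "Y e" "Y e"] comp_idt[of "Y e" "Y e"])
    have mid: "(?i \<cdot> x \<cdot> ?p) \<cdot> (?i \<cdot> y \<cdot> ?p) = ?i \<cdot> (x \<cdot> y) \<cdot> ?p"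
      if "x \<in> H (Y e) (Y e)" "y \<in> H (Y e) (Y e)" for x y
      using that pi idt_comp[OF YO YO that(2)] by (metis comp_assoc)
    have recover: "?p \<cdot> (?i \<cdot> x \<cdot> ?p) \<cdot> ?i = x" if "x \<in> H (Y e) (Y e)" for x
      using that pi idt_comp[OF YO YO that] comp_idt[OF YO YO that] by (metis comp_assoc)
    have z: "?i \<cdot> 0 \<cdot> ?p = 0" "?p \<cdot> 0 \<cdot> ?i = 0"
      using comp_zero[OF YO YO M iH] comp_zero[OF M M YO pH] by simp_all
    have "?i \<cdot> g \<cdot> ?p + ?i \<cdot> h \<cdot> ?p = ?i \<cdot> (g + h) \<cdot> ?p"
      using comp_add[OF YO YO M g(1) h(1) iH] by (simp add: add_comp)
    also have "\<dots> = e" using h ip comp_idt[OF YO M iH] by simp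
    finally have "?i \<cdot> g \<cdot> ?p = 0 \<or> ?i \<cdot> h \<cdot> ?p = 0"
      using g h M YO pH iH z e by (intro prim[of e]) (auto simp: mid intro: comp_H)
    then have "g = 0 \<or> h = 0" using recover[OF g(1)] recover[OF h(1)] z by auto
    then show "g = 0 \<or> g = idt (Y e)" by (auto simp: h_def)
  qed
  have pi: "p e \<cdot> i e' = (if e = e' then idt (Y e) else 0)" if "e \<in> E" "e' \<in> E" for e e'
  proof (cases "e = e'")
    case False
    \<comment> \<open>Writing \<open>p e\<close> as \<open>p e \<cdot> i e \<cdot> p e\<close>, and
      similarly for \<open>i e'\<close>, exposes the product \<open>e \<cdot> e'\<close> of
      orthogonal idempotents.\<close>
    have "p e \<cdot> i e' = (p e \<cdot> i e \<cdot> p e) \<cdot> (i e' \<cdot> p e' \<cdot> i e')"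
      using Y[OF that(1)] Y[OF that(2)] idt_comp[of M "Y e" "p e"] comp_idt[of "Y e'" M "i e'"] M
      by (metis comp_assoc)
    also have "\<dots> = p e \<cdot> (e \<cdot> e') \<cdot> i e'"
      using Y[OF that(1)] Y[OF that(2)] by (metis comp_assoc)
    also have "\<dots> = 0" using Eo[OF that] False Y[OF that(1)] comp_zero[of M M "Y e"] M by simp
    finally show ?thesis using False by simp
  qed (use Y that in auto)
  obtain b where b: "bij_betw b {..<card E} E"
    using ex_bij_betw_nat_finite[OF finE] by (auto simp: atLeast0LessThan)
  have bE: "b j \<in> E" if "j < card E" for j using b that by (auto simp: bij_betw_def)
  have "(\<Sum>j<card E. i (b j) \<cdot> p (b j)) = (\<Sum>e\<in>E. i e \<cdot> p e)"
    using sum.reindex_bij_betw[OF b] by simp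
  also have "\<dots> = idt M" using Y Es by simp
  finally have s: "(\<Sum>j<card E. i (b j) \<cdot> p (b j)) = idt M" .
  have "b j = b l \<longleftrightarrow> j = l" if "j < card E" "l < card E" for j l
    using b that by (auto simp: bij_betw_def inj_on_def)
  then show ?thesis
    using bE Y loc pi s
    by (intro exI[of _ "card E"] exI[of _ "\<lambda>j. Y (b j)"] exI[of _ "\<lambda>j. i (b j)"] exI[of _ "\<lambda>j. p (b j)"]) auto
qed

text \<open>
  The matrices \<open>h\<close> and \<open>k\<close> describe mutually inverse isomorphisms between the direct sums of the
  \<open>X i\<close> and of the \<open>Y j\<close>. Locality provides an invertible entry \<open>h i0 j0\<close>, and one step of
  Gaussian elimination with this pivot removes \<open>X i0\<close> and \<open>Y j0\<close>.
\<close>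

lemma local_decomposition_unique:
  assumes "finite I" "finite J"
    and "\<And>i. i \<in> I \<Longrightarrow> X i \<in> Ob \<and> is_local_ring (End (X i))"
    and "\<And>j. j \<in> J \<Longrightarrow> Y j \<in> Ob \<and> is_local_ring (End (Y j))"
    and "\<And>i j. i \<in> I \<Longrightarrow> j \<in> J \<Longrightarrow> h i j \<in> H (X i) (Y j)"
    and "\<And>i j. i \<in> I \<Longrightarrow> j \<in> J \<Longrightarrow> k j i \<in> H (Y j) (X i)"
    and "\<And>i i'. i \<in> I \<Longrightarrow> i' \<in> I \<Longrightarrow> (\<Sum>j\<in>J. k j i' \<cdot> h i j) = (if i = i' then idt (X i) else 0)"
    and "\<And>j j'. j \<in> J \<Longrightarrow> j' \<in> J \<Longrightarrow> (\<Sum>i\<in>I. h i j' \<cdot> k j i) = (if j = j' then idt (Y j) else 0)"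
  shows "\<exists>b. bij_betw b I J \<and> (\<forall>i\<in>I. iso (X i) (Y (b i)))"
  using assms
proof (induction I arbitrary: J h k)
  case empty
  \<comment> \<open>For \<open>j\<close> in \<open>J\<close> the second matrix identity would
    express \<open>idt (Y j)\<close> as an empty sum.\<close>
  then have "J = {}" using idt_nonzero_if_local by fastforce
  then show ?case by (auto simp: bij_betw_def)
next
  case (insert i0 I)
  note X = insert.prems(2) and Y = insert.prems(3) and hH = insert.prems(4) and kH = insert.prems(5)
    and kh = insert.prems(6) and hk = insert.prems(7)
  have X0: "X i0 \<in> Ob" "is_local_ring (End (X i0))" using X by auto
  have "\<exists>j\<in>J. k j i0 \<cdot> h i0 j \<in> Units (End (X i0))"
  proof (rule unit_summand_if_local[OF X0 insert.prems(1)])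
    show "k j i0 \<cdot> h i0 j \<in> H (X i0) (X i0)" if "j \<in> J" for j
      using comp_H[of "X i0" "Y j" "X i0"] X0 Y hH kH that by simp
    show "(\<Sum>j\<in>J. k j i0 \<cdot> h i0 j) = idt (X i0)" using kh[of i0 i0] by simp
  qed
  then obtain j0 where j0: "j0 \<in> J" and unit: "k j0 i0 \<cdot> h i0 j0 \<in> Units (End (X i0))" by blast
  have Y0: "Y j0 \<in> Ob" "is_local_ring (End (Y j0))" using Y j0 by auto
  define a where "a = h i0 j0"
  have aH: "a \<in> H (X i0) (Y j0)" and kH0: "k j0 i0 \<in> H (Y j0) (X i0)" using hH kH j0 by (auto simp: a_def)
  obtain u where u: "u \<in> H (X i0) (X i0)" "u \<cdot> (k j0 i0 \<cdot> a) = idt (X i0)"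
    using unit by (auto simp: Units_def a_def)
  define ai where "ai = u \<cdot> k j0 i0"
  have aiH: "ai \<in> H (Y j0) (X i0)" using u kH0 X0 Y0 comp_H by (auto simp: ai_def)
  have aia: "ai \<cdot> a = idt (X i0)" using u by (simp add: ai_def comp_assoc)
  \<comment> \<open>As \<open>ai\<close> is a left inverse of \<open>a\<close>, the product
    \<open>a \<cdot> ai\<close> is a nonzero idempotent of the local ring \<open>End (Y j0)\<close>,
    hence the identity; so the pivot \<open>a\<close> is an isomorphism.\<close>
  have "(a \<cdot> ai) \<cdot> (a \<cdot> ai) = a \<cdot> (ai \<cdot> a) \<cdot> ai" by (simp add: comp_assoc)
  also have "\<dots> = a \<cdot> ai" using aia comp_idt[OF X0(1) Y0(1) aH] by simp
  finally have "a \<cdot> ai = 0 \<or> a \<cdot> ai = idt (Y j0)"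
    using idempotent_if_local[OF Y0] comp_H[OF Y0(1) X0(1) Y0(1) aiH aH] by simp
  moreover have "a \<cdot> ai \<noteq> 0"
  proof
    assume "a \<cdot> ai = 0"
    then have "ai \<cdot> 0 \<cdot> a = ai \<cdot> a \<cdot> (ai \<cdot> a)" by (metis comp_assoc)
    then have "idt (X i0) = 0"
      using comp_zero[OF Y0(1) Y0(1) X0(1) aiH] aia comp_idt[OF X0(1) X0(1) idt_H[OF X0(1)]] by simp
    then show False using idt_nonzero_if_local X0 by simp
  qed
  ultimately have aai: "a \<cdot> ai = idt (Y j0)" by simp
  have iso0: "iso (X i0) (Y j0)" using aH aiH aia aai by (auto simp: iso_def)
  \<comment> \<open>The Schur complement of the pivot. The matrix \<open>k\<close> is kept
    unchanged, because the inverse of a Schur complement is the corresponding block of the inverse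
    matrix.\<close>
  define h' where "h' i j = h i j - h i0 j \<cdot> (ai \<cdot> h i j0)" for i j
  have "\<exists>b. bij_betw b I (J - {j0}) \<and> (\<forall>i\<in>I. iso (X i) (Y (b i)))"
  proof (rule insert.IH)
    show "finite (J - {j0})" using insert.prems(1) by simp
    show "X i \<in> Ob \<and> is_local_ring (End (X i))" if "i \<in> I" for i using X that by simp
    show "Y j \<in> Ob \<and> is_local_ring (End (Y j))" if "j \<in> J - {j0}" for j using Y that by simp
    show "k j i \<in> H (Y j) (X i)" if "i \<in> I" "j \<in> J - {j0}" for i j using kH that by simp
    have mid: "ai \<cdot> h i j0 \<in> H (X i) (X i0)" if "i \<in> I" for i
      using comp_H[of "X i" "Y j0" "X i0"] X that Y0 X0 hH j0 aiH by simp
    have mid2: "h i0 j \<cdot> (ai \<cdot> h i j0) \<in> H (X i) (Y j)" if "i \<in> I" "j \<in> J" for i j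
      using comp_H[of "X i" "X i0" "Y j"] X that Y X0 hH mid by simp
    show "h' i j \<in> H (X i) (Y j)" if "i \<in> I" "j \<in> J - {j0}" for i j
      using that X Y hH mid2 diff_H by (simp add: h'_def)
    show "(\<Sum>j\<in>J - {j0}. k j i' \<cdot> h' i j) = (if i = i' then idt (X i) else 0)"
      if i: "i \<in> I" "i' \<in> I" for i i'
    proof -
      have OX: "X i \<in> Ob" "X i' \<in> Ob" "h i j0 \<in> H (X i) (Y j0)" "k j0 i' \<in> H (Y j0) (X i')"
        "i' \<noteq> i0" using X i hH kH j0 insert.hyps by auto
      let ?m = "ai \<cdot> h i j0"
      have "(\<Sum>j\<in>J - {j0}. k j i' \<cdot> h' i j) = (\<Sum>j\<in>J - {j0}. k j i' \<cdot> h i j - k j i' \<cdot> h i0 j \<cdot> ?m)"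
      proof (rule sum.cong[OF refl])
        fix j assume j: "j \<in> J - {j0}"
        have "k j i' \<cdot> h' i j = k j i' \<cdot> h i j - k j i' \<cdot> (h i0 j \<cdot> ?m)"
          unfolding h'_def
          by (rule comp_diff[OF OX(1) _ OX(2)]) (use Y j i hH kH mid2 in auto)
        then show "k j i' \<cdot> h' i j = k j i' \<cdot> h i j - k j i' \<cdot> h i0 j \<cdot> ?m" by (simp add: comp_assoc)
      qed
      also have "\<dots> = (\<Sum>j\<in>J - {j0}. k j i' \<cdot> h i j) - (\<Sum>j\<in>J - {j0}. k j i' \<cdot> h i0 j) \<cdot> ?m"
        by (simp add: sum_subtractf sum_comp)
      also have "(\<Sum>j\<in>J - {j0}. k j i' \<cdot> h i j) = (if i = i' then idt (X i) else 0) - k j0 i' \<cdot> h i j0"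
        using kh[of i i'] i insert.prems(1) j0 by (simp add: sum_diff1)
      \<comment> \<open>Since \<open>i'\<close> differs from \<open>i0\<close>, the sum over all of
        \<open>J\<close> is zero, which leaves minus the term at \<open>j0\<close>.\<close>
      also have "(\<Sum>j\<in>J - {j0}. k j i' \<cdot> h i0 j) = - (k j0 i' \<cdot> a)"
        using kh[of i0 i'] i insert.prems(1) j0 OX by (simp add: sum_diff1 a_def)
      also have "- (k j0 i' \<cdot> a) \<cdot> ?m = - (k j0 i' \<cdot> ((a \<cdot> ai) \<cdot> h i j0))"
        by (simp add: minus_comp comp_assoc)
      also have "\<dots> = - (k j0 i' \<cdot> h i j0)"
        using aai OX idt_comp[of "X i" "Y j0" "h i j0"] Y0 by simp
      finally show ?thesis by simp
    qed
    show "(\<Sum>i\<in>I. h' i j' \<cdot> k j i) = (if j = j' then idt (Y j) else 0)"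
      if j: "j \<in> J - {j0}" "j' \<in> J - {j0}" for j j'
    proof -
      have OY: "Y j \<in> Ob" "Y j' \<in> Ob" "h i0 j' \<in> H (X i0) (Y j')" "k j i0 \<in> H (Y j) (X i0)"
        using Y j hH kH by auto
      have *: "(\<Sum>i\<in>I. h i l \<cdot> k j i) = (if j = l then idt (Y j) else 0) - h i0 l \<cdot> k j i0"
        if "l \<in> J" for l
        using hk[of j l] j that insert.hyps by (auto simp: eq_diff_eq add.commute)
      have mem: "h i j0 \<cdot> k j i \<in> H (Y j) (Y j0)" if "i \<in> I" for i
        using comp_H[of "Y j" "X i" "Y j0"] X Y0 OY that j j0 hH kH by simp
      have mem0: "a \<cdot> k j i0 \<in> H (Y j) (Y j0)" using comp_H[OF OY(1) X0(1) Y0(1) OY(4) aH] .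
      have "(\<Sum>i\<in>I. h' i j' \<cdot> k j i) = (\<Sum>i\<in>I. h i j' \<cdot> k j i) - (\<Sum>i\<in>I. h i0 j' \<cdot> ai \<cdot> (h i j0 \<cdot> k j i))"
        by (simp add: h'_def diff_comp sum_subtractf comp_assoc)
      also have "(\<Sum>i\<in>I. h i0 j' \<cdot> ai \<cdot> (h i j0 \<cdot> k j i)) = h i0 j' \<cdot> ai \<cdot> (\<Sum>i\<in>I. h i j0 \<cdot> k j i)"
        using comp_sum[OF OY(1) Y0(1) OY(2) comp_H[OF Y0(1) X0(1) OY(2) aiH OY(3)], of I "\<lambda>i. h i j0 \<cdot> k j i"] mem
        by simp
      also have "(\<Sum>i\<in>I. h i j0 \<cdot> k j i) = - (a \<cdot> k j i0)" using *[OF j0] j by (auto simp: a_def)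
      also have "h i0 j' \<cdot> ai \<cdot> (- (a \<cdot> k j i0)) = - (h i0 j' \<cdot> ai \<cdot> (a \<cdot> k j i0))"
        using comp_diff[OF OY(1) Y0(1) OY(2) zero_H[OF OY(1) Y0(1)] mem0 comp_H[OF Y0(1) X0(1) OY(2) aiH OY(3)]]
          comp_zero[OF OY(1) Y0(1) OY(2) comp_H[OF Y0(1) X0(1) OY(2) aiH OY(3)]] by simp
      also have "h i0 j' \<cdot> ai \<cdot> (a \<cdot> k j i0) = h i0 j' \<cdot> ((ai \<cdot> a) \<cdot> k j i0)" by (simp add: comp_assoc)
      also have "\<dots> = h i0 j' \<cdot> k j i0" using aia idt_comp[OF OY(1) X0(1) OY(4)] by simp
      finally show ?thesis using *[of j'] j by simp
    qed
  qed
  then obtain b where b: "bij_betw b I (J - {j0})" "\<forall>i\<in>I. iso (X i) (Y (b i))" by blast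
  have b': "bij_betw (b(i0 := j0)) (insert i0 I) J"
  proof -
    have "bij_betw (b(i0 := j0)) I (J - {j0})"
      using b(1) insert.hyps by (subst bij_betw_cong[of I _ b]) auto
    moreover have "J = insert j0 (J - {j0})" using j0 by auto
    ultimately show ?thesis
      using notIn_Un_bij_betw[of i0 I "b(i0 := j0)" "J - {j0}"] insert.hyps by simp
  qed
  show ?case
  proof (intro exI[of _ "b(i0 := j0)"] conjI ballI)
    fix i assume "i \<in> insert i0 I"
    then show "iso (X i) (Y ((b(i0 := j0)) i))" using iso0 b(2) by (cases "i = i0") auto
  qed (rule b')
qed

lemma full_subcategory: "C \<subseteq> Ob \<Longrightarrow> linear_category scale C H comp idt"
  by unfold_locales
    (auto simp: comp_assoc add_comp scale_comp subset_iff subspace_H idt_H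
      intro: comp_H comp_add comp_scale comp_idt idt_comp)

text \<open>The matrices \<open>p' b \<cdot> i a\<close> and \<open>p a \<cdot> i' b\<close> express
  the identity of \<open>M\<close> with respect to the two decompositions, so they are inverse to
  each other.\<close>

lemma local_biproducts_unique:
  assumes M: "M \<in> Ob" and fin: "finite I" "finite J"
    and X: "\<And>a. a \<in> I \<Longrightarrow> X a \<in> Ob \<and> is_local_ring (End (X a)) \<and> i a \<in> H (X a) M \<and> p a \<in> H M (X a)"
    and Y: "\<And>b. b \<in> J \<Longrightarrow> Y b \<in> Ob \<and> is_local_ring (End (Y b)) \<and> i' b \<in> H (Y b) M \<and> p' b \<in> H M (Y b)"
    and pi: "\<And>a a'. a \<in> I \<Longrightarrow> a' \<in> I \<Longrightarrow> p a \<cdot> i a' = (if a = a' then idt (X a) else 0)"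
    and pi': "\<And>b b'. b \<in> J \<Longrightarrow> b' \<in> J \<Longrightarrow> p' b \<cdot> i' b' = (if b = b' then idt (Y b) else 0)"
    and ip: "(\<Sum>a\<in>I. i a \<cdot> p a) = idt M" and ip': "(\<Sum>b\<in>J. i' b \<cdot> p' b) = idt M"
  shows "\<exists>c. bij_betw c I J \<and> (\<forall>a\<in>I. iso (X a) (Y (c a)))"
proof (rule local_decomposition_unique[where h = "\<lambda>a b. p' b \<cdot> i a" and k = "\<lambda>b a. p a \<cdot> i' b", OF fin])
  \<comment> \<open>Contraction of a matrix product: the inner factors
    \<open>j b \<cdot> o' b\<close> add up to \<open>idt M\<close>.\<close>
  have *: "(\<Sum>b\<in>K. g b \<cdot> q b) = q0 \<cdot> r0"
    if "\<And>b. b \<in> K \<Longrightarrow> g b \<cdot> q b = q0 \<cdot> (j b \<cdot> o' b) \<cdot> r0" "finite K" "Z \<in> Ob" "q0 \<in> H M Z"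
      "\<And>b. b \<in> K \<Longrightarrow> j b \<cdot> o' b \<in> H M M" "(\<Sum>b\<in>K. j b \<cdot> o' b) = idt M" for K :: "'x set" and g q q0 j o' r0 Z
  proof -
    have "(\<Sum>b\<in>K. g b \<cdot> q b) = (\<Sum>b\<in>K. q0 \<cdot> (j b \<cdot> o' b)) \<cdot> r0"
      using that(1) by (simp add: sum_comp)
    also have "\<dots> = q0 \<cdot> idt M \<cdot> r0"
      using comp_sum[of M M Z q0 K "\<lambda>b. j b \<cdot> o' b"] M that by simp
    finally show ?thesis using comp_idt[OF M that(3,4)] by simp
  qed
  have ipH: "i a \<cdot> p a \<in> H M M" if "a \<in> I" for a
    using comp_H[OF M _ M, of "X a" "p a" "i a"] X[OF that] by simp
  have ipH': "i' b \<cdot> p' b \<in> H M M" if "b \<in> J" for b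
    using comp_H[OF M _ M, of "Y b" "p' b" "i' b"] Y[OF that] by simp
  show "(\<Sum>b\<in>J. (p a' \<cdot> i' b) \<cdot> (p' b \<cdot> i a)) = (if a = a' then idt (X a) else 0)"
    if "a \<in> I" "a' \<in> I" for a a'
  proof -
    have "(\<Sum>b\<in>J. (p a' \<cdot> i' b) \<cdot> (p' b \<cdot> i a)) = p a' \<cdot> i a"
      by (rule *[of J _ _ _ i' p' _ "X a'"]) (use that X fin ip' ipH' in \<open>auto simp: comp_assoc\<close>)
    then show ?thesis using pi that by simp
  qed
  show "(\<Sum>a\<in>I. (p' b' \<cdot> i a) \<cdot> (p a \<cdot> i' b)) = (if b = b' then idt (Y b) else 0)"
    if "b \<in> J" "b' \<in> J" for b b'
  proof -
    have "(\<Sum>a\<in>I. (p' b' \<cdot> i a) \<cdot> (p a \<cdot> i' b)) = p' b' \<cdot> i' b"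
      by (rule *[of I _ _ _ i p _ "Y b'"]) (use that Y fin ip ipH in \<open>auto simp: comp_assoc\<close>)
    then show ?thesis using pi' that by simp
  qed
qed (use M X Y comp_H[of _ M] in auto)

end

section \<open>The category of representations\<close>

lemma HomI:
  assumes "\<And>x u. x \<in> verts Q \<Longrightarrow> u \<in> sp M x \<Longrightarrow> f x u \<in> sp N x"
    and "\<And>x. x \<in> verts Q \<Longrightarrow> linear_on s t (sp M x) (f x)"
    and "\<And>\<alpha> u. \<alpha> \<in> arcs Q \<Longrightarrow> u \<in> sp M (tail Q \<alpha>) \<Longrightarrow>
      f (head Q \<alpha>) (act M \<alpha> u) = act N \<alpha> (f (tail Q \<alpha>) u)"
    and "\<And>x u. x \<notin> verts Q \<or> u \<notin> sp M x \<Longrightarrow> f x u = 0"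
  shows "f \<in> Hom Q s t M N"
  using assms by (auto simp: Hom_def)

lemma Hom_in_sp: "f \<in> Hom Q s t M N \<Longrightarrow> x \<in> verts Q \<Longrightarrow> u \<in> sp M x \<Longrightarrow> f x u \<in> sp N x"
  and Hom_linear: "f \<in> Hom Q s t M N \<Longrightarrow> x \<in> verts Q \<Longrightarrow> linear_on s t (sp M x) (f x)"
  and Hom_act: "f \<in> Hom Q s t M N \<Longrightarrow> \<alpha> \<in> arcs Q \<Longrightarrow> u \<in> sp M (tail Q \<alpha>) \<Longrightarrow>
    f (head Q \<alpha>) (act M \<alpha> u) = act N \<alpha> (f (tail Q \<alpha>) u)"
  and Hom_outside: "f \<in> Hom Q s t M N \<Longrightarrow> x \<notin> verts Q \<or> u \<notin> sp M x \<Longrightarrow> f x u = 0"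
  by (auto simp: Hom_def)

lemma rep_subspace: "M \<in> rep Q s \<Longrightarrow> x \<in> verts Q \<Longrightarrow> module.subspace s (sp M x)"
  and rep_fin_dim: "M \<in> rep Q s \<Longrightarrow> x \<in> verts Q \<Longrightarrow> fin_dim s (sp M x)"
  and rep_act_in_sp: "M \<in> rep Q s \<Longrightarrow> \<alpha> \<in> arcs Q \<Longrightarrow> u \<in> sp M (tail Q \<alpha>) \<Longrightarrow> act M \<alpha> u \<in> sp M (head Q \<alpha>)"
  and rep_act_linear: "M \<in> rep Q s \<Longrightarrow> \<alpha> \<in> arcs Q \<Longrightarrow> linear_on s s (sp M (tail Q \<alpha>)) (act M \<alpha>)"
  by (auto simp: rep_def)

lemma repI:
  assumes "\<And>x. x \<in> verts Q \<Longrightarrow> module.subspace s (sp M x)"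
    and "\<And>x. x \<in> verts Q \<Longrightarrow> fin_dim s (sp M x)"
    and "\<And>\<alpha> u. \<alpha> \<in> arcs Q \<Longrightarrow> u \<in> sp M (tail Q \<alpha>) \<Longrightarrow> act M \<alpha> u \<in> sp M (head Q \<alpha>)"
    and "\<And>\<alpha>. \<alpha> \<in> arcs Q \<Longrightarrow> linear_on s s (sp M (tail Q \<alpha>)) (act M \<alpha>)"
  shows "M \<in> rep Q s"
  using assms by (auto simp: rep_def)

lemma sum_fun_apply: "(\<Sum>i\<in>A. f i) x = (\<Sum>i\<in>A. f i x)"
  by (induction A rule: infinite_finite_induct) auto

lemma comp_mor_apply: "comp_mor g f x u = g x (f x u)"
  by (simp add: comp_mor_def)

lemma pointwise_apply: "pointwise s c u i = s c (u i)"
  by (simp add: pointwise_def)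

context
  fixes Q :: "('v, 'e) pre_digraph" and s :: "'k::field \<Rightarrow> 'w::ab_group_add \<Rightarrow> 'w"
    and M :: "('v, 'e, 'w) quiver_rep"
  assumes s: "vector_space s" and M: "M \<in> rep Q s"
begin

interpretation s: vector_space s by (rule s)

lemma rep_zero: "x \<in> verts Q \<Longrightarrow> 0 \<in> sp M x"
  and rep_add: "x \<in> verts Q \<Longrightarrow> u \<in> sp M x \<Longrightarrow> v \<in> sp M x \<Longrightarrow> u + v \<in> sp M x"
  and rep_diff: "x \<in> verts Q \<Longrightarrow> u \<in> sp M x \<Longrightarrow> v \<in> sp M x \<Longrightarrow> u - v \<in> sp M x"
  and rep_scale: "x \<in> verts Q \<Longrightarrow> u \<in> sp M x \<Longrightarrow> s c u \<in> sp M x"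
  and rep_sum: "x \<in> verts Q \<Longrightarrow> (\<And>i. i \<in> I \<Longrightarrow> w i \<in> sp M x) \<Longrightarrow> (\<Sum>i\<in>I. w i) \<in> sp M x"
  using rep_subspace[OF M, of x] s.subspace_0 s.subspace_add s.subspace_diff s.subspace_scale
    s.subspace_sum[of "sp M x" I w] by auto

context
  assumes Q: "wf_digraph Q"
begin

interpretation wf_digraph Q by (rule Q)

lemma rep_act_zero: "\<alpha> \<in> arcs Q \<Longrightarrow> act M \<alpha> 0 = 0"
  and rep_act_add: "\<alpha> \<in> arcs Q \<Longrightarrow> u \<in> sp M (tail Q \<alpha>) \<Longrightarrow> v \<in> sp M (tail Q \<alpha>) \<Longrightarrow>
    act M \<alpha> (u + v) = act M \<alpha> u + act M \<alpha> v"
  and rep_act_diff: "\<alpha> \<in> arcs Q \<Longrightarrow> u \<in> sp M (tail Q \<alpha>) \<Longrightarrow> v \<in> sp M (tail Q \<alpha>) \<Longrightarrow>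
    act M \<alpha> (u - v) = act M \<alpha> u - act M \<alpha> v"
  and rep_act_scale: "\<alpha> \<in> arcs Q \<Longrightarrow> u \<in> sp M (tail Q \<alpha>) \<Longrightarrow> act M \<alpha> (s c u) = s c (act M \<alpha> u)"
  and rep_act_sum: "\<alpha> \<in> arcs Q \<Longrightarrow> (\<And>i. i \<in> I \<Longrightarrow> w i \<in> sp M (tail Q \<alpha>)) \<Longrightarrow>
    act M \<alpha> (\<Sum>i\<in>I. w i) = (\<Sum>i\<in>I. act M \<alpha> (w i))"
  using linear_on_zero[OF s s rep_subspace[OF M tail_in_verts] rep_act_linear[OF M]]
    linear_on_diff[OF s s rep_subspace[OF M tail_in_verts] rep_act_linear[OF M]]
    linear_on_sum[OF s s rep_subspace[OF M tail_in_verts] rep_act_linear[OF M], where I = I and u = w]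
    linear_on_add[OF rep_act_linear[OF M]] linear_on_scale[OF rep_act_linear[OF M]]
  by auto

end

context
  fixes t :: "'k \<Rightarrow> 'u::ab_group_add \<Rightarrow> 'u" and N and f
  assumes t: "vector_space t" and f: "f \<in> Hom Q s t M N"
begin

lemma Hom_zero: "f x 0 = 0"
  using linear_on_zero[OF s t rep_subspace[OF M] Hom_linear[OF f]] Hom_outside[OF f] by metis

lemma Hom_add: "x \<in> verts Q \<Longrightarrow> u \<in> sp M x \<Longrightarrow> v \<in> sp M x \<Longrightarrow> f x (u + v) = f x u + f x v"
  and Hom_diff: "x \<in> verts Q \<Longrightarrow> u \<in> sp M x \<Longrightarrow> v \<in> sp M x \<Longrightarrow> f x (u - v) = f x u - f x v"
  and Hom_scale: "x \<in> verts Q \<Longrightarrow> u \<in> sp M x \<Longrightarrow> f x (s c u) = t c (f x u)"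
  and Hom_sum: "x \<in> verts Q \<Longrightarrow> (\<And>i. i \<in> I \<Longrightarrow> w i \<in> sp M x) \<Longrightarrow> f x (\<Sum>i\<in>I. w i) = (\<Sum>i\<in>I. f x (w i))"
  using linear_on_diff[OF s t rep_subspace[OF M] Hom_linear[OF f]]
    linear_on_sum[OF s t rep_subspace[OF M] Hom_linear[OF f], where I = I and u = w]
    linear_on_add[OF Hom_linear[OF f]] linear_on_scale[OF Hom_linear[OF f]]
  by auto

end

text \<open>Morphisms are normalised to zero outside their source, so \<open>id_mor Q M\<close> also
  serves as the inclusion of \<open>M\<close> into a larger representation whose action extends that
  of \<open>M\<close>.\<close>

lemma id_mor_Hom:
  assumes "\<And>\<alpha> u. \<alpha> \<in> arcs Q \<Longrightarrow> u \<in> sp M (tail Q \<alpha>) \<Longrightarrow> act N \<alpha> u = act M \<alpha> u"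
    and "\<And>x. x \<in> verts Q \<Longrightarrow> sp M x \<subseteq> sp N x" and "wf_digraph Q"
  shows "id_mor Q M \<in> Hom Q s s M N"
proof -
  interpret wf_digraph Q by fact
  show ?thesis
    by (rule HomI)
      (use assms in \<open>auto simp: id_mor_def linear_on_def rep_add rep_scale rep_act_in_sp[OF M]\<close>)
qed

end

lemma subspace_Hom:
  assumes s: "vector_space s" and t: "vector_space t"
    and M: "M \<in> rep Q s" and N: "N \<in> rep Q t" and Q: "wf_digraph Q"
  shows "module.subspace (pointwise (pointwise t)) (Hom Q s t M N)"
proof -
  interpret vs: vector_space "pointwise (pointwise t)" by (intro vector_space_pointwise t)
  interpret t: vector_space t by (rule t)
  interpret wf_digraph Q by (rule Q)
  show ?thesis
  proof (rule vs.subspaceI)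
    show "0 \<in> Hom Q s t M N"
      using rep_zero[OF t N] rep_act_zero[OF t N Q] by (intro HomI) (auto simp: linear_on_def)
  next
    fix f g assume f: "f \<in> Hom Q s t M N" and g: "g \<in> Hom Q s t M N"
    show "f + g \<in> Hom Q s t M N"
      by (rule HomI)
        (auto simp: linear_on_def Hom_in_sp[OF f] Hom_in_sp[OF g] rep_add[OF t N] Hom_add[OF s M t f] Hom_add[OF s M t g]
           Hom_scale[OF s M t f] Hom_scale[OF s M t g] Hom_act[OF f] Hom_act[OF g] rep_act_add[OF t N Q]
           Hom_outside[OF f] Hom_outside[OF g] t.scale_right_distrib algebra_simps)
  next
    fix c f assume f: "f \<in> Hom Q s t M N"
    show "pointwise (pointwise t) c f \<in> Hom Q s t M N"
      by (rule HomI)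
        (auto simp: pointwise_apply linear_on_def Hom_in_sp[OF f] rep_scale[OF t N] Hom_add[OF s M t f]
           Hom_scale[OF s M t f] Hom_act[OF f] rep_act_scale[OF t N Q]
           Hom_outside[OF f] t.scale_right_distrib mult.commute)
  qed
qed

lemma comp_mor_Hom:
  assumes "vector_space s" "vector_space t" "vector_space r"
    and M: "M \<in> rep Q s" and N: "N \<in> rep Q t" and Q: "wf_digraph Q"
    and f: "f \<in> Hom Q s t M N" and g: "g \<in> Hom Q t r N K"
  shows "comp_mor g f \<in> Hom Q s r M K"
proof -
  interpret wf_digraph Q by (rule Q)
  note F = Hom_in_sp[OF f] Hom_add[OF assms(1) M assms(2) f] Hom_scale[OF assms(1) M assms(2) f]
    Hom_act[OF f] Hom_outside[OF f]
  note G = Hom_in_sp[OF g] Hom_add[OF assms(2) N assms(3) g] Hom_scale[OF assms(2) N assms(3) g]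
    Hom_act[OF g] Hom_zero[OF assms(2) N assms(3) g]
  show ?thesis
    by (rule HomI) (auto simp: comp_mor_apply linear_on_def F G)
qed

lemma linear_category_rep:
  fixes Q :: "('v, 'e) pre_digraph" and s :: "'k::field \<Rightarrow> 'w::ab_group_add \<Rightarrow> 'w"
  assumes s: "vector_space s" and Q: "wf_digraph Q"
  shows "linear_category (pointwise (pointwise s)) (rep Q s) (Hom Q s s) comp_mor (id_mor Q)"
proof -
  interpret s: vector_space s by (rule s)
  interpret vector_space "pointwise (pointwise s) :: 'k \<Rightarrow> ('v \<Rightarrow> 'w \<Rightarrow> 'w) \<Rightarrow> _"
    by (intro vector_space_pointwise s)
  show ?thesis
  proof
    show "module.subspace (pointwise (pointwise s)) (Hom Q s s X Y)" if "X \<in> rep Q s" "Y \<in> rep Q s" for X Y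
      using subspace_Hom[OF s s that Q] .
    show "comp_mor g f \<in> Hom Q s s X Z" if "X \<in> rep Q s" "Y \<in> rep Q s" "Z \<in> rep Q s"
      "f \<in> Hom Q s s X Y" "g \<in> Hom Q s s Y Z" for X Y Z f g
      using comp_mor_Hom[OF s s s that(1,2) Q that(4,5)] .
    show "comp_mor (comp_mor h g) f = comp_mor h (comp_mor g f)" for h g f :: "'v \<Rightarrow> 'w \<Rightarrow> 'w"
      by (simp add: comp_mor_def)
    show "comp_mor (g + h) f = comp_mor g f + comp_mor h f" for h g f :: "'v \<Rightarrow> 'w \<Rightarrow> 'w"
      by (simp add: comp_mor_def fun_eq_iff)
    show "comp_mor (pointwise (pointwise s) c g) f = pointwise (pointwise s) c (comp_mor g f)"
      for c and g f :: "'v \<Rightarrow> 'w \<Rightarrow> 'w"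
      by (simp add: comp_mor_def pointwise_def fun_eq_iff)
    show "id_mor Q X \<in> Hom Q s s X X" if "X \<in> rep Q s" for X
      by (rule id_mor_Hom[OF s that]) (use Q in auto)
  next
    fix X Y Z f f' g c assume X: "X \<in> rep Q s" and Y: "Y \<in> rep Q s" and "Z \<in> rep Q s"
      and f: "f \<in> Hom Q s s X Y" and g: "g \<in> Hom Q s s Y Z"
    \<comment> \<open>Outside its domain \<open>f\<close> takes the value \<open>0\<close>, which
      lies in \<open>sp Y x\<close> as well; so linearity of \<open>g\<close> applies to
      \<open>f x u\<close> for every \<open>u\<close>.\<close>
    have fx: "f x u \<in> sp Y x" if "x \<in> verts Q" for x u
      using Hom_in_sp[OF f that] Hom_outside[OF f] rep_zero[OF s Y that] by metis
    show "comp_mor g (pointwise (pointwise s) c f) = pointwise (pointwise s) c (comp_mor g f)"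
    proof (intro ext)
      fix x u
      show "comp_mor g (pointwise (pointwise s) c f) x u = pointwise (pointwise s) c (comp_mor g f) x u"
        using Hom_scale[OF s Y s g _ fx] Hom_outside[OF g]
        by (cases "x \<in> verts Q") (auto simp: comp_mor_apply pointwise_apply)
    qed
    assume f': "f' \<in> Hom Q s s X Y"
    have f'x: "f' x u \<in> sp Y x" if "x \<in> verts Q" for x u
      using Hom_in_sp[OF f' that] Hom_outside[OF f'] rep_zero[OF s Y that] by metis
    show "comp_mor g (f + f') = comp_mor g f + comp_mor g f'"
    proof (intro ext)
      fix x u
      show "comp_mor g (f + f') x u = (comp_mor g f + comp_mor g f') x u"
        using Hom_add[OF s Y s g _ fx f'x] Hom_outside[OF g]
        by (cases "x \<in> verts Q") (auto simp: comp_mor_apply)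
    qed
  next
    fix X Y f assume X: "X \<in> rep Q s" and Y: "Y \<in> rep Q s" and f: "f \<in> Hom Q s s X Y"
    show "comp_mor f (id_mor Q X) = f"
      using Hom_outside[OF f] Hom_zero[OF s X s f] by (auto simp: comp_mor_def id_mor_def fun_eq_iff)
    show "comp_mor (id_mor Q Y) f = f"
      using Hom_in_sp[OF f] Hom_outside[OF f] by (auto simp: comp_mor_def id_mor_def fun_eq_iff)
  qed
qed

section \<open>Direct sums as biproducts and splitting of idempotents\<close>

lemma direct_sum_simps:
  "u \<in> sp (direct_sum Ms) x \<longleftrightarrow> (\<forall>i<length Ms. u i \<in> sp (Ms ! i) x) \<and> (\<forall>i\<ge>length Ms. u i = 0)"
  "act (direct_sum Ms) \<alpha> u i = (if i < length Ms then act (Ms ! i) \<alpha> (u i) else 0)"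
  by (simp_all add: direct_sum_def)

lemma direct_sum_rep:
  fixes s :: "'k::field \<Rightarrow> 'w::ab_group_add \<Rightarrow> 'w"
  assumes s: "vector_space s" and Q: "wf_digraph Q" and Ms: "set Ms \<subseteq> rep Q s"
  shows "direct_sum Ms \<in> rep Q (pointwise s)"
proof -
  interpret s: vector_space s by (rule s)
  interpret ps: vector_space "pointwise s :: 'k \<Rightarrow> (nat \<Rightarrow> 'w) \<Rightarrow> _" by (rule vector_space_pointwise[OF s])
  interpret wf_digraph Q by (rule Q)
  have R: "Ms ! i \<in> rep Q s" if "i < length Ms" for i using Ms that by auto
  have sub: "ps.subspace (sp (direct_sum Ms) x)" if "x \<in> verts Q" for x
    using that
    by (intro ps.subspaceI)
      (auto simp: direct_sum_simps pointwise_apply rep_zero[OF s R] rep_add[OF s R] rep_scale[OF s R])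
  show ?thesis
  proof (rule repI)
    fix x assume x: "x \<in> verts Q"
    show "ps.subspace (sp (direct_sum Ms) x)" by (rule sub[OF x])
    show "fin_dim (pointwise s) (sp (direct_sum Ms) x)"
    proof (rule ps.fin_dim_jointly_injective[where f = "\<lambda>i u. u i" and U = "\<lambda>i. sp (Ms ! i) x" and I = "{..<length Ms}"])
      show "v = 0" if "v \<in> sp (direct_sum Ms) x" "\<And>i. i \<in> {..<length Ms} \<Longrightarrow> v i = 0" for v
      proof
        fix i show "v i = 0 i" using that by (cases "i < length Ms") (auto simp: direct_sum_simps)
      qed
    qed (use s x sub rep_fin_dim[OF R] in \<open>auto simp: linear_on_def pointwise_apply direct_sum_simps\<close>)
  next
    fix \<alpha> assume a: "\<alpha> \<in> arcs Q"
    show "act (direct_sum Ms) \<alpha> u \<in> sp (direct_sum Ms) (head Q \<alpha>)"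
      if "u \<in> sp (direct_sum Ms) (tail Q \<alpha>)" for u
      using that a by (auto simp: direct_sum_simps rep_act_in_sp[OF R])
    show "linear_on (pointwise s) (pointwise s) (sp (direct_sum Ms) (tail Q \<alpha>)) (act (direct_sum Ms) \<alpha>)"
      using a R by (auto simp: linear_on_def fun_eq_iff direct_sum_simps pointwise_apply
          rep_act_add[OF s _ Q] rep_act_scale[OF s _ Q])
  qed
qed

text \<open>The representation \<open>direct_sum Ms\<close> lives over \<open>pointwise s\<close>
  and is no object of the category \<open>rep Q s\<close>. The equivalence replaces an isomorphism
  with it by injections and projections satisfying the biproduct identities, all of which are
  morphisms within \<open>rep Q s\<close>.\<close>

lemma isomorphic_direct_sum_iff:
  fixes s :: "'k::field \<Rightarrow> 'w::ab_group_add \<Rightarrow> 'w"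
  assumes s: "vector_space s" and Q: "wf_digraph Q" and M: "M \<in> rep Q s" and Ms: "set Ms \<subseteq> rep Q s"
  shows "isomorphic Q s (pointwise s) M (direct_sum Ms) \<longleftrightarrow>
    (\<exists>i p. (\<forall>j<length Ms. i j \<in> Hom Q s s (Ms ! j) M \<and> p j \<in> Hom Q s s M (Ms ! j)) \<and>
      (\<forall>j<length Ms. \<forall>l<length Ms. comp_mor (p j) (i l) = (if j = l then id_mor Q (Ms ! j) else 0)) \<and>
      (\<Sum>j<length Ms. comp_mor (i j) (p j)) = id_mor Q M)"
    (is "_ \<longleftrightarrow> (\<exists>i p. ?H i p \<and> ?pi i p \<and> ?ip i p)")
proof -
  interpret s: vector_space s by (rule s)
  interpret ps: vector_space "pointwise s :: 'k \<Rightarrow> (nat \<Rightarrow> 'w) \<Rightarrow> _" by (rule vector_space_pointwise[OF s])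
  have ps: "vector_space (pointwise s :: 'k \<Rightarrow> (nat \<Rightarrow> 'w) \<Rightarrow> _)" by (rule ps.vector_space_axioms)
  interpret wf_digraph Q by (rule Q)
  let ?S = "direct_sum Ms" and ?n = "length Ms"
  have S: "?S \<in> rep Q (pointwise s)" by (rule direct_sum_rep[OF s Q Ms])
  have R: "Ms ! i \<in> rep Q s" if "i < ?n" for i using Ms that by auto
  \<comment> \<open>The coordinate embeddings of the ambient space: composed with an isomorphism out
    of the sum they give the injections, while coordinates of an isomorphism into the sum give the
    projections.\<close>
  define e :: "nat \<Rightarrow> 'w \<Rightarrow> nat \<Rightarrow> 'w" where "e j u = (\<lambda>i. if i = j then u else 0)" for j u
  have eS: "e j u \<in> sp ?S x" if "j < ?n" "x \<in> verts Q" "u \<in> sp (Ms ! j) x" for j u x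
    using that by (auto simp: e_def direct_sum_simps rep_zero[OF s R])
  have eadd: "e j (u + v) = e j u + e j v" and escale: "e j (s c u) = pointwise s c (e j u)" for j u v c
    by (auto simp: e_def fun_eq_iff pointwise_apply)
  have eact: "act ?S \<alpha> (e j u) = e j (act (Ms ! j) \<alpha> u)" if "j < ?n" "\<alpha> \<in> arcs Q" for j \<alpha> u
    using that by (auto simp: e_def fun_eq_iff direct_sum_simps rep_act_zero[OF s R Q])
  have esum: "(\<Sum>j<?n. e j (w j)) = w" if "w \<in> sp ?S x" for w x
  proof
    fix i show "(\<Sum>j<?n. e j (w j)) i = w i"
      using that by (auto simp: sum_fun_apply e_def direct_sum_simps not_less)
  qed
  show ?thesis
  proof
    assume "isomorphic Q s (pointwise s) M ?S"
    then obtain f g where f: "f \<in> Hom Q s (pointwise s) M ?S" and g: "g \<in> Hom Q (pointwise s) s ?S M"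
      and gf: "comp_mor g f = id_mor Q M" and fg: "comp_mor f g = id_mor Q ?S"
      by (auto simp: isomorphic_def)
    define p where "p j = (\<lambda>x u. f x u j)" for j
    define i where "i j = (\<lambda>x u. if x \<in> verts Q \<and> u \<in> sp (Ms ! j) x then g x (e j u) else 0)" for j
    have fx: "f x u j \<in> sp (Ms ! j) x" if "x \<in> verts Q" "u \<in> sp M x" "j < ?n" for x u j
      using Hom_in_sp[OF f that(1,2)] that(3) by (simp add: direct_sum_simps)
    have "?H i p"
    proof (intro allI impI conjI)
      fix j assume j: "j < ?n"
      show "p j \<in> Hom Q s s M (Ms ! j)"
        unfolding p_def
        by (rule HomI)
          (use j in \<open>auto simp: fx linear_on_def Hom_add[OF s M ps f] Hom_scale[OF s M ps f] Hom_act[OF f]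
            Hom_outside[OF f] pointwise_apply direct_sum_simps\<close>)
      show "i j \<in> Hom Q s s (Ms ! j) M"
        unfolding i_def
      proof (rule HomI)
        fix x assume x: "x \<in> verts Q"
        show "linear_on s s (sp (Ms ! j) x) (\<lambda>u. if x \<in> verts Q \<and> u \<in> sp (Ms ! j) x then g x (e j u) else 0)"
          using x R[OF j] eS[OF j x]
          by (auto simp: linear_on_def rep_add[OF s R[OF j]] rep_scale[OF s R[OF j]] eadd escale
              Hom_add[OF ps S s g] Hom_scale[OF ps S s g])
      qed (use j eS Hom_in_sp[OF g] Hom_act[OF g] rep_act_in_sp[OF R[OF j]] in \<open>auto simp flip: eact\<close>)
    qed
    moreover have "?pi i p"
    proof (intro allI impI ext)
      fix j l x u assume jl: "j < ?n" "l < ?n"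
      have "f x (g x (e l u)) = e l u" if "x \<in> verts Q" "u \<in> sp (Ms ! l) x"
        using fun_cong[OF fun_cong[OF fg], of x "e l u"] eS[OF jl(2) that] that
        by (simp add: comp_mor_apply id_mor_def)
      then show "comp_mor (p j) (i l) x u = (if j = l then id_mor Q (Ms ! j) else 0) x u"
        using Hom_zero[OF s M ps f, of x]
        by (auto simp: comp_mor_apply p_def i_def id_mor_def e_def)
    qed
    moreover have "?ip i p"
    proof (intro ext)
      fix x u
      show "(\<Sum>j<?n. comp_mor (i j) (p j)) x u = id_mor Q M x u"
      proof (cases "x \<in> verts Q \<and> u \<in> sp M x")
        case True
        then have "(\<Sum>j<?n. comp_mor (i j) (p j)) x u = (\<Sum>j<?n. g x (e j (f x u j)))"
          by (simp add: sum_fun_apply comp_mor_apply i_def p_def fx)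
        also have "\<dots> = g x (\<Sum>j<?n. e j (f x u j))"
          using True eS fx by (subst Hom_sum[OF ps S s g]) auto
        also have "\<dots> = g x (f x u)" using esum Hom_in_sp[OF f] True by metis
        also have "\<dots> = id_mor Q M x u" using fun_cong[OF fun_cong[OF gf], of x u] by (simp add: comp_mor_apply)
        finally show ?thesis .
      next
        case False
        then have "f x u = 0" by (intro Hom_outside[OF f]) auto
        moreover have "e j 0 = 0" for j by (simp add: e_def fun_eq_iff)
        ultimately show ?thesis using False Hom_zero[OF ps S s g, of x]
          by (auto simp: sum_fun_apply comp_mor_apply i_def p_def id_mor_def intro!: sum.neutral)
      qed
    qed
    ultimately show "\<exists>i p. ?H i p \<and> ?pi i p \<and> ?ip i p" by blast
  next
    assume "\<exists>i p. ?H i p \<and> ?pi i p \<and> ?ip i p"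
    then obtain i p where H: "?H i p" and pi: "?pi i p" and ip: "?ip i p" by blast
    have iH: "i j \<in> Hom Q s s (Ms ! j) M" and pH: "p j \<in> Hom Q s s M (Ms ! j)" if "j < ?n" for j
      using H that by auto
    define f where "f = (\<lambda>x u j. if j < ?n then p j x u else 0)"
    define g where "g = (\<lambda>x w. if x \<in> verts Q \<and> w \<in> sp ?S x then \<Sum>j<?n. i j x (w j) else 0)"
    have f: "f \<in> Hom Q s (pointwise s) M ?S"
    proof (rule HomI)
      fix x assume x: "x \<in> verts Q"
      show "linear_on s (pointwise s) (sp M x) (f x)"
        using x by (auto simp: linear_on_def f_def fun_eq_iff pointwise_apply Hom_add[OF s M s pH] Hom_scale[OF s M s pH])
    qed (auto simp: f_def direct_sum_simps Hom_in_sp[OF pH] Hom_act[OF pH] Hom_outside[OF pH] fun_eq_iff)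
    have wj: "w j \<in> sp (Ms ! j) x" if "w \<in> sp ?S x" "j < ?n" for w j x
      using that by (simp add: direct_sum_simps)
    have g: "g \<in> Hom Q (pointwise s) s ?S M"
    proof (rule HomI)
      fix x w assume x: "x \<in> verts Q" and w: "w \<in> sp ?S x"
      have "i j x (w j) \<in> sp M x" if "j < ?n" for j
        using Hom_in_sp[OF iH[OF that] x] wj w that by blast
      then show "g x w \<in> sp M x"
        using x w rep_sum[OF s M x, of "{..<?n}" "\<lambda>j. i j x (w j)"] by (simp add: g_def)
    next
      fix x assume x: "x \<in> verts Q"
      show "linear_on (pointwise s) s (sp ?S x) (g x)"
        using x
        by (auto simp: linear_on_def g_def rep_add[OF ps S] rep_scale[OF ps S] sum.distrib[symmetric]
            pointwise_apply s.scale_sum_right wj Hom_add[OF s R s iH] Hom_scale[OF s R s iH] intro!: sum.cong)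
    next
      fix \<alpha> w assume a: "\<alpha> \<in> arcs Q" and w: "w \<in> sp ?S (tail Q \<alpha>)"
      have *: "i j (tail Q \<alpha>) (w j) \<in> sp M (tail Q \<alpha>)" if "j < ?n" for j
        using Hom_in_sp[OF iH[OF that], of "tail Q \<alpha>"] wj w that a by auto
      have "g (head Q \<alpha>) (act ?S \<alpha> w) = (\<Sum>j<?n. i j (head Q \<alpha>) (act (Ms ! j) \<alpha> (w j)))"
        using a w rep_act_in_sp[OF S a w] by (simp add: g_def direct_sum_simps)
      also have "\<dots> = (\<Sum>j<?n. act M \<alpha> (i j (tail Q \<alpha>) (w j)))"
        using Hom_act[OF iH a] wj[OF w] by (intro sum.cong) auto
      also have "\<dots> = act M \<alpha> (g (tail Q \<alpha>) w)"
        using a w * rep_act_sum[OF s M Q a, of "{..<?n}" "\<lambda>j. i j (tail Q \<alpha>) (w j)"] by (simp add: g_def)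
      finally show "g (head Q \<alpha>) (act ?S \<alpha> w) = act M \<alpha> (g (tail Q \<alpha>) w)" .
    qed (auto simp: g_def)
    have "comp_mor g f = id_mor Q M"
    proof (intro ext)
      fix x u
      show "comp_mor g f x u = id_mor Q M x u"
      proof (cases "x \<in> verts Q \<and> u \<in> sp M x")
        case True
        then have "comp_mor g f x u = (\<Sum>j<?n. comp_mor (i j) (p j)) x u"
          using Hom_in_sp[OF f] by (simp add: comp_mor_apply g_def sum_fun_apply) (simp add: f_def)
        then show ?thesis using ip by simp
      next
        case False
        then have "f x u = 0" by (intro Hom_outside[OF f]) auto
        then show ?thesis using False Hom_zero[OF ps S s g] by (auto simp: comp_mor_apply id_mor_def)
      qed
    qed
    moreover have "comp_mor f g = id_mor Q ?S"
    proof (intro ext)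
      fix x w l
      show "comp_mor f g x w l = id_mor Q ?S x w l"
      proof (cases "x \<in> verts Q \<and> w \<in> sp ?S x \<and> l < ?n")
        case True
        then have ij: "i j x (w j) \<in> sp M x" if "j < ?n" for j
          using Hom_in_sp[OF iH[OF that]] wj that by blast
        have pij: "p l x (i j x (w j)) = (if l = j then w j else 0)" if j: "j < ?n" for j
        proof -
          have "comp_mor (p l) (i j) = (if l = j then id_mor Q (Ms ! l) else 0)" using pi True j by blast
          from fun_cong[OF fun_cong[OF this], of x "w j"] show ?thesis
            using True wj[of w x j] j by (auto simp: comp_mor_apply id_mor_def)
        qed
        have "comp_mor f g x w l = (\<Sum>j<?n. p l x (i j x (w j)))"
          using True Hom_sum[OF s M s pH, of l x "{..<?n}" "\<lambda>j. i j x (w j)"] ij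
          by (simp add: comp_mor_apply f_def g_def)
        also have "\<dots> = w l" using True by (simp add: pij)
        finally show ?thesis using True by (simp add: id_mor_def)
      next
        case False
        show ?thesis
        proof (cases "x \<in> verts Q \<and> w \<in> sp ?S x")
          case True
          then show ?thesis using False by (auto simp: comp_mor_apply f_def id_mor_def direct_sum_simps)
        next
          case False
          then have "g x w = 0" by (auto simp: g_def)
          then show ?thesis using False Hom_zero[OF s M ps f] by (auto simp: comp_mor_apply id_mor_def)
        qed
      qed
    qed
    ultimately show "isomorphic Q s (pointwise s) M ?S"
      using f g by (auto simp: isomorphic_def)
  qed
qed

definition image_rep :: "('v \<Rightarrow> 'w \<Rightarrow> 'w) \<Rightarrow> ('v, 'e, 'w) quiver_rep \<Rightarrow> ('v, 'e, 'w) quiver_rep" where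
  "image_rep e M = \<lparr>sp = (\<lambda>x. e x ` sp M x), act = act M\<rparr>"

text \<open>The image of an idempotent consists of its fixed vectors, so the action of
  \<open>M\<close> restricts to it and the ambient space stays the same; \<open>e\<close> becomes
  the projection and \<open>id_mor Q Y\<close> the inclusion.\<close>

lemma image_rep_splits:
  fixes s :: "'k::field \<Rightarrow> 'w::ab_group_add \<Rightarrow> 'w"
  assumes s: "vector_space s" and Q: "wf_digraph Q" and M: "M \<in> rep Q s"
    and e: "e \<in> Hom Q s s M M" and ee: "comp_mor e e = e"
  defines "Y \<equiv> image_rep e M"
  shows "Y \<in> rep Q s" "e \<in> Hom Q s s M Y" "id_mor Q Y \<in> Hom Q s s Y M"
    "comp_mor e (id_mor Q Y) = id_mor Q Y" "comp_mor (id_mor Q Y) e = e"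
proof -
  interpret s: vector_space s by (rule s)
  interpret wf_digraph Q by (rule Q)
  have eex: "e x (e x u) = e x u" for x u
    using fun_cong[OF fun_cong[OF ee]] by (simp add: comp_mor_apply)
  have sub: "sp Y x \<subseteq> sp M x" if "x \<in> verts Q" for x
    using Hom_in_sp[OF e that] by (auto simp: Y_def image_rep_def)
  have fix_e: "u \<in> sp Y x \<Longrightarrow> e x u = u" for x u
    by (auto simp: Y_def image_rep_def eex)
  have act: "act Y = act M" by (simp add: Y_def image_rep_def)
  have in_Y: "e x u \<in> sp Y x" if "u \<in> sp M x" for x u
    using that by (simp add: Y_def image_rep_def)
  show Y: "Y \<in> rep Q s"
  proof (rule repI)
    fix x assume x: "x \<in> verts Q"
    show 1: "s.subspace (sp Y x)"
      using subspace_linear_image[OF s s rep_subspace[OF M x] Hom_linear[OF e x]] by (simp add: Y_def image_rep_def)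
    show "fin_dim s (sp Y x)" by (rule s.fin_dim_subspace[OF rep_fin_dim[OF M x] 1 sub[OF x]])
  next
    fix \<alpha> assume a: "\<alpha> \<in> arcs Q"
    then have x: "tail Q \<alpha> \<in> verts Q" by simp
    show "act Y \<alpha> u \<in> sp Y (head Q \<alpha>)" if u: "u \<in> sp Y (tail Q \<alpha>)" for u
    proof -
      have uM: "u \<in> sp M (tail Q \<alpha>)" using sub[OF x] u by auto
      have "act M \<alpha> u = e (head Q \<alpha>) (act M \<alpha> u)"
        using Hom_act[OF e a uM] fix_e[OF u] by simp
      then show ?thesis using in_Y[OF rep_act_in_sp[OF M a uM]] by (simp add: act)
    qed
    show "linear_on s s (sp Y (tail Q \<alpha>)) (act Y \<alpha>)"
      using linear_on_subset[OF rep_act_linear[OF M a] sub[OF x]] by (simp add: act)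
  qed
  show "e \<in> Hom Q s s M Y"
    by (rule HomI) (use in_Y Hom_linear[OF e] Hom_act[OF e] Hom_outside[OF e] in \<open>auto simp: act\<close>)
  show "id_mor Q Y \<in> Hom Q s s Y M"
    using sub by (intro id_mor_Hom[OF s Y _ _ Q]) (auto simp: act)
  show "comp_mor e (id_mor Q Y) = id_mor Q Y"
    using Hom_zero[OF s M s e] fix_e by (auto simp: comp_mor_def id_mor_def fun_eq_iff)
  show "comp_mor (id_mor Q Y) e = e"
    using in_Y Hom_outside[OF e] by (auto simp: comp_mor_def id_mor_def fun_eq_iff)
qed

section \<open>Successors and predecessors\<close>

context strongly_locally_finite_quiver
begin

lemma paths_simps:
  "[] \<in> paths Q x y \<longleftrightarrow> x = y \<and> x \<in> verts Q"
  "\<alpha> # p \<in> paths Q x y \<longleftrightarrow> \<alpha> \<in> arcs Q \<and> tail Q \<alpha> = x \<and> p \<in> paths Q (head Q \<alpha>) y"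
  "p @ q \<in> paths Q x y \<longleftrightarrow> (\<exists>z. p \<in> paths Q x z \<and> q \<in> paths Q z y)"
  "p @ [\<alpha>] \<in> paths Q x y \<longleftrightarrow> \<alpha> \<in> arcs Q \<and> head Q \<alpha> = y \<and> p \<in> paths Q x (tail Q \<alpha>)"
proof -
  show app: "p @ q \<in> paths Q x y \<longleftrightarrow> (\<exists>z. p \<in> paths Q x z \<and> q \<in> paths Q z y)" for p q
    unfolding paths_def using awalk_append_iff by (auto dest: awalkE' awalk_ends_eqD)
  show "[] \<in> paths Q x y \<longleftrightarrow> x = y \<and> x \<in> verts Q"
    by (auto simp: paths_def awalk_Nil_iff)
  show Cons: "\<alpha> # p \<in> paths Q x y \<longleftrightarrow> \<alpha> \<in> arcs Q \<and> tail Q \<alpha> = x \<and> p \<in> paths Q (head Q \<alpha>) y" for x p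
    by (auto simp: paths_def awalk_Cons_iff)
  have "[\<alpha>] \<in> paths Q z y \<longleftrightarrow> \<alpha> \<in> arcs Q \<and> tail Q \<alpha> = z \<and> head Q \<alpha> = y" for z
    using Cons[of "[]" z] by (auto simp: paths_def awalk_Nil_iff)
  then show "p @ [\<alpha>] \<in> paths Q x y \<longleftrightarrow> \<alpha> \<in> arcs Q \<and> head Q \<alpha> = y \<and> p \<in> paths Q x (tail Q \<alpha>)"
    using app[of p "[\<alpha>]"] by auto
qed

lemma paths_in_verts: "p \<in> paths Q x y \<Longrightarrow> x \<in> verts Q \<and> y \<in> verts Q"
  by (auto simp: paths_def)

lemma finite_paths: "finite (paths Q x y)"
  using interval_finite[of x y] paths_in_verts by (metis finite.emptyI equals0I)

lemma finite_in_arcs: "finite (in_arcs Q x)" and finite_out_arcs: "finite (out_arcs Q x)"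
proof -
  have "in_arcs Q x = {}" "out_arcs Q x = {}" if "x \<notin> verts Q" using that by auto
  then show "finite (in_arcs Q x)" "finite (out_arcs Q x)"
    using locally_finite[of x] by (cases "x \<in> verts Q"; auto)+
qed

definition succs :: "'v set \<Rightarrow> 'v set" where
  "succs A = {y. \<exists>a\<in>A. paths Q a y \<noteq> {}}"

definition preds :: "'v set \<Rightarrow> 'v set" where
  "preds B = {x. \<exists>b\<in>B. paths Q x b \<noteq> {}}"

lemma head_in_succs: "\<alpha> \<in> arcs Q \<Longrightarrow> tail Q \<alpha> \<in> succs A \<Longrightarrow> head Q \<alpha> \<in> succs A"
  unfolding succs_def using paths_simps(4) by blast

text \<open>Such a vertex lies on one of the finitely many paths from \<open>A\<close> to
  \<open>B\<close>. In this form interval-finiteness makes the overlap of the supports of the two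
  ends of an extension finite.\<close>

lemma finite_succs_Int_preds:
  assumes "finite A" "finite B" shows "finite (succs A \<inter> preds B)"
proof (rule finite_subset)
  \<comment> \<open>A vertex on a path is either its starting point or the head of one of its
    arrows.\<close>
  show "succs A \<inter> preds B \<subseteq> A \<union> (\<Union>a\<in>A. \<Union>b\<in>B. \<Union>r\<in>paths Q a b. head Q ` set r)"
  proof
    fix x assume "x \<in> succs A \<inter> preds B"
    then obtain a b p q where ab: "a \<in> A" "b \<in> B" and p: "p \<in> paths Q a x" and q: "q \<in> paths Q x b"
      by (auto simp: succs_def preds_def)
    then have r: "p @ q \<in> paths Q a b" using paths_simps(3) by blast
    show "x \<in> A \<union> (\<Union>a\<in>A. \<Union>b\<in>B. \<Union>r\<in>paths Q a b. head Q ` set r)"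
    proof (cases p rule: rev_cases)
      case Nil
      then show ?thesis using p ab paths_simps(1) by auto
    next
      case (snoc p' \<alpha>)
      then have "x = head Q \<alpha>" "\<alpha> \<in> set (p @ q)" using p paths_simps(4) by auto
      then show ?thesis using ab r by blast
    qed
  qed
qed (use assms finite_paths in auto)

text \<open>The maximal length of a path from \<open>A\<close> increases along the arrows inside \<open>succs A\<close>.\<close>

lemma succs_induct [consumes 2, case_names outside step]:
  assumes "finite A" and "x \<in> verts Q"
    and outside: "\<And>x. x \<in> verts Q \<Longrightarrow> x \<notin> succs A \<Longrightarrow> R x"
    and step: "\<And>x. x \<in> verts Q \<Longrightarrow> (\<And>\<alpha>. \<alpha> \<in> in_arcs Q x \<Longrightarrow> R (tail Q \<alpha>)) \<Longrightarrow> R x"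
  shows "R x"
  using \<open>x \<in> verts Q\<close>
\<comment> \<open>Inserting \<open>0\<close> keeps \<open>Max\<close> defined where no path from
  \<open>A\<close> arrives. Tails of that kind are settled by \<open>outside\<close>, so the measure
  has to decrease only for tails in \<open>succs A\<close>.\<close>
proof (induction x rule: measure_induct_rule[where f = "\<lambda>x. Max (insert 0 (length ` (\<Union>a\<in>A. paths Q a x)))"])
  case (less x)
  let ?S = "\<lambda>x. length ` (\<Union>a\<in>A. paths Q a x)"
  have fin: "finite (?S x)" for x using \<open>finite A\<close> finite_paths by auto
  show ?case
  proof (rule step[OF less.prems])
    fix \<alpha> assume a: "\<alpha> \<in> in_arcs Q x"
    then have y: "tail Q \<alpha> \<in> verts Q" by auto
    show "R (tail Q \<alpha>)"
    proof (cases "tail Q \<alpha> \<in> succs A")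
      case True
      then have "?S (tail Q \<alpha>) \<noteq> {}" by (auto simp: succs_def)
      then have "Max (insert 0 (?S (tail Q \<alpha>))) \<in> ?S (tail Q \<alpha>)"
        using Max_in[OF fin, of "tail Q \<alpha>"] fin[of "tail Q \<alpha>"] by simp
      then obtain b p where p: "b \<in> A" "p \<in> paths Q b (tail Q \<alpha>)"
        and m: "Max (insert 0 (?S (tail Q \<alpha>))) = length p" by auto
      have "p @ [\<alpha>] \<in> paths Q b x" using p a paths_simps(4) by auto
      then have "length (p @ [\<alpha>]) \<in> ?S x" using p(1) by blast
      then have "Suc (length p) \<le> Max (insert 0 (?S x))" using fin[of x] by (intro Max_ge) auto
      then show ?thesis using less.IH[OF _ y] m by simp
    qed (use outside y in auto)
  qed
qed

text \<open>Dually, the maximal length of a path into \<open>B\<close> decreases along the arrows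
  inside \<open>preds B\<close>.\<close>

lemma preds_induct [consumes 2, case_names outside step]:
  assumes "finite B" and "x \<in> verts Q"
    and outside: "\<And>x. x \<in> verts Q \<Longrightarrow> x \<notin> preds B \<Longrightarrow> R x"
    and step: "\<And>x. x \<in> verts Q \<Longrightarrow> (\<And>\<alpha>. \<alpha> \<in> out_arcs Q x \<Longrightarrow> R (head Q \<alpha>)) \<Longrightarrow> R x"
  shows "R x"
  using \<open>x \<in> verts Q\<close>
proof (induction x rule: measure_induct_rule[where f = "\<lambda>x. Max (insert 0 (length ` (\<Union>b\<in>B. paths Q x b)))"])
  case (less x)
  let ?S = "\<lambda>x. length ` (\<Union>b\<in>B. paths Q x b)"
  have fin: "finite (?S x)" for x using \<open>finite B\<close> finite_paths by auto
  show ?case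
  proof (rule step[OF less.prems])
    fix \<alpha> assume a: "\<alpha> \<in> out_arcs Q x"
    then have y: "head Q \<alpha> \<in> verts Q" by auto
    show "R (head Q \<alpha>)"
    proof (cases "head Q \<alpha> \<in> preds B")
      case True
      then have "?S (head Q \<alpha>) \<noteq> {}" by (auto simp: preds_def)
      then have "Max (insert 0 (?S (head Q \<alpha>))) \<in> ?S (head Q \<alpha>)"
        using Max_in[OF fin, of "head Q \<alpha>"] fin[of "head Q \<alpha>"] by simp
      then obtain b p where p: "b \<in> B" "p \<in> paths Q (head Q \<alpha>) b"
        and m: "Max (insert 0 (?S (head Q \<alpha>))) = length p" by auto
      have "\<alpha> # p \<in> paths Q x b" using p a paths_simps(2) by auto
      then have "length (\<alpha> # p) \<in> ?S x" using p(1) by blast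
      then have "Suc (length p) \<le> Max (insert 0 (?S x))" using fin[of x] by (intro Max_ge) auto
      then show ?thesis using less.IH[OF _ y] m by simp
    qed (use outside y in auto)
  qed
qed

end

section \<open>Finitely presented representations\<close>

text \<open>An element of the direct sum over the incoming arrows is encoded as a family
  \<open>v\<close> indexed by arrows, so parallel arrows give separate summands; values of
  \<open>v\<close> at other arrows are ignored.\<close>

definition in_iso :: "('v, 'e) pre_digraph \<Rightarrow> ('v, 'e, 'w::ab_group_add) quiver_rep \<Rightarrow> 'v \<Rightarrow> bool" where
  "in_iso Q M x \<longleftrightarrow>
    (\<forall>u\<in>sp M x. \<exists>v. (\<forall>\<alpha>\<in>in_arcs Q x. v \<alpha> \<in> sp M (tail Q \<alpha>)) \<and> u = (\<Sum>\<alpha>\<in>in_arcs Q x. act M \<alpha> (v \<alpha>))) \<and>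
    (\<forall>v. (\<forall>\<alpha>\<in>in_arcs Q x. v \<alpha> \<in> sp M (tail Q \<alpha>)) \<longrightarrow> (\<Sum>\<alpha>\<in>in_arcs Q x. act M \<alpha> (v \<alpha>)) = 0 \<longrightarrow>
      (\<forall>\<alpha>\<in>in_arcs Q x. v \<alpha> = 0))"

lemma in_isoI:
  assumes "\<And>u. u \<in> sp M x \<Longrightarrow>
      \<exists>v. (\<forall>\<alpha>\<in>in_arcs Q x. v \<alpha> \<in> sp M (tail Q \<alpha>)) \<and> u = (\<Sum>\<alpha>\<in>in_arcs Q x. act M \<alpha> (v \<alpha>))"
    and "\<And>v \<alpha>. (\<And>\<alpha>. \<alpha> \<in> in_arcs Q x \<Longrightarrow> v \<alpha> \<in> sp M (tail Q \<alpha>)) \<Longrightarrow>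
      (\<Sum>\<alpha>\<in>in_arcs Q x. act M \<alpha> (v \<alpha>)) = 0 \<Longrightarrow> \<alpha> \<in> in_arcs Q x \<Longrightarrow> v \<alpha> = 0"
  shows "in_iso Q M x"
  using assms by (auto simp: in_iso_def)

lemma in_iso_surj:
  assumes "in_iso Q M x" "u \<in> sp M x"
  obtains v where "\<And>\<alpha>. \<alpha> \<in> in_arcs Q x \<Longrightarrow> v \<alpha> \<in> sp M (tail Q \<alpha>)"
    "u = (\<Sum>\<alpha>\<in>in_arcs Q x. act M \<alpha> (v \<alpha>))"
  using assms unfolding in_iso_def by blast

lemma in_iso_inj:
  assumes "in_iso Q M x" "\<And>\<alpha>. \<alpha> \<in> in_arcs Q x \<Longrightarrow> v \<alpha> \<in> sp M (tail Q \<alpha>)"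
    "(\<Sum>\<alpha>\<in>in_arcs Q x. act M \<alpha> (v \<alpha>)) = 0" "\<alpha> \<in> in_arcs Q x"
  shows "v \<alpha> = 0"
  using assms by (auto simp: in_iso_def)

text \<open>Generators are listed as pairs of a vertex and a vector, since \<open>direct_sum\<close>
  takes lists. Distinctness turns a sum over the list positions at one vertex into a sum over the
  vectors attached to it.\<close>

lemma sum_list_fibre:
  assumes "distinct gs"
  shows "(\<Sum>i | i < length gs \<and> map fst gs ! i = x. f (snd (gs ! i))) = (\<Sum>b | (x, b) \<in> set gs. f b)"
proof (rule sum.reindex_bij_betw)
  show "bij_betw (\<lambda>i. snd (gs ! i)) {i. i < length gs \<and> map fst gs ! i = x} {b. (x, b) \<in> set gs}"
  proof (rule bij_betwI')
    fix i j assume "i \<in> {i. i < length gs \<and> map fst gs ! i = x}" "j \<in> {i. i < length gs \<and> map fst gs ! i = x}"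
    then show "(snd (gs ! i) = snd (gs ! j)) = (i = j)"
      using assms by (auto simp: nth_eq_iff_index_eq[symmetric] prod_eq_iff)
  next
    fix i assume "i \<in> {i. i < length gs \<and> map fst gs ! i = x}"
    then show "snd (gs ! i) \<in> {b. (x, b) \<in> set gs}"
      by (auto simp: in_set_conv_nth prod_eq_iff)
  next
    fix b assume "b \<in> {b. (x, b) \<in> set gs}"
    then obtain i where "i < length gs" "gs ! i = (x, b)" by (auto simp: in_set_conv_nth)
    then show "\<exists>i\<in>{i. i < length gs \<and> map fst gs ! i = x}. b = snd (gs ! i)" by force
  qed
qed

abbreviation P_sum :: "('v, 'e) pre_digraph \<Rightarrow> 'v list \<Rightarrow> ('v, 'e, nat \<Rightarrow> 'e list \<Rightarrow> 'k::field) quiver_rep" where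
  "P_sum Q as \<equiv> direct_sum (map (P_rep Q) as)"

text \<open>The Yoneda correspondence: a morphism out of a sum of \<open>P_a\<close> is given by the
  images \<open>e i\<close> of the trivial paths, and a path \<open>p\<close> is sent to the result
  of letting its arrows act on \<open>e i\<close> in order.\<close>

definition free_map :: "('v, 'e) pre_digraph \<Rightarrow> ('k::field \<Rightarrow> 'w::ab_group_add \<Rightarrow> 'w) \<Rightarrow>
    ('v, 'e, 'w) quiver_rep \<Rightarrow> 'v list \<Rightarrow> (nat \<Rightarrow> 'w) \<Rightarrow> 'v \<Rightarrow> (nat \<Rightarrow> 'e list \<Rightarrow> 'k) \<Rightarrow> 'w" where
  "free_map Q s L as e x w = (if x \<in> verts Q \<and> w \<in> sp (P_sum Q as) x
     then \<Sum>i<length as. \<Sum>p\<in>paths Q (as ! i) x. s (w i p) (fold (act L) p (e i)) else 0)"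

lemma vector_space_path_scale:
  "vector_space (path_scale :: 'k::field \<Rightarrow> (nat \<Rightarrow> 'e list \<Rightarrow> 'k) \<Rightarrow> _)"
  by (intro vector_space_pointwise vector_space_field)

context strongly_locally_finite_quiver
begin

lemma wf: "wf_digraph Q"
  by unfold_locales

text \<open>Interval-finiteness makes the finite-support condition of \<open>free_space\<close>
  automatic, so only the location of the support matters.\<close>

lemma sp_P_sum:
  assumes "set as \<subseteq> verts Q" "x \<in> verts Q"
  shows "w \<in> sp (P_sum Q as) x \<longleftrightarrow> (\<forall>i p. w i p \<noteq> 0 \<longrightarrow> i < length as \<and> p \<in> paths Q (as ! i) x)"
proof -
  have "finite {p. w i p \<noteq> 0}" if "{p. w i p \<noteq> 0} \<subseteq> paths Q (as ! i) x" for i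
    using that finite_paths finite_subset by blast
  then have "w \<in> sp (P_sum Q as) x \<longleftrightarrow>
      (\<forall>i<length as. {p. w i p \<noteq> 0} \<subseteq> paths Q (as ! i) x) \<and> (\<forall>i\<ge>length as. w i = 0)"
    by (auto simp: direct_sum_simps P_rep_def free_space_def)
  also have "\<dots> \<longleftrightarrow> (\<forall>i p. w i p \<noteq> 0 \<longrightarrow> i < length as \<and> p \<in> paths Q (as ! i) x)"
    by (auto simp: fun_eq_iff subset_iff not_less[symmetric]; blast)
  finally show ?thesis .
qed

lemma act_P_sum: "act (P_sum Q as) \<alpha> w i q =
    (if i < length as \<and> q \<noteq> [] \<and> last q = \<alpha> then w i (butlast q) else 0)"
  by (auto simp: direct_sum_simps P_rep_def)

lemma finite_dim_functions:
  fixes V :: "(nat \<Rightarrow> 'e list \<Rightarrow> 'k::field) set"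
  assumes "module.subspace path_scale V" "finite I" "\<And>w i p. w \<in> V \<Longrightarrow> (i, p) \<notin> I \<Longrightarrow> w i p = 0"
  shows "fin_dim path_scale V"
proof -
  interpret ps: vector_space "path_scale :: 'k \<Rightarrow> (nat \<Rightarrow> 'e list \<Rightarrow> 'k) \<Rightarrow> _"
    by (rule vector_space_path_scale)
  interpret k: vector_space "(*) :: 'k \<Rightarrow> _" by (rule vector_space_field)
  have k: "fin_dim (*) (UNIV :: 'k set)"
    unfolding fin_dim_def by (rule exI[of _ "{1}"]) (auto simp: k.span_singleton)
  show ?thesis
  proof (rule ps.fin_dim_jointly_injective[where f = "\<lambda>(i, p) w. w i p" and U = "\<lambda>_. UNIV" and I = I])
    show "v = 0" if "v \<in> V" "\<And>j. j \<in> I \<Longrightarrow> (case j of (i, p) \<Rightarrow> \<lambda>w. w i p) v = 0" for v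
    proof (intro ext)
      fix i p show "v i p = 0 i p" using that(1) that(2)[of "(i, p)"] assms(3)[of v i p] by auto
    qed
  qed (use assms k vector_space_field in \<open>auto simp: linear_on_def pointwise_apply\<close>)
qed

lemma P_sum_rep:
  assumes as: "set as \<subseteq> verts Q"
  shows "(P_sum Q as :: ('v, 'e, nat \<Rightarrow> 'e list \<Rightarrow> 'k::field) quiver_rep) \<in> rep Q path_scale"
proof -
  interpret ps: vector_space "path_scale :: 'k \<Rightarrow> (nat \<Rightarrow> 'e list \<Rightarrow> 'k) \<Rightarrow> _"
    by (rule vector_space_path_scale)
  let ?P = "P_sum Q as :: ('v, 'e, nat \<Rightarrow> 'e list \<Rightarrow> 'k) quiver_rep"
  have sub: "ps.subspace (sp ?P x)" if "x \<in> verts Q" for x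
    by (rule ps.subspaceI) (auto simp: sp_P_sum[OF as that] pointwise_apply, (metis add_0)+)
  show ?thesis
  proof (rule repI)
    fix x assume x: "x \<in> verts Q"
    show "ps.subspace (sp ?P x)" by (rule sub[OF x])
    show "fin_dim path_scale (sp ?P x)"
    proof (rule finite_dim_functions[OF sub[OF x]])
      show "finite (SIGMA i:{..<length as}. paths Q (as ! i) x)" using finite_paths by auto
    qed (use sp_P_sum[OF as x] in auto)
  next
    fix \<alpha> assume a: "\<alpha> \<in> arcs Q"
    show "act ?P \<alpha> w \<in> sp ?P (head Q \<alpha>)" if w: "w \<in> sp ?P (tail Q \<alpha>)" for w
    proof -
      have "q \<in> paths Q (as ! i) (head Q \<alpha>)" if "w i (butlast q) \<noteq> 0" "q \<noteq> []" "last q = \<alpha>" for i q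
      proof -
        have "butlast q \<in> paths Q (as ! i) (tail Q \<alpha>)" using w that(1) sp_P_sum[OF as tail_in_verts[OF a]] by blast
        then have "butlast q @ [\<alpha>] \<in> paths Q (as ! i) (head Q \<alpha>)" using a paths_simps(4) by blast
        then show ?thesis using append_butlast_last_id[OF that(2)] that(3) by simp
      qed
      then show ?thesis using w a by (auto simp: sp_P_sum[OF as] act_P_sum)
    qed
    show "linear_on path_scale path_scale (sp ?P (tail Q \<alpha>)) (act ?P \<alpha>)"
      by (auto simp: linear_on_def fun_eq_iff act_P_sum pointwise_apply)
  qed
qed

text \<open>A nontrivial path has exactly one last arrow, so at most one summand contributes to its
  coefficient.\<close>

lemma sum_act_P_sum:
  "(\<Sum>\<alpha>\<in>in_arcs Q x. act (P_sum Q as) \<alpha> (v \<alpha>)) i q =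
    (if i < length as \<and> q \<noteq> [] \<and> last q \<in> in_arcs Q x then v (last q) i (butlast q) else 0)"
proof -
  have "(\<Sum>\<alpha>\<in>in_arcs Q x. act (P_sum Q as) \<alpha> (v \<alpha>)) i q =
      (\<Sum>\<alpha>\<in>in_arcs Q x. if \<alpha> = last q then (if i < length as \<and> q \<noteq> [] then v \<alpha> i (butlast q) else 0) else 0)"
    unfolding sum_fun_apply by (intro sum.cong) (auto simp: act_P_sum)
  then show ?thesis by (auto simp: finite_in_arcs)
qed

text \<open>The coefficient of \<open>v \<alpha>\<close> at \<open>p\<close> reappears in the sum at
  the path \<open>p @ [\<alpha>]\<close>. This covers the vertices in \<open>as\<close> too, and the
  property is inherited by subrepresentations, in particular by kernels.\<close>

lemma P_sum_inj:
  assumes as: "set as \<subseteq> verts Q"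
    and v: "\<And>\<alpha>. \<alpha> \<in> in_arcs Q x \<Longrightarrow> v \<alpha> \<in> sp (P_sum Q as) (tail Q \<alpha>)"
    and 0: "(\<Sum>\<alpha>\<in>in_arcs Q x. act (P_sum Q as) \<alpha> (v \<alpha>)) = 0" and a: "\<alpha> \<in> in_arcs Q x"
  shows "v \<alpha> = 0"
proof (intro ext)
  fix i p
  show "v \<alpha> i p = 0 i p"
  proof (rule ccontr)
    assume "v \<alpha> i p \<noteq> 0 i p"
    then have "i < length as" using v[OF a] a sp_P_sum[OF as, of "tail Q \<alpha>"] by auto
    then show False
      using sum_act_P_sum[of as v x i "p @ [\<alpha>]"] a \<open>v \<alpha> i p \<noteq> 0 i p\<close> unfolding 0 by simp
  qed
qed

text \<open>The paths ending at \<open>x\<close> are sorted by their last arrow; only the trivial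
  path, which occurs in the summands with \<open>as ! i = x\<close>, is left over.\<close>

lemma P_sum_decomposition:
  assumes as: "set as \<subseteq> verts Q" and x: "x \<in> verts Q" and w: "w \<in> sp (P_sum Q as) x"
  obtains v where "\<And>\<alpha>. \<alpha> \<in> in_arcs Q x \<Longrightarrow> v \<alpha> \<in> sp (P_sum Q as) (tail Q \<alpha>)"
    "w = (\<Sum>\<alpha>\<in>in_arcs Q x. act (P_sum Q as) \<alpha> (v \<alpha>)) +
      (\<lambda>i q. if i < length as \<and> q = [] \<and> as ! i = x then w i [] else 0)"
proof
  let ?v = "\<lambda>\<alpha> i p. w i (p @ [\<alpha>])"
  show "?v \<alpha> \<in> sp (P_sum Q as) (tail Q \<alpha>)" if "\<alpha> \<in> in_arcs Q x" for \<alpha>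
    using w that by (force simp: sp_P_sum[OF as] paths_simps(4))
  show "w = (\<Sum>\<alpha>\<in>in_arcs Q x. act (P_sum Q as) \<alpha> (?v \<alpha>)) +
      (\<lambda>i q. if i < length as \<and> q = [] \<and> as ! i = x then w i [] else 0)"
  proof (intro ext)
    fix i q
    have nz: "i < length as \<and> q \<in> paths Q (as ! i) x" if "w i q \<noteq> 0"
      using w that by (auto simp: sp_P_sum[OF as x])
    show "w i q = ((\<Sum>\<alpha>\<in>in_arcs Q x. act (P_sum Q as) \<alpha> (?v \<alpha>)) +
      (\<lambda>i q. if i < length as \<and> q = [] \<and> as ! i = x then w i [] else 0)) i q"
    proof (cases q rule: rev_cases)
      case Nil
      then show ?thesis using nz paths_simps(1) by (auto simp: sum_act_P_sum)
    next
      case (snoc q' \<alpha>)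
      then show ?thesis using nz paths_simps(4) by (auto simp: sum_act_P_sum)
    qed
  qed
qed

lemma P_sum_in_iso:
  assumes as: "set as \<subseteq> verts Q" and x: "x \<in> verts Q" "x \<notin> set as"
  shows "in_iso Q (P_sum Q as) x"
proof (rule in_isoI)
  fix w assume "w \<in> sp (P_sum Q as) x"
  then obtain v where v: "\<And>\<alpha>. \<alpha> \<in> in_arcs Q x \<Longrightarrow> v \<alpha> \<in> sp (P_sum Q as) (tail Q \<alpha>)"
    and w: "w = (\<Sum>\<alpha>\<in>in_arcs Q x. act (P_sum Q as) \<alpha> (v \<alpha>)) +
      (\<lambda>i q. if i < length as \<and> q = [] \<and> as ! i = x then w i [] else 0)" (is "_ = ?S + ?z")
    using P_sum_decomposition[OF as x(1)] by blast
  have "?z = 0" using x(2) by (auto simp: fun_eq_iff)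
  then have "?S + ?z = ?S" by (simp only: add_0_right)
  from trans[OF w this] show "\<exists>v. (\<forall>\<alpha>\<in>in_arcs Q x. v \<alpha> \<in> sp (P_sum Q as) (tail Q \<alpha>)) \<and>
      w = (\<Sum>\<alpha>\<in>in_arcs Q x. act (P_sum Q as) \<alpha> (v \<alpha>))"
    using v by blast
qed (rule P_sum_inj[OF as])

lemma P_sum_zero_outside:
  assumes "set as \<subseteq> verts Q" "x \<in> verts Q" "x \<notin> succs (set as)"
  shows "sp (P_sum Q as :: ('v, 'e, nat \<Rightarrow> 'e list \<Rightarrow> 'k::field) quiver_rep) x \<subseteq> {0}"
proof
  fix w :: "nat \<Rightarrow> 'e list \<Rightarrow> 'k" assume w: "w \<in> sp (P_sum Q as) x"
  have "w i p = 0" for i p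
  proof (rule ccontr)
    assume "w i p \<noteq> 0"
    then have "i < length as" "p \<in> paths Q (as ! i) x" using w sp_P_sum[OF assms(1,2)] by auto
    then have "x \<in> succs (set as)" unfolding succs_def using nth_mem by blast
    then show False using assms(3) by simp
  qed
  then show "w \<in> {0}" by (auto simp: fun_eq_iff)
qed

section \<open>Morphisms out of sums of the projectives \<open>P_a\<close>\<close>

context
  fixes s :: "'k::field \<Rightarrow> 'w::ab_group_add \<Rightarrow> 'w" and L :: "('v, 'e, 'w) quiver_rep"
  assumes s: "vector_space s" and L: "L \<in> rep Q s"
begin

interpretation s: vector_space s by (rule s)
interpretation ps: vector_space "path_scale :: 'k \<Rightarrow> (nat \<Rightarrow> 'e list \<Rightarrow> 'k) \<Rightarrow> _"
  by (rule vector_space_path_scale)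

text \<open>The family \<open>U\<close> stands for a subrepresentation; the lemma is used for all of
  \<open>L\<close> as well as for kernels and images.\<close>

lemma path_act_closed:
  assumes "\<And>\<alpha> u. \<alpha> \<in> arcs Q \<Longrightarrow> u \<in> U (tail Q \<alpha>) \<Longrightarrow> act L \<alpha> u \<in> U (head Q \<alpha>)"
  shows "p \<in> paths Q x y \<Longrightarrow> u \<in> U x \<Longrightarrow> fold (act L) p u \<in> U y"
  by (induction p arbitrary: x u) (auto simp: paths_simps(1,2) assms)

lemma path_act_in_sp: "p \<in> paths Q x y \<Longrightarrow> u \<in> sp L x \<Longrightarrow> fold (act L) p u \<in> sp L y"
  by (rule path_act_closed[where U = "sp L"]) (auto intro: rep_act_in_sp[OF L])

lemma path_act_linear:
  "p \<in> paths Q x y \<Longrightarrow> linear_on s s (sp L x) (fold (act L) p)"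
proof (induction p arbitrary: x)
  case (Cons \<alpha> p)
  then have a: "\<alpha> \<in> arcs Q" "tail Q \<alpha> = x" and IH: "linear_on s s (sp L (head Q \<alpha>)) (fold (act L) p)"
    by (auto simp: paths_simps(2))
  then show ?case
    using rep_act_add[OF s L wf a(1)] rep_act_scale[OF s L wf a(1)] rep_act_in_sp[OF L a(1)]
    by (auto simp: linear_on_def)
qed (simp add: linear_on_def)

context
  fixes as :: "'v list" and e :: "nat \<Rightarrow> 'w"
  assumes as: "set as \<subseteq> verts Q" and e: "\<And>i. i < length as \<Longrightarrow> e i \<in> sp L (as ! i)"
begin

lemma free_map_term:
  "i < length as \<Longrightarrow> p \<in> paths Q (as ! i) x \<Longrightarrow> s c (fold (act L) p (e i)) \<in> sp L x"
  using path_act_in_sp[of p "as ! i" x "e i"] e rep_scale[OF s L] paths_in_verts by blast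

lemma free_map_Hom: "free_map Q s L as e \<in> Hom Q path_scale s (P_sum Q as) L"
proof (rule HomI)
  fix x and w :: "nat \<Rightarrow> 'e list \<Rightarrow> 'k" assume "x \<in> verts Q" "w \<in> sp (P_sum Q as) x"
  then show "free_map Q s L as e x w \<in> sp L x"
    unfolding free_map_def using free_map_term by (auto intro!: rep_sum[OF s L])
next
  fix x assume x: "x \<in> verts Q"
  show "linear_on path_scale s (sp (P_sum Q as) x) (free_map Q s L as e x)"
    using x rep_add[OF vector_space_path_scale P_sum_rep[OF as] x]
      rep_scale[OF vector_space_path_scale P_sum_rep[OF as] x]
    by (auto simp: linear_on_def free_map_def pointwise_apply s.scale_left_distrib sum.distrib
        s.scale_sum_right)
next
  fix \<alpha> and w :: "nat \<Rightarrow> 'e list \<Rightarrow> 'k"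
  assume a: "\<alpha> \<in> arcs Q" and w: "w \<in> sp (P_sum Q as) (tail Q \<alpha>)"
  let ?x = "tail Q \<alpha>" and ?y = "head Q \<alpha>"
  have aw: "act (P_sum Q as) \<alpha> w \<in> sp (P_sum Q as) ?y" by (rule rep_act_in_sp[OF P_sum_rep[OF as] a w])
  have "(\<Sum>q\<in>paths Q (as ! i) ?y. s (act (P_sum Q as) \<alpha> w i q) (fold (act L) q (e i))) =
      act L \<alpha> (\<Sum>p\<in>paths Q (as ! i) ?x. s (w i p) (fold (act L) p (e i)))" if i: "i < length as" for i
  proof -
    let ?f = "\<lambda>q. s (act (P_sum Q as) \<alpha> w i q) (fold (act L) q (e i))"
    \<comment> \<open>The action of \<open>\<alpha>\<close> appends it to paths, so paths to
      \<open>?y\<close> that do not end in \<open>\<alpha>\<close> have coefficient zero.\<close>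
    have "sum ?f (paths Q (as ! i) ?y) = sum ?f ((\<lambda>p. p @ [\<alpha>]) ` paths Q (as ! i) ?x)"
    proof (rule sum.mono_neutral_right)
      show "(\<lambda>p. p @ [\<alpha>]) ` paths Q (as ! i) ?x \<subseteq> paths Q (as ! i) ?y"
        using a paths_simps(4) by auto
      show "\<forall>q\<in>paths Q (as ! i) ?y - (\<lambda>p. p @ [\<alpha>]) ` paths Q (as ! i) ?x. ?f q = 0"
      proof
        fix q assume q: "q \<in> paths Q (as ! i) ?y - (\<lambda>p. p @ [\<alpha>]) ` paths Q (as ! i) ?x"
        show "?f q = 0"
        proof (cases q rule: rev_cases)
          case (snoc q' \<beta>)
          then have "\<beta> \<noteq> \<alpha>" using q paths_simps(4) by auto
          then show ?thesis using snoc by (simp add: act_P_sum)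
        qed (simp add: act_P_sum)
      qed
    qed (rule finite_paths)
    also have "\<dots> = (\<Sum>p\<in>paths Q (as ! i) ?x. s (w i p) (act L \<alpha> (fold (act L) p (e i))))"
      using i by (subst sum.reindex) (auto simp: inj_on_def act_P_sum)
    also have "\<dots> = (\<Sum>p\<in>paths Q (as ! i) ?x. act L \<alpha> (s (w i p) (fold (act L) p (e i))))"
      using rep_act_scale[OF s L wf a path_act_in_sp[OF _ e[OF i]]] by (intro sum.cong) auto
    also have "\<dots> = act L \<alpha> (\<Sum>p\<in>paths Q (as ! i) ?x. s (w i p) (fold (act L) p (e i)))"
      using free_map_term[OF i] by (intro rep_act_sum[OF s L wf a, symmetric]) auto
    finally show ?thesis .
  qed
  then have "free_map Q s L as e ?y (act (P_sum Q as) \<alpha> w) =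
      (\<Sum>i<length as. act L \<alpha> (\<Sum>p\<in>paths Q (as ! i) ?x. s (w i p) (fold (act L) p (e i))))"
    using aw a by (simp add: free_map_def)
  also have "\<dots> = act L \<alpha> (free_map Q s L as e ?x w)"
    using a w free_map_term
    by (subst rep_act_sum[OF s L wf a, symmetric]) (auto simp: free_map_def intro!: rep_sum[OF s L])
  finally show "free_map Q s L as e ?y (act (P_sum Q as) \<alpha> w) = act L \<alpha> (free_map Q s L as e ?x w)" .
qed (auto simp: free_map_def)

lemma P_sum_generators:
  fixes t :: "nat \<Rightarrow> 'k"
  assumes x: "x \<in> verts Q"
  shows "(\<lambda>i q. if i < length as \<and> q = [] \<and> as ! i = x then t i else 0) \<in> sp (P_sum Q as) x"
    (is "?w \<in> _")
    and "free_map Q s L as e x (\<lambda>i q. if i < length as \<and> q = [] \<and> as ! i = x then t i else 0) =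
      (\<Sum>i | i < length as \<and> as ! i = x. s (t i) (e i))"
proof -
  show w: "?w \<in> sp (P_sum Q as) x"
    using x paths_simps(1) by (auto simp: sp_P_sum[OF as] split: if_splits)
  have "(\<Sum>p\<in>paths Q (as ! i) x. s (?w i p) (fold (act L) p (e i))) = (if as ! i = x then s (t i) (e i) else 0)"
    if i: "i < length as" for i
  proof (cases "as ! i = x")
    case True
    have "(\<Sum>p\<in>paths Q (as ! i) x. s (?w i p) (fold (act L) p (e i))) =
        (\<Sum>p\<in>{[]}. s (?w i p) (fold (act L) p (e i)))"
      using True x by (intro sum.mono_neutral_right) (auto simp: paths_simps(1) finite_paths)
    then show ?thesis using True i by simp
  qed auto
  then have "free_map Q s L as e x ?w = (\<Sum>i<length as. if as ! i = x then s (t i) (e i) else 0)"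
    using w x by (simp add: free_map_def)
  also have "\<dots> = (\<Sum>i | i < length as \<and> as ! i = x. s (t i) (e i))"
    by (simp add: sum.If_cases Int_def)
  finally show "free_map Q s L as e x ?w = (\<Sum>i | i < length as \<and> as ! i = x. s (t i) (e i))" .
qed

text \<open>Together with \<open>P_sum_decomposition\<close> this expresses \<open>free_map\<close>
  at \<open>x\<close> by its values at the tails of incoming arrows and the generators at
  \<open>x\<close>, which is the recursion behind both the image and the injectivity
  statement.\<close>

lemma free_map_sum_act:
  assumes x: "x \<in> verts Q" and v: "\<And>\<alpha>. \<alpha> \<in> in_arcs Q x \<Longrightarrow> v \<alpha> \<in> sp (P_sum Q as) (tail Q \<alpha>)"
  shows "free_map Q s L as e x ((\<Sum>\<alpha>\<in>in_arcs Q x. act (P_sum Q as) \<alpha> (v \<alpha>)) +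
      (\<lambda>i q. if i < length as \<and> q = [] \<and> as ! i = x then t i else 0)) =
    (\<Sum>\<alpha>\<in>in_arcs Q x. act L \<alpha> (free_map Q s L as e (tail Q \<alpha>) (v \<alpha>))) +
    (\<Sum>i | i < length as \<and> as ! i = x. s (t i) (e i))"
    and "(\<Sum>\<alpha>\<in>in_arcs Q x. act (P_sum Q as) \<alpha> (v \<alpha>)) +
      (\<lambda>i q. if i < length as \<and> q = [] \<and> as ! i = x then t i else 0) \<in> sp (P_sum Q as) x"
proof -
  note PR = P_sum_rep[OF as, where ?'k = 'k]
  have av: "act (P_sum Q as) \<alpha> (v \<alpha>) \<in> sp (P_sum Q as) x" if "\<alpha> \<in> in_arcs Q x" for \<alpha>
    using rep_act_in_sp[OF PR _ v[OF that]] that by auto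
  have sum: "(\<Sum>\<alpha>\<in>in_arcs Q x. act (P_sum Q as) \<alpha> (v \<alpha>)) \<in> sp (P_sum Q as) x"
    using av by (rule rep_sum[OF vector_space_path_scale PR x])
  then show "(\<Sum>\<alpha>\<in>in_arcs Q x. act (P_sum Q as) \<alpha> (v \<alpha>)) +
      (\<lambda>i q. if i < length as \<and> q = [] \<and> as ! i = x then t i else 0) \<in> sp (P_sum Q as) x"
    using P_sum_generators(1)[OF x] by (intro rep_add[OF vector_space_path_scale PR x])
  have "free_map Q s L as e x (\<Sum>\<alpha>\<in>in_arcs Q x. act (P_sum Q as) \<alpha> (v \<alpha>)) =
      (\<Sum>\<alpha>\<in>in_arcs Q x. free_map Q s L as e x (act (P_sum Q as) \<alpha> (v \<alpha>)))"
    using av by (rule Hom_sum[OF vector_space_path_scale PR s free_map_Hom x])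
  also have "\<dots> = (\<Sum>\<alpha>\<in>in_arcs Q x. act L \<alpha> (free_map Q s L as e (tail Q \<alpha>) (v \<alpha>)))"
    using Hom_act[OF free_map_Hom _ v] by (intro sum.cong) auto
  finally show "free_map Q s L as e x ((\<Sum>\<alpha>\<in>in_arcs Q x. act (P_sum Q as) \<alpha> (v \<alpha>)) +
      (\<lambda>i q. if i < length as \<and> q = [] \<and> as ! i = x then t i else 0)) =
    (\<Sum>\<alpha>\<in>in_arcs Q x. act L \<alpha> (free_map Q s L as e (tail Q \<alpha>) (v \<alpha>))) +
    (\<Sum>i | i < length as \<and> as ! i = x. s (t i) (e i))"
    using P_sum_generators[OF x, of t] Hom_add[OF vector_space_path_scale PR s free_map_Hom x sum] by simp
qed

lemma free_map_in_closed:
  assumes U: "\<And>x. x \<in> verts Q \<Longrightarrow> s.subspace (U x)"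
    "\<And>\<alpha> u. \<alpha> \<in> arcs Q \<Longrightarrow> u \<in> U (tail Q \<alpha>) \<Longrightarrow> act L \<alpha> u \<in> U (head Q \<alpha>)"
    and eU: "\<And>i. i < length as \<Longrightarrow> e i \<in> U (as ! i)" and x: "x \<in> verts Q"
  shows "free_map Q s L as e x (w :: nat \<Rightarrow> 'e list \<Rightarrow> 'k) \<in> U x"
  unfolding free_map_def
  using s.subspace_0[OF U(1)[OF x]] path_act_closed[of U, OF U(2) _ eU]
  by (auto intro!: s.subspace_sum[OF U(1)[OF x]] s.subspace_scale[OF U(1)[OF x]])

text \<open>Induction along the arrows: by \<open>gen\<close> a vector at \<open>x\<close> is made
  of vectors at the tails of incoming arrows, which have preimages already, and of generators placed
  at \<open>x\<close>. The family \<open>U\<close> allows the intended image to be a proper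
  subrepresentation, such as a kernel.\<close>

lemma free_map_image:
  assumes U: "\<And>x. x \<in> verts Q \<Longrightarrow> s.subspace (U x)"
    "\<And>\<alpha> u. \<alpha> \<in> arcs Q \<Longrightarrow> u \<in> U (tail Q \<alpha>) \<Longrightarrow> act L \<alpha> u \<in> U (head Q \<alpha>)"
    and eU: "\<And>i. i < length as \<Longrightarrow> e i \<in> U (as ! i)"
    and A: "finite A" "\<And>x. x \<in> verts Q \<Longrightarrow> x \<notin> succs A \<Longrightarrow> U x \<subseteq> {0}"
    and gen: "\<And>x u. x \<in> verts Q \<Longrightarrow> u \<in> U x \<Longrightarrow> \<exists>v t. (\<forall>\<alpha>\<in>in_arcs Q x. v \<alpha> \<in> U (tail Q \<alpha>)) \<and>
      u = (\<Sum>\<alpha>\<in>in_arcs Q x. act L \<alpha> (v \<alpha>)) + (\<Sum>i | i < length as \<and> as ! i = x. s (t i) (e i))"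
    and x: "x \<in> verts Q"
  shows "free_map Q s L as e x ` sp (P_sum Q as) x = U x"
proof
  show "free_map Q s L as e x ` sp (P_sum Q as) x \<subseteq> U x"
    by (rule image_subsetI) (rule free_map_in_closed[of U, OF U eU x])
  note PR = P_sum_rep[OF as, where ?'k = 'k]
  show "U x \<subseteq> free_map Q s L as e x ` sp (P_sum Q as) x"
    using A(1) x
  proof (induction x rule: succs_induct)
    case (outside x)
    have "0 \<in> free_map Q s L as e x ` sp (P_sum Q as) x"
      using imageI[OF rep_zero[OF vector_space_path_scale PR outside(1)], of "free_map Q s L as e x"]
      by (simp only: Hom_zero[OF vector_space_path_scale PR s free_map_Hom])
    then show ?case using A(2)[OF outside] by blast
  next
    case (step x)
    show ?case
    proof
      fix u assume "u \<in> U x"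
      then obtain v t where v: "\<And>\<alpha>. \<alpha> \<in> in_arcs Q x \<Longrightarrow> v \<alpha> \<in> U (tail Q \<alpha>)" and
        u: "u = (\<Sum>\<alpha>\<in>in_arcs Q x. act L \<alpha> (v \<alpha>)) + (\<Sum>i | i < length as \<and> as ! i = x. s (t i) (e i))"
        using gen[OF step.hyps] by blast
      have "\<forall>\<alpha>\<in>in_arcs Q x. \<exists>w\<in>sp (P_sum Q as) (tail Q \<alpha>). v \<alpha> = free_map Q s L as e (tail Q \<alpha>) w"
        using v step.IH by blast
      then obtain w where w: "\<And>\<alpha>. \<alpha> \<in> in_arcs Q x \<Longrightarrow> w \<alpha> \<in> sp (P_sum Q as) (tail Q \<alpha>)"
        "\<And>\<alpha>. \<alpha> \<in> in_arcs Q x \<Longrightarrow> v \<alpha> = free_map Q s L as e (tail Q \<alpha>) (w \<alpha>)"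
        by metis
      have "u = (\<Sum>\<alpha>\<in>in_arcs Q x. act L \<alpha> (free_map Q s L as e (tail Q \<alpha>) (w \<alpha>))) +
          (\<Sum>i | i < length as \<and> as ! i = x. s (t i) (e i))"
        unfolding u using w(2) by simp
      also note free_map_sum_act(1)[OF step.hyps w(1), of t, symmetric]
      finally show "u \<in> free_map Q s L as e x ` sp (P_sum Q as) x"
        by (rule image_eqI[where f = "free_map Q s L as e x"]) (assumption | rule free_map_sum_act(2)[OF step.hyps w(1)])+
    qed
  qed
qed

text \<open>An element of the kernel is split by last arrows. The condition \<open>indep\<close>
  shows that the coefficients at trivial paths vanish and that the part belonging to each arrow is
  again in the kernel, so that the induction along the arrows applies to it.\<close>

lemma free_map_inj:
  assumes U: "\<And>x. x \<in> verts Q \<Longrightarrow> s.subspace (U x)"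
    "\<And>\<alpha> u. \<alpha> \<in> arcs Q \<Longrightarrow> u \<in> U (tail Q \<alpha>) \<Longrightarrow> act L \<alpha> u \<in> U (head Q \<alpha>)"
    and eU: "\<And>i. i < length as \<Longrightarrow> e i \<in> U (as ! i)"
    and indep: "\<And>x v t. x \<in> verts Q \<Longrightarrow> (\<And>\<alpha>. \<alpha> \<in> in_arcs Q x \<Longrightarrow> v \<alpha> \<in> U (tail Q \<alpha>)) \<Longrightarrow>
      (\<Sum>\<alpha>\<in>in_arcs Q x. act L \<alpha> (v \<alpha>)) + (\<Sum>i | i < length as \<and> as ! i = x. s (t i) (e i)) = 0 \<Longrightarrow>
      (\<forall>\<alpha>\<in>in_arcs Q x. v \<alpha> = 0) \<and> (\<forall>i<length as. as ! i = x \<longrightarrow> t i = 0)"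
    and x: "x \<in> verts Q"
  shows "inj_on (free_map Q s L as e x) (sp (P_sum Q as) x)"
proof -
  note PR = P_sum_rep[OF as, where ?'k = 'k]
  have ker: "w = 0" if "w \<in> sp (P_sum Q as) x" "free_map Q s L as e x w = 0" for w
    using finite_set[of as] x that
  proof (induction x arbitrary: w rule: succs_induct)
    case (outside x)
    then show ?case using P_sum_zero_outside[OF as] by blast
  next
    case (step x)
    obtain v where v: "\<And>\<alpha>. \<alpha> \<in> in_arcs Q x \<Longrightarrow> v \<alpha> \<in> sp (P_sum Q as) (tail Q \<alpha>)" and
      w: "w = (\<Sum>\<alpha>\<in>in_arcs Q x. act (P_sum Q as) \<alpha> (v \<alpha>)) +
        (\<lambda>i q. if i < length as \<and> q = [] \<and> as ! i = x then w i [] else 0)"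
      using P_sum_decomposition[OF as step.hyps step.prems(1)] by blast
    have "(\<Sum>\<alpha>\<in>in_arcs Q x. act L \<alpha> (free_map Q s L as e (tail Q \<alpha>) (v \<alpha>))) +
        (\<Sum>i | i < length as \<and> as ! i = x. s (w i []) (e i)) = 0"
      using free_map_sum_act(1)[OF step.hyps v, of "\<lambda>i. w i []"] step.prems(2) unfolding w[symmetric] by simp
    moreover have "free_map Q s L as e (tail Q \<alpha>) (v \<alpha>) \<in> U (tail Q \<alpha>)" if "\<alpha> \<in> in_arcs Q x" for \<alpha>
      by (rule free_map_in_closed[of U, OF U eU]) (use that in auto)
    ultimately have "(\<forall>\<alpha>\<in>in_arcs Q x. free_map Q s L as e (tail Q \<alpha>) (v \<alpha>) = 0) \<and>
        (\<forall>i<length as. as ! i = x \<longrightarrow> w i [] = 0)"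
      using indep[OF step.hyps, of "\<lambda>\<alpha>. free_map Q s L as e (tail Q \<alpha>) (v \<alpha>)" "\<lambda>i. w i []"] by blast
    then have "\<forall>\<alpha>\<in>in_arcs Q x. v \<alpha> = 0" "\<forall>i<length as. as ! i = x \<longrightarrow> w i [] = 0"
      using step.IH v by blast+
    note 0 = this
    have "(\<Sum>\<alpha>\<in>in_arcs Q x. act (P_sum Q as) \<alpha> (v \<alpha>)) = 0"
    proof (rule sum.neutral, rule ballI)
      fix \<alpha> assume "\<alpha> \<in> in_arcs Q x"
      then show "act (P_sum Q as) \<alpha> (v \<alpha>) = 0"
        using 0(1) rep_act_zero[OF vector_space_path_scale PR wf, of \<alpha>] by simp
    qed
    moreover have "(\<lambda>i q. if i < length as \<and> q = [] \<and> as ! i = x then w i [] else 0) = 0"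
      using 0(2) by (auto simp: fun_eq_iff)
    ultimately have "(\<Sum>\<alpha>\<in>in_arcs Q x. act (P_sum Q as) \<alpha> (v \<alpha>)) +
        (\<lambda>i q. if i < length as \<and> q = [] \<and> as ! i = x then w i [] else 0) = 0"
      by (simp only: add_0_right add_0_left)
    from trans[OF w this] show ?case .
  qed
  show ?thesis
  proof (rule inj_onI)
    fix u v assume uv: "u \<in> sp (P_sum Q as) x" "v \<in> sp (P_sum Q as) x"
      and eq: "free_map Q s L as e x u = free_map Q s L as e x v"
    have "u - v = 0"
      using Hom_diff[OF vector_space_path_scale PR s free_map_Hom x uv] eq
        rep_diff[OF vector_space_path_scale PR x uv] by (intro ker) auto
    then show "u = v" by simp
  qed
qed

end

end

section \<open>Characterisation of finitely presented representations\<close>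

definition eventually_in_iso :: "('v, 'e, 'w::ab_group_add) quiver_rep \<Rightarrow> bool" where
  "eventually_in_iso L \<longleftrightarrow> (\<exists>A F. finite A \<and> A \<subseteq> verts Q \<and> finite F \<and>
    (\<forall>x\<in>verts Q - succs A. sp L x \<subseteq> {0}) \<and> (\<forall>x\<in>verts Q - F. in_iso Q L x))"

text \<open>Naturality of the map from the direct sum over the incoming arrows.\<close>

lemma Hom_sum_in_arcs:
  assumes "vector_space s" "vector_space t" "M \<in> rep Q s" "f \<in> Hom Q s t M N" "x \<in> verts Q"
    "\<And>\<alpha>. \<alpha> \<in> in_arcs Q x \<Longrightarrow> v \<alpha> \<in> sp M (tail Q \<alpha>)"
  shows "(\<Sum>\<alpha>\<in>in_arcs Q x. act M \<alpha> (v \<alpha>)) \<in> sp M x"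
    and "f x (\<Sum>\<alpha>\<in>in_arcs Q x. act M \<alpha> (v \<alpha>)) = (\<Sum>\<alpha>\<in>in_arcs Q x. act N \<alpha> (f (tail Q \<alpha>) (v \<alpha>)))"
proof -
  have av: "act M \<alpha> (v \<alpha>) \<in> sp M x" if "\<alpha> \<in> in_arcs Q x" for \<alpha>
    using rep_act_in_sp[OF assms(3) _ assms(6)[OF that]] that by auto
  then show "(\<Sum>\<alpha>\<in>in_arcs Q x. act M \<alpha> (v \<alpha>)) \<in> sp M x"
    by (rule rep_sum[OF assms(1,3,5)])
  have "f x (\<Sum>\<alpha>\<in>in_arcs Q x. act M \<alpha> (v \<alpha>)) = (\<Sum>\<alpha>\<in>in_arcs Q x. f x (act M \<alpha> (v \<alpha>)))"
    using av by (rule Hom_sum[OF assms(1,3,2,4,5)])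
  also have "\<dots> = (\<Sum>\<alpha>\<in>in_arcs Q x. act N \<alpha> (f (tail Q \<alpha>) (v \<alpha>)))"
    using Hom_act[OF assms(4) _ assms(6)] by (intro sum.cong) auto
  finally show "f x (\<Sum>\<alpha>\<in>in_arcs Q x. act M \<alpha> (v \<alpha>)) = (\<Sum>\<alpha>\<in>in_arcs Q x. act N \<alpha> (f (tail Q \<alpha>) (v \<alpha>)))" .
qed

text \<open>A chase as in the five lemma. Surjectivity for \<open>L\<close> comes from that for
  \<open>P\<close>; for injectivity, a family in \<open>L\<close> with sum zero is lifted to
  \<open>P\<close> and corrected by a family from \<open>K\<close>, using surjectivity for
  \<open>K\<close> and injectivity for \<open>P\<close>.\<close>

lemma in_iso_quotient:
  assumes r: "vector_space r" and s: "vector_space s" and t: "vector_space t"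
    and K: "K \<in> rep Q r" and P: "P \<in> rep Q s"
    and ex: "short_exact Q r s t K f P g L" and x: "x \<in> verts Q"
    and iso: "in_iso Q K x" "in_iso Q P x"
  shows "in_iso Q L x"
proof -
  have f: "f \<in> Hom Q r s K P" and g: "g \<in> Hom Q s t P L"
    and ker: "\<And>x. x \<in> verts Q \<Longrightarrow> f x ` sp K x = {u \<in> sp P x. g x u = 0}"
    and surj: "\<And>x. x \<in> verts Q \<Longrightarrow> g x ` sp P x = sp L x"
    using ex by (auto simp: short_exact_def)
  show ?thesis
  proof (rule in_isoI)
    fix u assume "u \<in> sp L x"
    then obtain w where w: "w \<in> sp P x" "u = g x w" using surj[OF x] by blast
    obtain v where v: "\<And>\<alpha>. \<alpha> \<in> in_arcs Q x \<Longrightarrow> v \<alpha> \<in> sp P (tail Q \<alpha>)"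
      and wv: "w = (\<Sum>\<alpha>\<in>in_arcs Q x. act P \<alpha> (v \<alpha>))"
      using in_iso_surj[OF iso(2) w(1)] by blast
    have "u = (\<Sum>\<alpha>\<in>in_arcs Q x. act L \<alpha> (g (tail Q \<alpha>) (v \<alpha>)))"
      using Hom_sum_in_arcs(2)[OF s t P g x v] w(2) wv by simp
    moreover have "\<forall>\<alpha>\<in>in_arcs Q x. g (tail Q \<alpha>) (v \<alpha>) \<in> sp L (tail Q \<alpha>)"
      using Hom_in_sp[OF g _ v] by auto
    ultimately show "\<exists>v. (\<forall>\<alpha>\<in>in_arcs Q x. v \<alpha> \<in> sp L (tail Q \<alpha>)) \<and> u = (\<Sum>\<alpha>\<in>in_arcs Q x. act L \<alpha> (v \<alpha>))"
      by (intro exI[of _ "\<lambda>\<alpha>. g (tail Q \<alpha>) (v \<alpha>)"] conjI)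
  next
    fix v \<alpha> assume v: "\<And>\<alpha>. \<alpha> \<in> in_arcs Q x \<Longrightarrow> v \<alpha> \<in> sp L (tail Q \<alpha>)"
      and 0: "(\<Sum>\<alpha>\<in>in_arcs Q x. act L \<alpha> (v \<alpha>)) = 0" and a: "\<alpha> \<in> in_arcs Q x"
    have "\<forall>\<alpha>\<in>in_arcs Q x. \<exists>w\<in>sp P (tail Q \<alpha>). v \<alpha> = g (tail Q \<alpha>) w"
    proof
      fix \<alpha> assume "\<alpha> \<in> in_arcs Q x"
      then show "\<exists>w\<in>sp P (tail Q \<alpha>). v \<alpha> = g (tail Q \<alpha>) w" using surj[of "tail Q \<alpha>"] v[of \<alpha>] by auto
    qed
    then obtain w where w: "\<And>\<alpha>. \<alpha> \<in> in_arcs Q x \<Longrightarrow> w \<alpha> \<in> sp P (tail Q \<alpha>)"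
      and vw: "\<And>\<alpha>. \<alpha> \<in> in_arcs Q x \<Longrightarrow> v \<alpha> = g (tail Q \<alpha>) (w \<alpha>)"
      by metis
    have "g x (\<Sum>\<alpha>\<in>in_arcs Q x. act P \<alpha> (w \<alpha>)) = 0"
      using Hom_sum_in_arcs(2)[OF s t P g x w] 0 vw by simp
    then have "(\<Sum>\<alpha>\<in>in_arcs Q x. act P \<alpha> (w \<alpha>)) \<in> f x ` sp K x"
      unfolding ker[OF x] using Hom_sum_in_arcs(1)[OF s t P g x w] by simp
    then obtain k where k: "k \<in> sp K x" "f x k = (\<Sum>\<alpha>\<in>in_arcs Q x. act P \<alpha> (w \<alpha>))"
      by (metis imageE)
    obtain k' where k': "\<And>\<alpha>. \<alpha> \<in> in_arcs Q x \<Longrightarrow> k' \<alpha> \<in> sp K (tail Q \<alpha>)"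
      and kk': "k = (\<Sum>\<alpha>\<in>in_arcs Q x. act K \<alpha> (k' \<alpha>))"
      using in_iso_surj[OF iso(1) k(1)] by blast
    have fk: "f (tail Q \<alpha>) (k' \<alpha>) \<in> sp P (tail Q \<alpha>)" if "\<alpha> \<in> in_arcs Q x" for \<alpha>
      using Hom_in_sp[OF f _ k'[OF that]] that by auto
    have d: "w \<alpha> - f (tail Q \<alpha>) (k' \<alpha>) \<in> sp P (tail Q \<alpha>)" if "\<alpha> \<in> in_arcs Q x" for \<alpha>
      using rep_diff[OF s P _ w[OF that] fk[OF that]] that by auto
    \<comment> \<open>The corrected lift has sum zero and therefore vanishes; so \<open>w\<close>
      comes from \<open>K\<close> and is killed by \<open>g\<close>.\<close>
    have "(\<Sum>\<alpha>\<in>in_arcs Q x. act P \<alpha> (w \<alpha> - f (tail Q \<alpha>) (k' \<alpha>))) =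
        (\<Sum>\<alpha>\<in>in_arcs Q x. act P \<alpha> (w \<alpha>) - act P \<alpha> (f (tail Q \<alpha>) (k' \<alpha>)))"
      using rep_act_diff[OF s P wf _ w fk] by (intro sum.cong) auto
    also have "\<dots> = 0"
      using Hom_sum_in_arcs(2)[OF r s K f x k'] k(2) kk' by (simp add: sum_subtractf)
    finally have "w \<alpha> - f (tail Q \<alpha>) (k' \<alpha>) = 0"
      using in_iso_inj[OF iso(2), of "\<lambda>\<alpha>. w \<alpha> - f (tail Q \<alpha>) (k' \<alpha>)"] d a by blast
    then have "v \<alpha> = g (tail Q \<alpha>) (f (tail Q \<alpha>) (k' \<alpha>))" using vw[OF a] by simp
    also have "\<dots> = 0" using ker[of "tail Q \<alpha>"] k'[OF a] a by auto
    finally show "v \<alpha> = 0" .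
  qed
qed

lemma eventually_in_iso_if_rep_plus:
  fixes s :: "'k::field \<Rightarrow> 'w::ab_group_add \<Rightarrow> 'w"
  assumes s: "vector_space s" and "L \<in> rep_plus Q s"
  shows "eventually_in_iso L"
proof -
  obtain as bs f g where as: "set as \<subseteq> verts Q" and bs: "set bs \<subseteq> verts Q"
    and ex: "short_exact Q path_scale path_scale s (P_sum Q bs) f (P_sum Q as) g L"
    using assms(2) by (auto simp: rep_plus_def)
  note PA = P_sum_rep[OF as, where ?'k = 'k] and PB = P_sum_rep[OF bs, where ?'k = 'k]
  show ?thesis
    unfolding eventually_in_iso_def
  proof (intro exI conjI ballI)
    show "finite (set as)" "set as \<subseteq> verts Q" "finite (set as \<union> set bs)" using as by auto
  next
    fix x assume "x \<in> verts Q - succs (set as)"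
    then show "sp L x \<subseteq> {0}"
      using P_sum_zero_outside[OF as, of x, where ?'k = 'k] ex
        Hom_zero[OF vector_space_path_scale PA s, of g L x] unfolding short_exact_def by fastforce
  next
    fix x assume "x \<in> verts Q - (set as \<union> set bs)"
    then show "in_iso Q L x"
      using P_sum_in_iso[OF as, of x] P_sum_in_iso[OF bs, of x]
      by (intro in_iso_quotient[OF vector_space_path_scale vector_space_path_scale s PB PA ex]) auto
  qed
qed

text \<open>
  The generators of \<open>L\<close> are bases of its spaces at the exceptional vertices. The kernel \<open>K\<close> of the
  resulting map \<open>g\<close> from a sum of \<open>P_a\<close> has, like every subrepresentation of such a sum, injective
  maps from the in-arcs, so complements of their images generate it freely.
\<close>

lemma rep_plus_if_eventually_in_iso:
  fixes s :: "'k::field \<Rightarrow> 'w::ab_group_add \<Rightarrow> 'w"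
  assumes s: "vector_space s" and L: "L \<in> rep Q s" and "eventually_in_iso L"
  shows "L \<in> rep_plus Q s"
proof -
  interpret s: vector_space s by (rule s)
  interpret ps: vector_space "path_scale :: 'k \<Rightarrow> (nat \<Rightarrow> 'e list \<Rightarrow> 'k) \<Rightarrow> _"
    by (rule vector_space_path_scale)
  note ps = vector_space_path_scale[where ?'k = 'k and ?'e = 'e]
  obtain A F0 where A: "finite A" "\<And>x. x \<in> verts Q \<Longrightarrow> x \<notin> succs A \<Longrightarrow> sp L x \<subseteq> {0}"
    and F0: "finite F0" "\<And>x. x \<in> verts Q \<Longrightarrow> x \<notin> F0 \<Longrightarrow> in_iso Q L x"
    using assms(3) unfolding eventually_in_iso_def by blast
  define F where "F = F0 \<inter> verts Q"
  have F: "finite F" "F \<subseteq> verts Q" "\<And>x. x \<in> verts Q \<Longrightarrow> x \<notin> F \<Longrightarrow> in_iso Q L x"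
    using F0 by (auto simp: F_def)
  have "\<forall>x\<in>F. \<exists>B. finite B \<and> B \<subseteq> sp L x \<and> s.span B = sp L x"
    using s.fin_dim_basis[OF rep_fin_dim[OF L] rep_subspace[OF L]] F(2) by (metis subsetD)
  then obtain B where B: "\<And>x. x \<in> F \<Longrightarrow> finite (B x) \<and> B x \<subseteq> sp L x \<and> s.span (B x) = sp L x"
    by metis
  obtain gs where gs: "set gs = Sigma F B" "distinct gs"
    using finite_distinct_list[of "Sigma F B"] F(1) B by auto
  define as e where "as = map fst gs" and "e i = snd (gs ! i)" for i
  have as: "set as \<subseteq> verts Q" "set as \<subseteq> F" using gs F by (auto simp: as_def)
  have gs_nth: "as ! i \<in> F" "e i \<in> B (as ! i)" if "i < length as" for i
  proof -
    have "gs ! i \<in> Sigma F B" using that gs(1) nth_mem[of i gs] by (simp add: as_def)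
    then show "as ! i \<in> F" "e i \<in> B (as ! i)" using that by (auto simp: as_def e_def)
  qed
  have e: "e i \<in> sp L (as ! i)" if "i < length as" for i
    using gs_nth[OF that] B by auto
  define g where "g = free_map Q s L as e"
  define P where "P = (P_sum Q as :: ('v, 'e, nat \<Rightarrow> 'e list \<Rightarrow> 'k) quiver_rep)"
  have P: "P \<in> rep Q path_scale" unfolding P_def by (rule P_sum_rep[OF as(1)])
  have g: "g \<in> Hom Q path_scale s P L" unfolding g_def P_def by (rule free_map_Hom[OF s L as(1) e])
  have g_surj: "g x ` sp P x = sp L x" if "x \<in> verts Q" for x
    unfolding g_def P_def
  proof (rule free_map_image[where U = "sp L" and A = A])
    fix x u assume x: "x \<in> verts Q" and u: "u \<in> sp L x"
    show "\<exists>v t. (\<forall>\<alpha>\<in>in_arcs Q x. v \<alpha> \<in> sp L (tail Q \<alpha>)) \<and>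
      u = (\<Sum>\<alpha>\<in>in_arcs Q x. act L \<alpha> (v \<alpha>)) + (\<Sum>i | i < length as \<and> as ! i = x. s (t i) (e i))"
    proof (cases "x \<in> F")
      case True
      have "finite (B x)" "u \<in> s.span (B x)" using B[OF True] u by simp_all
      then have "u \<in> range (\<lambda>t. \<Sum>b\<in>B x. s (t b) b)" by (simp only: s.span_finite)
      then obtain t where t: "u = (\<Sum>b\<in>B x. s (t b) b)" by blast
      have "(\<Sum>i | i < length as \<and> as ! i = x. s (t (e i)) (e i)) = u"
        using sum_list_fibre[OF gs(2), where x = x and f = "\<lambda>b. s (t b) b"] True gs(1) t
        by (simp add: as_def e_def)
      moreover have "(\<Sum>\<alpha>\<in>in_arcs Q x. act L \<alpha> 0) = 0"
        using rep_act_zero[OF s L wf] by (intro sum.neutral) auto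
      ultimately show ?thesis
        using rep_zero[OF s L] by (intro exI[of _ "\<lambda>_. 0"] exI[of _ "\<lambda>i. t (e i)"]) auto
    next
      case False
      obtain v where "\<And>\<alpha>. \<alpha> \<in> in_arcs Q x \<Longrightarrow> v \<alpha> \<in> sp L (tail Q \<alpha>)" "u = (\<Sum>\<alpha>\<in>in_arcs Q x. act L \<alpha> (v \<alpha>))"
        using in_iso_surj[OF F(3)[OF x False] u] by blast
      then show ?thesis by (intro exI[of _ v] exI[of _ "\<lambda>_. 0"]) simp
    qed
  qed (use s L as(1) e rep_subspace[OF L] rep_act_in_sp[OF L] A that in blast)+
  define K where "K x = {w \<in> sp P x. g x w = 0}" for x
  have K_sub: "ps.subspace (K x)" if "x \<in> verts Q" for x
    unfolding K_def by (rule subspace_linear_kernel[OF ps s rep_subspace[OF P that] Hom_linear[OF g that]])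
  have K_act: "act P \<alpha> w \<in> K (head Q \<alpha>)" if "\<alpha> \<in> arcs Q" "w \<in> K (tail Q \<alpha>)" for \<alpha> w
    using that Hom_act[OF g] rep_act_in_sp[OF P] rep_act_zero[OF s L wf] by (auto simp: K_def)
  have K_sum: "(\<Sum>\<alpha>\<in>in_arcs Q x. act P \<alpha> (v \<alpha>)) \<in> K x"
    if "x \<in> verts Q" "\<And>\<alpha>. \<alpha> \<in> in_arcs Q x \<Longrightarrow> v \<alpha> \<in> K (tail Q \<alpha>)" for x v
  proof (rule ps.subspace_sum[OF K_sub[OF that(1)]])
    fix \<alpha> assume "\<alpha> \<in> in_arcs Q x"
    then show "act P \<alpha> (v \<alpha>) \<in> K x" using K_act[of \<alpha> "v \<alpha>"] that(2)[of \<alpha>] by auto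
  qed
  \<comment> \<open>The part of the kernel at \<open>x\<close> that arrives along incoming arrows;
    new generators at \<open>x\<close> have to supply a complement of \<open>R x\<close> in
    \<open>K x\<close>.\<close>
  define R where "R x = {(\<Sum>\<alpha>\<in>in_arcs Q x. act P \<alpha> (v \<alpha>)) | v. \<forall>\<alpha>\<in>in_arcs Q x. v \<alpha> \<in> K (tail Q \<alpha>)}" for x
  have R_intro: "u \<in> R x" if "\<forall>\<alpha>\<in>in_arcs Q x. v \<alpha> \<in> K (tail Q \<alpha>)" "u = (\<Sum>\<alpha>\<in>in_arcs Q x. act P \<alpha> (v \<alpha>))"
    for x u v using that by (auto simp: R_def)
  have R_sub: "ps.subspace (R x)" if x: "x \<in> verts Q" for x
  proof (rule ps.subspaceI)
    show "0 \<in> R x"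
      using rep_act_zero[OF ps P wf] ps.subspace_0[OF K_sub]
      by (intro R_intro[of x "\<lambda>_. 0"]) (auto intro!: sum.neutral[symmetric])
  next
    fix u w assume "u \<in> R x" "w \<in> R x"
    then obtain a b where a: "\<And>\<alpha>. \<alpha> \<in> in_arcs Q x \<Longrightarrow> a \<alpha> \<in> K (tail Q \<alpha>)" "u = (\<Sum>\<alpha>\<in>in_arcs Q x. act P \<alpha> (a \<alpha>))"
      and b: "\<And>\<alpha>. \<alpha> \<in> in_arcs Q x \<Longrightarrow> b \<alpha> \<in> K (tail Q \<alpha>)" "w = (\<Sum>\<alpha>\<in>in_arcs Q x. act P \<alpha> (b \<alpha>))"
      unfolding R_def by blast
    have "u + w = (\<Sum>\<alpha>\<in>in_arcs Q x. act P \<alpha> (a \<alpha> + b \<alpha>))"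
      using a b rep_act_add[OF ps P wf] by (auto simp: K_def sum.distrib[symmetric] intro!: sum.cong)
    moreover have "\<forall>\<alpha>\<in>in_arcs Q x. a \<alpha> + b \<alpha> \<in> K (tail Q \<alpha>)"
      using a(1) b(1) ps.subspace_add[OF K_sub] by auto
    ultimately show "u + w \<in> R x" by (intro R_intro[of x "\<lambda>\<alpha>. a \<alpha> + b \<alpha>"])
  next
    fix c u assume "u \<in> R x"
    then obtain a where a: "\<And>\<alpha>. \<alpha> \<in> in_arcs Q x \<Longrightarrow> a \<alpha> \<in> K (tail Q \<alpha>)" "u = (\<Sum>\<alpha>\<in>in_arcs Q x. act P \<alpha> (a \<alpha>))"
      unfolding R_def by blast
    have "path_scale c u = (\<Sum>\<alpha>\<in>in_arcs Q x. act P \<alpha> (path_scale c (a \<alpha>)))"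
      using a rep_act_scale[OF ps P wf] by (auto simp: K_def ps.scale_sum_right intro!: sum.cong)
    moreover have "\<forall>\<alpha>\<in>in_arcs Q x. path_scale c (a \<alpha>) \<in> K (tail Q \<alpha>)"
      using a(1) ps.subspace_scale[OF K_sub] by auto
    ultimately show "path_scale c u \<in> R x" by (intro R_intro[of x "\<lambda>\<alpha>. path_scale c (a \<alpha>)"])
  qed
  \<comment> \<open>\<open>C\<close> is a basis of a complement of \<open>R x\<close> in
    \<open>K x\<close> with dual forms \<open>l\<close>. Bundling these properties allows
    \<open>C\<close> and \<open>l\<close> to be chosen for all vertices at once.\<close>
  define coord where "coord x C l \<longleftrightarrow> finite C \<and> C \<subseteq> K x \<and> (\<forall>c. linear_on path_scale (*) (K x) (l c)) \<and>
      (\<forall>c\<in>C. \<forall>v\<in>R x. l c v = 0) \<and> (\<forall>c\<in>C. \<forall>d\<in>C. l c d = (if c = d then 1 else 0)) \<and>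
      (\<forall>z\<in>K x. (\<forall>c\<in>C. l c z = 0) \<longrightarrow> z \<in> R x)"
    for x and C :: "(nat \<Rightarrow> 'e list \<Rightarrow> 'k) set" and l :: "_ \<Rightarrow> _ \<Rightarrow> 'k"
  have "\<exists>C l. coord x C l" if x: "x \<in> verts Q" for x
  proof -
    have fd: "fin_dim path_scale (K x)"
      by (rule ps.fin_dim_subspace[OF rep_fin_dim[OF P x] K_sub[OF x]]) (auto simp: K_def)
    have RK: "R x \<subseteq> K x" using K_sum[OF x] by (auto simp: R_def)
    show ?thesis
    proof (rule ps.fin_dim_relative_coordinates[OF fd K_sub[OF x] R_sub[OF x] K_sub[OF x] RK subset_refl])
      fix C and l :: "_ \<Rightarrow> _ \<Rightarrow> 'k"
      assume "finite C" "C \<subseteq> K x" "\<And>c. linear_on path_scale (*) (K x) (l c)"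
        "\<And>c v. c \<in> C \<Longrightarrow> v \<in> R x \<Longrightarrow> l c v = 0"
        "\<And>c d. c \<in> C \<Longrightarrow> d \<in> C \<Longrightarrow> l c d = (if c = d then 1 else 0)"
        "\<And>z. z \<in> K x \<Longrightarrow> (\<And>c. c \<in> C \<Longrightarrow> l c z = 0) \<Longrightarrow> z \<in> R x"
      then have "coord x C l" unfolding coord_def by blast
      then show ?thesis by blast
    qed
  qed
  then obtain C l where coord: "\<And>x. x \<in> verts Q \<Longrightarrow> coord x (C x) (l x)" by metis
  have C: "finite (C x) \<and> C x \<subseteq> K x" and l_lin: "linear_on path_scale (*) (K x) (l x c)"
    and lR: "c \<in> C x \<Longrightarrow> v \<in> R x \<Longrightarrow> l x c v = 0"
    and lC: "c \<in> C x \<Longrightarrow> d \<in> C x \<Longrightarrow> l x c d = (if c = d then 1 else 0)"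
    and lK: "z \<in> K x \<Longrightarrow> (\<And>c. c \<in> C x \<Longrightarrow> l x c z = 0) \<Longrightarrow> z \<in> R x"
    if "x \<in> verts Q" for x c d v z
    using coord[OF that] unfolding coord_def by blast+
  have l_sum: "l x c (\<Sum>d\<in>C x. path_scale (t d) d) = t c" if x: "x \<in> verts Q" and c: "c \<in> C x" for x c t
  proof -
    have "l x c (\<Sum>d\<in>C x. path_scale (t d) d) = (\<Sum>d\<in>C x. l x c (path_scale (t d) d))"
      by (rule linear_on_sum[OF ps vector_space_field K_sub[OF x] l_lin[OF x]])
        (use C[OF x] ps.subspace_scale[OF K_sub[OF x]] in auto)
    also have "\<dots> = (\<Sum>d\<in>C x. if d = c then t c else 0)"
      using C[OF x] lC[OF x c] by (intro sum.cong) (auto simp: linear_on_scale[OF l_lin[OF x]])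
    finally show ?thesis using C[OF x] c by simp
  qed
  obtain hs where hs: "set hs = Sigma F C" "distinct hs"
    using finite_distinct_list[of "Sigma F C"] F(1,2) C by (metis finite_SigmaI subsetD)
  define bs d where "bs = map fst hs" and "d i = snd (hs ! i)" for i
  have bs: "set bs \<subseteq> verts Q" "set bs \<subseteq> F" using hs F by (auto simp: bs_def)
  have hs_nth: "bs ! i \<in> F" "d i \<in> C (bs ! i)" if "i < length bs" for i
  proof -
    have "hs ! i \<in> Sigma F C" using that hs(1) nth_mem[of i hs] by (simp add: bs_def)
    then show "bs ! i \<in> F" "d i \<in> C (bs ! i)" using that by (auto simp: bs_def d_def)
  qed
  have dK: "d i \<in> K (bs ! i)" if "i < length bs" for i
    using hs_nth[OF that] C F(2) by blast
  then have d: "d i \<in> sp P (bs ! i)" if "i < length bs" for i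
    using that by (auto simp: K_def)
  have fibre: "(\<Sum>i | i < length bs \<and> bs ! i = x. path_scale (t (d i)) (d i)) = (\<Sum>c\<in>C x. path_scale (t c) c)"
    if "x \<in> F" for x t
    using sum_list_fibre[OF hs(2), where x = x and f = "\<lambda>b. path_scale (t b) b"] that hs(1)
    by (simp add: bs_def d_def)
  define f where "f = free_map Q path_scale P bs d"
  have f: "f \<in> Hom Q path_scale path_scale (P_sum Q bs) P"
    unfolding f_def by (rule free_map_Hom[OF ps P bs(1) d])
  have f_im: "f x ` sp (P_sum Q bs) x = K x" if "x \<in> verts Q" for x
    unfolding f_def
  proof (rule free_map_image[where U = K and A = "set as"])
    show "K x \<subseteq> {0}" if "x \<in> verts Q" "x \<notin> succs (set as)" for x
      using P_sum_zero_outside[OF as(1) that, where ?'k = 'k] by (auto simp: K_def P_def)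
  next
    fix x u assume x: "x \<in> verts Q" and u: "u \<in> K x"
    show "\<exists>v t. (\<forall>\<alpha>\<in>in_arcs Q x. v \<alpha> \<in> K (tail Q \<alpha>)) \<and>
      u = (\<Sum>\<alpha>\<in>in_arcs Q x. act P \<alpha> (v \<alpha>)) + (\<Sum>i | i < length bs \<and> bs ! i = x. path_scale (t i) (d i))"
    proof (cases "x \<in> F")
      case True
      \<comment> \<open>\<open>w\<close> has the same coordinates at \<open>C x\<close> as
        \<open>u\<close>, so the difference lies in \<open>R x\<close>.\<close>
      define w where "w = (\<Sum>c\<in>C x. path_scale (l x c u) c)"
      have w: "w \<in> K x"
        unfolding w_def by (rule ps.subspace_sum[OF K_sub[OF x]]) (use C[OF x] ps.subspace_scale[OF K_sub[OF x]] in auto)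
      have "u - w \<in> R x"
      proof (rule lK[OF x])
        show "u - w \<in> K x" using ps.subspace_diff[OF K_sub[OF x] u w] .
        show "l x c (u - w) = 0" if "c \<in> C x" for c
          using linear_on_diff[OF ps vector_space_field K_sub[OF x] l_lin[OF x] u w]
            l_sum[OF x that, of "\<lambda>c. l x c u"] by (simp add: w_def)
      qed
      then obtain v where v: "\<forall>\<alpha>\<in>in_arcs Q x. v \<alpha> \<in> K (tail Q \<alpha>)" "u - w = (\<Sum>\<alpha>\<in>in_arcs Q x. act P \<alpha> (v \<alpha>))"
        by (auto simp: R_def)
      have w_eq: "w = (\<Sum>i | i < length bs \<and> bs ! i = x. path_scale (l x (d i) u) (d i))"
        unfolding w_def fibre[OF True, of "\<lambda>c. l x c u"] ..
      have "u = (u - w) + w" by simp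
      then have "u = (\<Sum>\<alpha>\<in>in_arcs Q x. act P \<alpha> (v \<alpha>)) + w" unfolding v(2) .
      then have "u = (\<Sum>\<alpha>\<in>in_arcs Q x. act P \<alpha> (v \<alpha>)) +
          (\<Sum>i | i < length bs \<and> bs ! i = x. path_scale (l x (d i) u) (d i))"
        by (simp only: w_eq)
      then show ?thesis using v(1) by (intro exI[of _ v] exI[of _ "\<lambda>i. l x (d i) u"]) auto
    next
      case False
      \<comment> \<open>Outside \<open>F\<close> the kernel needs no generators: write
        \<open>u\<close> as a sum over the in-arcs of \<open>P\<close>; the images under
        \<open>g\<close> have sum zero in \<open>L\<close>, so injectivity for \<open>L\<close> puts
        each component of the family into \<open>K\<close>.\<close>
      then have iso: "in_iso Q P x" "in_iso Q L x"
        using P_sum_in_iso[OF as(1) x] as(2) F(3)[OF x] by (auto simp: P_def)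
      have uP: "u \<in> sp P x" "g x u = 0" using u by (auto simp: K_def)
      obtain v where v: "\<And>\<alpha>. \<alpha> \<in> in_arcs Q x \<Longrightarrow> v \<alpha> \<in> sp P (tail Q \<alpha>)" "u = (\<Sum>\<alpha>\<in>in_arcs Q x. act P \<alpha> (v \<alpha>))"
        using in_iso_surj[OF iso(1) uP(1)] by blast
      have "(\<Sum>\<alpha>\<in>in_arcs Q x. act L \<alpha> (g (tail Q \<alpha>) (v \<alpha>))) = 0"
        using Hom_sum_in_arcs(2)[OF ps s P g x v(1)] uP(2) v(2) by simp
      then have "g (tail Q \<alpha>) (v \<alpha>) = 0" if "\<alpha> \<in> in_arcs Q x" for \<alpha>
        using in_iso_inj[OF iso(2), of "\<lambda>\<alpha>. g (tail Q \<alpha>) (v \<alpha>)"] that Hom_in_sp[OF g _ v(1)] by auto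
      then have "\<forall>\<alpha>\<in>in_arcs Q x. v \<alpha> \<in> K (tail Q \<alpha>)" using v(1) by (simp add: K_def)
      then show ?thesis using v(2) by (intro exI[of _ v] exI[of _ "\<lambda>_. 0"]) auto
    qed
  qed (use ps P bs(1) d K_sub K_act dK finite_set that in blast)+
  have f_inj: "inj_on (f x) (sp (P_sum Q bs) x)" if "x \<in> verts Q" for x
    unfolding f_def
  proof (rule free_map_inj[where U = K])
    fix x v t assume x: "x \<in> verts Q" and v: "\<And>\<alpha>. \<alpha> \<in> in_arcs Q x \<Longrightarrow> v \<alpha> \<in> K (tail Q \<alpha>)"
      and 0: "(\<Sum>\<alpha>\<in>in_arcs Q x. act P \<alpha> (v \<alpha>)) + (\<Sum>i | i < length bs \<and> bs ! i = x. path_scale (t i) (d i)) = 0"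
    have ti: "t i = 0" if i: "i < length bs" "bs ! i = x" for i
    proof -
      \<comment> \<open>Coefficients indexed by the vectors of \<open>C x\<close> instead of list
        positions. Since \<open>hs\<close> is distinct, each vector occurs at only one position over
        \<open>x\<close>, so no coefficients are merged.\<close>
      define t' where "t' c = (\<Sum>i | i < length bs \<and> bs ! i = x \<and> d i = c. t i)" for c
      have xF: "x \<in> F" using hs_nth(1)[OF i(1)] i(2) by simp
      have one: "t' (d i) = t i" if "i < length bs" "bs ! i = x" for i
      proof -
        have "{j. j < length bs \<and> bs ! j = x \<and> d j = d i} = {i}"
          using that hs(2) by (auto simp: bs_def d_def nth_eq_iff_index_eq[symmetric] prod_eq_iff)
        then show ?thesis by (simp add: t'_def)
      qed
      have "(\<Sum>i | i < length bs \<and> bs ! i = x. path_scale (t i) (d i)) = (\<Sum>c\<in>C x. path_scale (t' c) c)"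
        using fibre[OF xF, of t'] one by simp
      then have sum0: "(\<Sum>\<alpha>\<in>in_arcs Q x. act P \<alpha> (v \<alpha>)) + (\<Sum>c\<in>C x. path_scale (t' c) c) = 0" using 0 by simp
      \<comment> \<open>The relation places the combination of generators in \<open>R x\<close>,
        where the dual forms vanish, while evaluating these forms returns its coefficients.\<close>
      have R: "(\<Sum>\<alpha>\<in>in_arcs Q x. act P \<alpha> (v \<alpha>)) \<in> R x" using v by (auto simp: R_def)
      then have "- (\<Sum>\<alpha>\<in>in_arcs Q x. act P \<alpha> (v \<alpha>)) \<in> R x" by (rule ps.subspace_neg[OF R_sub[OF x]])
      moreover have "(\<Sum>c\<in>C x. path_scale (t' c) c) = - (\<Sum>\<alpha>\<in>in_arcs Q x. act P \<alpha> (v \<alpha>))"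
        using sum0 by (simp add: eq_neg_iff_add_eq_0 add.commute)
      moreover have di: "d i \<in> C x" using hs_nth(2)[OF i(1)] i(2) by simp
      ultimately have "l x (d i) (\<Sum>c\<in>C x. path_scale (t' c) c) = 0" using lR[OF x] by simp
      then show "t i = 0" using l_sum[OF x di, of t'] one[OF i] by simp
    qed
    then have "(\<Sum>i | i < length bs \<and> bs ! i = x. path_scale (t i) (d i)) = 0"
      by (intro sum.neutral) auto
    then have "(\<Sum>\<alpha>\<in>in_arcs Q x. act P \<alpha> (v \<alpha>)) = 0" using 0 by simp
    then have "v \<alpha> = 0" if "\<alpha> \<in> in_arcs Q x" for \<alpha>
      using P_sum_inj[OF as(1), of x v] v that by (auto simp: P_def K_def)
    then show "(\<forall>\<alpha>\<in>in_arcs Q x. v \<alpha> = 0) \<and> (\<forall>i<length bs. bs ! i = x \<longrightarrow> t i = 0)" using ti by blast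
  qed (use ps P bs(1) d K_sub K_act dK that in blast)+
  have "short_exact Q path_scale path_scale s (P_sum Q bs) f P g L"
    unfolding short_exact_def using f g f_inj f_im g_surj by (simp add: K_def)
  then show ?thesis unfolding rep_plus_def P_def using L as(1) bs(1) by blast
qed

end

section \<open>Finitely co-presented representations\<close>

text \<open>Dual of \<open>in_iso\<close>: bijectivity of the map from the space at \<open>x\<close>
  to the product over the outgoing arrows.\<close>

definition out_iso :: "('v, 'e) pre_digraph \<Rightarrow> ('v, 'e, 'w::ab_group_add) quiver_rep \<Rightarrow> 'v \<Rightarrow> bool" where
  "out_iso Q M x \<longleftrightarrow>
    (\<forall>v. (\<forall>\<alpha>\<in>out_arcs Q x. v \<alpha> \<in> sp M (head Q \<alpha>)) \<longrightarrow> (\<exists>u\<in>sp M x. \<forall>\<alpha>\<in>out_arcs Q x. act M \<alpha> u = v \<alpha>)) \<and>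
    (\<forall>u\<in>sp M x. (\<forall>\<alpha>\<in>out_arcs Q x. act M \<alpha> u = 0) \<longrightarrow> u = 0)"

lemma out_isoI:
  assumes "\<And>v. (\<And>\<alpha>. \<alpha> \<in> out_arcs Q x \<Longrightarrow> v \<alpha> \<in> sp M (head Q \<alpha>)) \<Longrightarrow>
      \<exists>u\<in>sp M x. \<forall>\<alpha>\<in>out_arcs Q x. act M \<alpha> u = v \<alpha>"
    and "\<And>u. u \<in> sp M x \<Longrightarrow> (\<And>\<alpha>. \<alpha> \<in> out_arcs Q x \<Longrightarrow> act M \<alpha> u = 0) \<Longrightarrow> u = 0"
  shows "out_iso Q M x"
  using assms unfolding out_iso_def by blast

lemma out_iso_surj:
  assumes "out_iso Q M x" "\<And>\<alpha>. \<alpha> \<in> out_arcs Q x \<Longrightarrow> v \<alpha> \<in> sp M (head Q \<alpha>)"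
  obtains u where "u \<in> sp M x" "\<And>\<alpha>. \<alpha> \<in> out_arcs Q x \<Longrightarrow> act M \<alpha> u = v \<alpha>"
  using assms unfolding out_iso_def by blast

lemma out_iso_inj:
  assumes "out_iso Q M x" "u \<in> sp M x" "\<And>\<alpha>. \<alpha> \<in> out_arcs Q x \<Longrightarrow> act M \<alpha> u = 0"
  shows "u = 0"
  using assms unfolding out_iso_def by blast

abbreviation I_sum :: "('v, 'e) pre_digraph \<Rightarrow> 'v list \<Rightarrow> ('v, 'e, nat \<Rightarrow> 'e list \<Rightarrow> 'k::field) quiver_rep" where
  "I_sum Q bs \<equiv> direct_sum (map (I_rep Q) bs)"

text \<open>The dual Yoneda correspondence: a morphism into \<open>I_b\<close> is given by a linear
  form on the space at \<open>b\<close>, and its coefficient at a path \<open>p\<close> is the value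
  of the form after \<open>p\<close> has acted.\<close>

definition cofree_map :: "('v, 'e) pre_digraph \<Rightarrow> ('v, 'e, 'w) quiver_rep \<Rightarrow> 'v list \<Rightarrow>
    (nat \<Rightarrow> 'w \<Rightarrow> 'k::field) \<Rightarrow> 'v \<Rightarrow> 'w \<Rightarrow> nat \<Rightarrow> 'e list \<Rightarrow> 'k" where
  "cofree_map Q N bs l x u = (\<lambda>i p. if x \<in> verts Q \<and> u \<in> sp N x \<and> i < length bs \<and> p \<in> paths Q x (bs ! i)
     then l i (fold (act N) p u) else 0)"

context strongly_locally_finite_quiver
begin

lemma sp_I_sum:
  assumes "set bs \<subseteq> verts Q" "x \<in> verts Q"
  shows "w \<in> sp (I_sum Q bs) x \<longleftrightarrow> (\<forall>i p. w i p \<noteq> 0 \<longrightarrow> i < length bs \<and> p \<in> paths Q x (bs ! i))"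
proof -
  have "finite {p. w i p \<noteq> 0}" if "{p. w i p \<noteq> 0} \<subseteq> paths Q x (bs ! i)" for i
    using that finite_paths finite_subset by blast
  then have "w \<in> sp (I_sum Q bs) x \<longleftrightarrow>
      (\<forall>i<length bs. {p. w i p \<noteq> 0} \<subseteq> paths Q x (bs ! i)) \<and> (\<forall>i\<ge>length bs. w i = 0)"
    by (auto simp: direct_sum_simps I_rep_def free_space_def)
  also have "\<dots> \<longleftrightarrow> (\<forall>i p. w i p \<noteq> 0 \<longrightarrow> i < length bs \<and> p \<in> paths Q x (bs ! i))"
    by (auto simp: fun_eq_iff subset_iff not_less[symmetric]; blast)
  finally show ?thesis .
qed

lemma act_I_sum: "act (I_sum Q bs) \<alpha> w i p = (if i < length bs then w i (\<alpha> # p) else 0)"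
  by (auto simp: direct_sum_simps I_rep_def)

lemma I_sum_rep:
  assumes bs: "set bs \<subseteq> verts Q"
  shows "(I_sum Q bs :: ('v, 'e, nat \<Rightarrow> 'e list \<Rightarrow> 'k::field) quiver_rep) \<in> rep Q path_scale"
proof -
  interpret ps: vector_space "path_scale :: 'k \<Rightarrow> (nat \<Rightarrow> 'e list \<Rightarrow> 'k) \<Rightarrow> _"
    by (rule vector_space_path_scale)
  let ?I = "I_sum Q bs :: ('v, 'e, nat \<Rightarrow> 'e list \<Rightarrow> 'k) quiver_rep"
  have sub: "ps.subspace (sp ?I x)" if "x \<in> verts Q" for x
    by (rule ps.subspaceI) (auto simp: sp_I_sum[OF bs that] pointwise_apply, (metis add_0)+)
  show ?thesis
  proof (rule repI)
    fix x assume x: "x \<in> verts Q"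
    show "ps.subspace (sp ?I x)" by (rule sub[OF x])
    show "fin_dim path_scale (sp ?I x)"
    proof (rule finite_dim_functions[OF sub[OF x]])
      show "finite (SIGMA i:{..<length bs}. paths Q x (bs ! i))" using finite_paths by auto
    qed (use sp_I_sum[OF bs x] in auto)
  next
    fix \<alpha> assume a: "\<alpha> \<in> arcs Q"
    show "act ?I \<alpha> w \<in> sp ?I (head Q \<alpha>)" if w: "w \<in> sp ?I (tail Q \<alpha>)" for w
    proof -
      have "p \<in> paths Q (head Q \<alpha>) (bs ! i)" if "w i (\<alpha> # p) \<noteq> 0" for i p
        using w that paths_simps(2) unfolding sp_I_sum[OF bs tail_in_verts[OF a]] by blast
      then show ?thesis unfolding sp_I_sum[OF bs head_in_verts[OF a]] act_I_sum by auto
    qed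
    show "linear_on path_scale path_scale (sp ?I (tail Q \<alpha>)) (act ?I \<alpha>)"
      by (auto simp: linear_on_def fun_eq_iff act_I_sum pointwise_apply)
  qed
qed

text \<open>The coefficients at paths beginning with \<open>\<alpha>\<close> are prescribed by
  \<open>v \<alpha>\<close>, and the unconstrained trivial path gets \<open>0\<close>. This covers
  the vertices in \<open>bs\<close> too, and the property is inherited by quotients.\<close>

lemma I_sum_surj:
  assumes bs: "set bs \<subseteq> verts Q" and x: "x \<in> verts Q"
    and v: "\<And>\<alpha>. \<alpha> \<in> out_arcs Q x \<Longrightarrow> v \<alpha> \<in> sp (I_sum Q bs) (head Q \<alpha>)"
  shows "\<exists>w\<in>sp (I_sum Q bs) x. \<forall>\<alpha>\<in>out_arcs Q x. act (I_sum Q bs) \<alpha> w = v \<alpha>"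
proof
  let ?w = "\<lambda>i p. case p of [] \<Rightarrow> 0 | \<alpha> # p' \<Rightarrow> if \<alpha> \<in> out_arcs Q x then v \<alpha> i p' else 0"
  have vi: "i < length bs \<and> p \<in> paths Q (head Q \<alpha>) (bs ! i)" if "\<alpha> \<in> out_arcs Q x" "v \<alpha> i p \<noteq> 0" for \<alpha> i p
    using v[OF that(1)] that sp_I_sum[OF bs, of "head Q \<alpha>"] by auto
  show "?w \<in> sp (I_sum Q bs) x"
    unfolding sp_I_sum[OF bs x]
    using vi by (auto simp: paths_simps(2) split: list.splits if_splits)
  show "\<forall>\<alpha>\<in>out_arcs Q x. act (I_sum Q bs) \<alpha> ?w = v \<alpha>"
  proof (intro ballI ext)
    fix \<alpha> i p assume "\<alpha> \<in> out_arcs Q x"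
    then show "act (I_sum Q bs) \<alpha> ?w i p = v \<alpha> i p" using vi[of \<alpha> i p] by (auto simp: act_I_sum)
  qed
qed

text \<open>A vector killed by all outgoing arrows is supported on trivial paths, and there are none
  at \<open>x\<close> since \<open>x\<close> is not in \<open>bs\<close>.\<close>

lemma I_sum_out_iso:
  assumes bs: "set bs \<subseteq> verts Q" and x: "x \<in> verts Q" "x \<notin> set bs"
  shows "out_iso Q (I_sum Q bs) x"
proof (rule out_isoI)
  fix w assume w: "w \<in> sp (I_sum Q bs) x"
    and 0: "\<And>\<alpha>. \<alpha> \<in> out_arcs Q x \<Longrightarrow> act (I_sum Q bs) \<alpha> w = 0"
  show "w = 0"
  proof (intro ext, rule ccontr)
    fix i p assume "w i p \<noteq> 0 i p"
    then have nz: "w i p \<noteq> 0" by simp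
    then have i: "i < length bs" "p \<in> paths Q x (bs ! i)" using w sp_I_sum[OF bs x(1)] by auto
    show False
    proof (cases p)
      case Nil
      then have "bs ! i = x" using i paths_simps(1) by simp
      then show ?thesis using x(2) nth_mem[OF i(1)] by simp
    next
      case (Cons \<alpha> p')
      then have "\<alpha> \<in> out_arcs Q x" using i paths_simps(2) by auto
      then show ?thesis using fun_cong[OF fun_cong[OF 0], of \<alpha> i p'] nz i Cons by (simp add: act_I_sum)
    qed
  qed
qed (rule I_sum_surj[OF bs x(1)])

lemma I_sum_zero_outside:
  assumes "set bs \<subseteq> verts Q" "x \<in> verts Q" "x \<notin> preds (set bs)"
  shows "sp (I_sum Q bs :: ('v, 'e, nat \<Rightarrow> 'e list \<Rightarrow> 'k::field) quiver_rep) x \<subseteq> {0}"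
proof
  fix w :: "nat \<Rightarrow> 'e list \<Rightarrow> 'k" assume w: "w \<in> sp (I_sum Q bs) x"
  have "w i p = 0" for i p
  proof (rule ccontr)
    assume "w i p \<noteq> 0"
    then have "i < length bs" "p \<in> paths Q x (bs ! i)" using w sp_I_sum[OF assms(1,2)] by auto
    then have "x \<in> preds (set bs)" unfolding preds_def using nth_mem by blast
    then show False using assms(3) by simp
  qed
  then show "w \<in> {0}" by (auto simp: fun_eq_iff)
qed

section \<open>Morphisms into sums of the injectives \<open>I_b\<close>\<close>

context
  fixes s :: "'k::field \<Rightarrow> 'w::ab_group_add \<Rightarrow> 'w" and N :: "('v, 'e, 'w) quiver_rep"
    and bs :: "'v list" and l :: "nat \<Rightarrow> 'w \<Rightarrow> 'k"
  assumes s: "vector_space s" and N: "N \<in> rep Q s" and bs: "set bs \<subseteq> verts Q"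
    and l: "\<And>i. i < length bs \<Longrightarrow> linear_on s (*) (sp N (bs ! i)) (l i)"
begin

interpretation s: vector_space s by (rule s)

lemma cofree_map_Hom: "cofree_map Q N bs l \<in> Hom Q s path_scale N (I_sum Q bs)"
proof (rule HomI)
  fix x u assume "x \<in> verts Q" "u \<in> sp N x"
  then show "cofree_map Q N bs l x u \<in> sp (I_sum Q bs) x"
    by (auto simp: sp_I_sum[OF bs] cofree_map_def)
next
  fix x assume x: "x \<in> verts Q"
  have "l i (fold (act N) p (u + v)) = l i (fold (act N) p u) + l i (fold (act N) p v)"
    "l i (fold (act N) p (s c u)) = c * l i (fold (act N) p u)"
    if "i < length bs" "p \<in> paths Q x (bs ! i)" "u \<in> sp N x" "v \<in> sp N x" for i p u v c
    using path_act_linear[OF s N that(2)] l[OF that(1)] path_act_in_sp[OF s N that(2)] that(3,4)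
    by (auto simp: linear_on_def)
  then show "linear_on s path_scale (sp N x) (cofree_map Q N bs l x)"
    using x rep_add[OF s N x] rep_scale[OF s N x]
    by (auto simp: linear_on_def cofree_map_def fun_eq_iff pointwise_apply)
next
  fix \<alpha> u assume a: "\<alpha> \<in> arcs Q" and u: "u \<in> sp N (tail Q \<alpha>)"
  show "cofree_map Q N bs l (head Q \<alpha>) (act N \<alpha> u) = act (I_sum Q bs) \<alpha> (cofree_map Q N bs l (tail Q \<alpha>) u)"
    using a u rep_act_in_sp[OF N a u] by (auto simp: fun_eq_iff act_I_sum cofree_map_def paths_simps(2))
qed (auto simp: cofree_map_def fun_eq_iff)

lemma cofree_map_generator:
  "x \<in> verts Q \<Longrightarrow> u \<in> sp N x \<Longrightarrow> cofree_map Q N bs l x u i [] = (if i < length bs \<and> bs ! i = x then l i u else 0)"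
  by (auto simp: cofree_map_def paths_simps(1))

text \<open>Induction against the arrows: outgoing arrows send the kernel into the kernel, hence
  into \<open>U\<close>, and \<open>cogen\<close> concludes. With \<open>U\<close> zero this yields
  injectivity, with \<open>U\<close> the image of the preceding map it yields exactness.\<close>

lemma cofree_map_kernel:
  assumes U: "\<And>x. x \<in> verts Q \<Longrightarrow> 0 \<in> U x" "\<And>x. x \<in> verts Q \<Longrightarrow> U x \<subseteq> sp N x"
    "\<And>\<alpha> u. \<alpha> \<in> arcs Q \<Longrightarrow> u \<in> U (tail Q \<alpha>) \<Longrightarrow> act N \<alpha> u \<in> U (head Q \<alpha>)"
    and lU: "\<And>i u. i < length bs \<Longrightarrow> u \<in> U (bs ! i) \<Longrightarrow> l i u = 0"
    and B: "finite B" "\<And>x. x \<in> verts Q \<Longrightarrow> x \<notin> preds B \<Longrightarrow> sp N x \<subseteq> {0}"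
    and cogen: "\<And>x v. x \<in> verts Q \<Longrightarrow> v \<in> sp N x \<Longrightarrow> (\<And>\<alpha>. \<alpha> \<in> out_arcs Q x \<Longrightarrow> act N \<alpha> v \<in> U (head Q \<alpha>)) \<Longrightarrow>
      (\<And>i. i < length bs \<Longrightarrow> bs ! i = x \<Longrightarrow> l i v = 0) \<Longrightarrow> v \<in> U x"
    and x: "x \<in> verts Q"
  shows "{v \<in> sp N x. cofree_map Q N bs l x v = 0} = U x"
proof
  have "cofree_map Q N bs l x v = 0" if v: "v \<in> U x" for v
    using path_act_closed[OF s N, where U = U, OF U(3) _ v] lU by (auto simp: cofree_map_def fun_eq_iff)
  then show "U x \<subseteq> {v \<in> sp N x. cofree_map Q N bs l x v = 0}" using U(2)[OF x] by blast
  show "{v \<in> sp N x. cofree_map Q N bs l x v = 0} \<subseteq> U x"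
    using B(1) x
  proof (induction x rule: preds_induct)
    case (outside x)
    then show ?case using B(2)[OF outside] U(1)[OF outside(1)] by blast
  next
    case (step x)
    show ?case
    proof
      fix v assume "v \<in> {v \<in> sp N x. cofree_map Q N bs l x v = 0}"
      then have v: "v \<in> sp N x" and 0: "cofree_map Q N bs l x v = 0" by auto
      show "v \<in> U x"
      proof (rule cogen[OF step.hyps v])
        fix \<alpha> assume a: "\<alpha> \<in> out_arcs Q x"
        then have aQ: "\<alpha> \<in> arcs Q" and t: "tail Q \<alpha> = x" by auto
        have "cofree_map Q N bs l (head Q \<alpha>) (act N \<alpha> v) = 0"
          using Hom_act[OF cofree_map_Hom aQ] v 0 rep_act_zero[OF vector_space_path_scale I_sum_rep[OF bs] wf aQ]
          unfolding t by simp
        moreover have "act N \<alpha> v \<in> sp N (head Q \<alpha>)" using rep_act_in_sp[OF N aQ] v t by simp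
        ultimately show "act N \<alpha> v \<in> U (head Q \<alpha>)" using step.IH[OF a] by blast
      next
        fix i assume "i < length bs" "bs ! i = x"
        then show "l i v = 0" using cofree_map_generator[OF step.hyps v, of i] 0 by simp
      qed
    qed
  qed
qed

text \<open>Preimages are built against the arrows. The vector \<open>u\<close> has to match the
  preimages chosen at the heads only modulo \<open>U\<close>, because \<open>U\<close> lies in the
  kernel; thus surjectivity is proved for the map induced on the quotient by \<open>U\<close>
  without forming that quotient.\<close>

lemma cofree_map_surj:
  assumes ker: "\<And>x u. x \<in> verts Q \<Longrightarrow> u \<in> U x \<Longrightarrow> cofree_map Q N bs l x u = 0"
    and lift: "\<And>x v t. x \<in> verts Q \<Longrightarrow> (\<And>\<alpha>. \<alpha> \<in> out_arcs Q x \<Longrightarrow> v \<alpha> \<in> sp N (head Q \<alpha>)) \<Longrightarrow>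
      \<exists>u\<in>sp N x. (\<forall>\<alpha>\<in>out_arcs Q x. act N \<alpha> u - v \<alpha> \<in> U (head Q \<alpha>)) \<and>
        (\<forall>i<length bs. bs ! i = x \<longrightarrow> l i u = t i)"
    and x: "x \<in> verts Q"
  shows "cofree_map Q N bs l x ` sp N x = sp (I_sum Q bs) x"
proof
  show "cofree_map Q N bs l x ` sp N x \<subseteq> sp (I_sum Q bs) x" using Hom_in_sp[OF cofree_map_Hom x] by blast
  show "sp (I_sum Q bs) x \<subseteq> cofree_map Q N bs l x ` sp N x"
    using finite_set[of bs] x
  proof (induction x rule: preds_induct)
    case (outside x)
    have "0 \<in> cofree_map Q N bs l x ` sp N x"
      using imageI[OF rep_zero[OF s N outside(1)], of "cofree_map Q N bs l x"]
      by (simp only: Hom_zero[OF s N vector_space_path_scale cofree_map_Hom])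
    then show ?case using I_sum_zero_outside[OF bs outside] by blast
  next
    case (step x)
    show ?case
    proof
      fix w :: "nat \<Rightarrow> 'e list \<Rightarrow> 'k" assume w: "w \<in> sp (I_sum Q bs) x"
      have "\<forall>\<alpha>\<in>out_arcs Q x. \<exists>v\<in>sp N (head Q \<alpha>). act (I_sum Q bs) \<alpha> w = cofree_map Q N bs l (head Q \<alpha>) v"
      proof
        fix \<alpha> assume a: "\<alpha> \<in> out_arcs Q x"
        then have "act (I_sum Q bs) \<alpha> w \<in> sp (I_sum Q bs) (head Q \<alpha>)"
          using rep_act_in_sp[OF I_sum_rep[OF bs], of \<alpha> w] w by auto
        then show "\<exists>v\<in>sp N (head Q \<alpha>). act (I_sum Q bs) \<alpha> w = cofree_map Q N bs l (head Q \<alpha>) v"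
          using step.IH[OF a] by blast
      qed
      then obtain v where v: "\<And>\<alpha>. \<alpha> \<in> out_arcs Q x \<Longrightarrow> v \<alpha> \<in> sp N (head Q \<alpha>)"
        and vw: "\<And>\<alpha>. \<alpha> \<in> out_arcs Q x \<Longrightarrow> act (I_sum Q bs) \<alpha> w = cofree_map Q N bs l (head Q \<alpha>) (v \<alpha>)"
        by metis
      obtain u where u: "u \<in> sp N x" "\<And>\<alpha>. \<alpha> \<in> out_arcs Q x \<Longrightarrow> act N \<alpha> u - v \<alpha> \<in> U (head Q \<alpha>)"
        "\<And>i. i < length bs \<Longrightarrow> bs ! i = x \<Longrightarrow> l i u = w i []"
        using lift[OF step.hyps v, of "\<lambda>i. w i []"] by blast
      have "cofree_map Q N bs l x u = w"
      proof (intro ext)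
        fix i p
        have wi: "i < length bs \<and> p \<in> paths Q x (bs ! i)" if "w i p \<noteq> 0"
          using w that sp_I_sum[OF bs step.hyps] by blast
        show "cofree_map Q N bs l x u i p = w i p"
        proof (cases p)
          case Nil
          then show ?thesis
            using cofree_map_generator[OF step.hyps u(1), of i] u(3)[of i] wi paths_simps(1) by auto
        next
          case (Cons \<alpha> p')
          show ?thesis
          proof (cases "\<alpha> \<in> out_arcs Q x \<and> i < length bs")
            case True
            then have a: "\<alpha> \<in> out_arcs Q x" "\<alpha> \<in> arcs Q" "tail Q \<alpha> = x" by auto
            have h: "head Q \<alpha> \<in> verts Q" using a by simp
            have au: "act N \<alpha> u \<in> sp N (head Q \<alpha>)" using rep_act_in_sp[OF N a(2)] u(1) a(3) by simp
            have "cofree_map Q N bs l (head Q \<alpha>) (act N \<alpha> u) = cofree_map Q N bs l (head Q \<alpha>) (v \<alpha>)"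
              using Hom_diff[OF s N vector_space_path_scale cofree_map_Hom h au v[OF a(1)]] ker[OF h u(2)[OF a(1)]]
              by simp
            then have "act (I_sum Q bs) \<alpha> (cofree_map Q N bs l x u) = act (I_sum Q bs) \<alpha> w"
              using vw[OF a(1)] Hom_act[OF cofree_map_Hom a(2)] u(1) a(3) by simp
            from fun_cong[OF fun_cong[OF this], of i p'] show ?thesis
              using True Cons by (simp add: act_I_sum)
          next
            case False
            then have "p \<notin> paths Q x (bs ! i) \<or> \<not> i < length bs" using Cons paths_simps(2) by auto
            then show ?thesis using wi by (auto simp: cofree_map_def)
          qed
        qed
      qed
      then show "w \<in> cofree_map Q N bs l x ` sp N x" using u(1) by blast
    qed
  qed
qed

end

section \<open>Characterisation of finitely co-presented representations\<close>

definition eventually_out_iso :: "('v, 'e, 'w::ab_group_add) quiver_rep \<Rightarrow> bool" where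
  "eventually_out_iso N \<longleftrightarrow> (\<exists>B F. finite B \<and> B \<subseteq> verts Q \<and> finite F \<and>
    (\<forall>x\<in>verts Q - preds B. sp N x \<subseteq> {0}) \<and> (\<forall>x\<in>verts Q - F. out_iso Q N x))"

text \<open>Dual chase: injectivity passes from \<open>I\<close> to its subobject \<open>N\<close>.
  A family in \<open>N\<close> is realised by a vector \<open>w\<close> of \<open>I\<close>, and
  injectivity for \<open>J\<close> forces \<open>g x w = 0\<close>, so \<open>w\<close> comes from
  \<open>N\<close>.\<close>

lemma out_iso_kernel:
  assumes r: "vector_space r" and s: "vector_space s" and t: "vector_space t"
    and N: "N \<in> rep Q r" and I: "I \<in> rep Q s" and J: "J \<in> rep Q t"
    and ex: "short_exact Q r s t N f I g J" and x: "x \<in> verts Q"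
    and iso: "out_iso Q I x" "out_iso Q J x"
  shows "out_iso Q N x"
proof -
  have f: "f \<in> Hom Q r s N I" and g: "g \<in> Hom Q s t I J"
    and inj: "\<And>x. x \<in> verts Q \<Longrightarrow> inj_on (f x) (sp N x)"
    and ker: "\<And>x. x \<in> verts Q \<Longrightarrow> f x ` sp N x = {u \<in> sp I x. g x u = 0}"
    using ex by (auto simp: short_exact_def)
  show ?thesis
  proof (rule out_isoI)
    fix v assume v: "\<And>\<alpha>. \<alpha> \<in> out_arcs Q x \<Longrightarrow> v \<alpha> \<in> sp N (head Q \<alpha>)"
    have fv: "f (head Q \<alpha>) (v \<alpha>) \<in> sp I (head Q \<alpha>)" if "\<alpha> \<in> out_arcs Q x" for \<alpha>
      using Hom_in_sp[OF f _ v[OF that]] that by auto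
    obtain w where w: "w \<in> sp I x" "\<And>\<alpha>. \<alpha> \<in> out_arcs Q x \<Longrightarrow> act I \<alpha> w = f (head Q \<alpha>) (v \<alpha>)"
      using out_iso_surj[OF iso(1), of "\<lambda>\<alpha>. f (head Q \<alpha>) (v \<alpha>)"] fv by blast
    have "g x w = 0"
    proof (rule out_iso_inj[OF iso(2) Hom_in_sp[OF g x w(1)]])
      fix \<alpha> assume a: "\<alpha> \<in> out_arcs Q x"
      then have "act J \<alpha> (g x w) = g (head Q \<alpha>) (f (head Q \<alpha>) (v \<alpha>))"
        using Hom_act[OF g, of \<alpha> w] w by auto
      also have "\<dots> = 0" using ker[of "head Q \<alpha>"] v[OF a] a by auto
      finally show "act J \<alpha> (g x w) = 0" .
    qed
    then have "w \<in> f x ` sp N x" using ker[OF x] w(1) by simp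
    then obtain u where u: "u \<in> sp N x" "w = f x u" by blast
    have "act N \<alpha> u = v \<alpha>" if a: "\<alpha> \<in> out_arcs Q x" for \<alpha>
    proof -
      have aQ: "\<alpha> \<in> arcs Q" "tail Q \<alpha> = x" "head Q \<alpha> \<in> verts Q" using a by auto
      have "f (head Q \<alpha>) (act N \<alpha> u) = f (head Q \<alpha>) (v \<alpha>)"
        using Hom_act[OF f aQ(1)] u w(2)[OF a] aQ by simp
      then show ?thesis
        using inj_onD[OF inj[OF aQ(3)]] rep_act_in_sp[OF N aQ(1)] u(1) aQ(2) v[OF a] by simp
    qed
    then show "\<exists>u\<in>sp N x. \<forall>\<alpha>\<in>out_arcs Q x. act N \<alpha> u = v \<alpha>" using u(1) by blast
  next
    fix u assume u: "u \<in> sp N x" and 0: "\<And>\<alpha>. \<alpha> \<in> out_arcs Q x \<Longrightarrow> act N \<alpha> u = 0"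
    have "f x u = 0"
    proof (rule out_iso_inj[OF iso(1) Hom_in_sp[OF f x u]])
      fix \<alpha> assume a: "\<alpha> \<in> out_arcs Q x"
      then have "act I \<alpha> (f x u) = f (head Q \<alpha>) (act N \<alpha> u)" using Hom_act[OF f, of \<alpha> u] u by auto
      then show "act I \<alpha> (f x u) = 0" using 0[OF a] Hom_zero[OF r N s f] by simp
    qed
    then show "u = 0"
      using inj_onD[OF inj[OF x] _ u rep_zero[OF r N x]] Hom_zero[OF r N s f] by simp
  qed
qed

lemma eventually_out_iso_if_rep_minus:
  fixes s :: "'k::field \<Rightarrow> 'w::ab_group_add \<Rightarrow> 'w"
  assumes s: "vector_space s" and "N \<in> rep_minus Q s"
  shows "eventually_out_iso N"
proof -
  obtain as bs f g where as: "set as \<subseteq> verts Q" and bs: "set bs \<subseteq> verts Q" and N: "N \<in> rep Q s"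
    and ex: "short_exact Q s path_scale path_scale N f (I_sum Q as) g (I_sum Q bs)"
    using assms(2) by (auto simp: rep_minus_def)
  note IA = I_sum_rep[OF as, where ?'k = 'k] and IB = I_sum_rep[OF bs, where ?'k = 'k]
  have f: "f \<in> Hom Q s path_scale N (I_sum Q as)" and inj: "\<And>x. x \<in> verts Q \<Longrightarrow> inj_on (f x) (sp N x)"
    using ex by (auto simp: short_exact_def)
  show ?thesis
    unfolding eventually_out_iso_def
  proof (intro exI conjI ballI)
    show "finite (set as)" "set as \<subseteq> verts Q" "finite (set as \<union> set bs)" using as by auto
  next
    fix x assume x: "x \<in> verts Q - preds (set as)"
    show "sp N x \<subseteq> {0}"
    proof
      fix u assume u: "u \<in> sp N x"
      then have "f x u \<in> {0}"
        using I_sum_zero_outside[OF as, of x, where ?'k = 'k] Hom_in_sp[OF f, of x u] x by blast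
      then have "f x u = f x 0" using Hom_zero[OF s N vector_space_path_scale f] by simp
      then show "u \<in> {0}" using inj_onD[OF inj _ u rep_zero[OF s N]] x by auto
    qed
  next
    fix x assume "x \<in> verts Q - (set as \<union> set bs)"
    then show "out_iso Q N x"
      using I_sum_out_iso[OF as, of x] I_sum_out_iso[OF bs, of x]
      by (intro out_iso_kernel[OF s vector_space_path_scale vector_space_path_scale N IA IB ex]) auto
  qed
qed

text \<open>Forms separating the vectors at the exceptional vertices define an embedding
  \<open>f\<close> into a sum \<open>I\<close> of \<open>I_b\<close>. The quotient of
  \<open>I\<close> by the image \<open>U\<close> of \<open>f\<close> inherits surjectivity onto the
  out-arcs, so bases of the duals of the kernels of its out-arc maps identify it with another such
  sum. These kernels are the quotients \<open>Z x / U x\<close>, and their duals are represented by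
  forms on \<open>sp I x\<close> vanishing on \<open>U x\<close>.\<close>

lemma rep_minus_if_eventually_out_iso:
  fixes s :: "'k::field \<Rightarrow> 'w::ab_group_add \<Rightarrow> 'w"
  assumes s: "vector_space s" and N: "N \<in> rep Q s" and "eventually_out_iso N"
  shows "N \<in> rep_minus Q s"
proof -
  interpret s: vector_space s by (rule s)
  interpret ps: vector_space "path_scale :: 'k \<Rightarrow> (nat \<Rightarrow> 'e list \<Rightarrow> 'k) \<Rightarrow> _"
    by (rule vector_space_path_scale)
  note ps = vector_space_path_scale[where ?'k = 'k and ?'e = 'e]
  obtain B F0 where B: "finite B" "\<And>x. x \<in> verts Q \<Longrightarrow> x \<notin> preds B \<Longrightarrow> sp N x \<subseteq> {0}"
    and F0: "finite F0" "\<And>x. x \<in> verts Q \<Longrightarrow> x \<notin> F0 \<Longrightarrow> out_iso Q N x"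
    using assms(3) unfolding eventually_out_iso_def by blast
  define F where "F = F0 \<inter> verts Q"
  have F: "finite F" "F \<subseteq> verts Q" "\<And>x. x \<in> verts Q \<Longrightarrow> x \<notin> F \<Longrightarrow> out_iso Q N x"
    using F0 by (auto simp: F_def)
  \<comment> \<open>Coordinates relative to the zero subspace: the forms \<open>l c\<close> with
    \<open>c\<close> in \<open>C\<close> separate the vectors of \<open>sp N x\<close>.\<close>
  define coord1 where "coord1 x C l \<longleftrightarrow> finite C \<and> (\<forall>c. linear_on s (*) (sp N x) (l c)) \<and>
      (\<forall>z\<in>sp N x. (\<forall>c\<in>C. l c z = 0) \<longrightarrow> z = 0)"
    for x and C :: "'w set" and l :: "'w \<Rightarrow> 'w \<Rightarrow> 'k"
  have "\<exists>C l. coord1 x C l" if x: "x \<in> verts Q" for x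
  proof (rule s.fin_dim_relative_coordinates[OF rep_fin_dim[OF N x] rep_subspace[OF N x] s.subspace_single_0
        rep_subspace[OF N x] _ subset_refl])
    show "{0} \<subseteq> sp N x" using rep_zero[OF s N x] by simp
    fix C and l :: "'w \<Rightarrow> 'w \<Rightarrow> 'k"
    assume "finite C" "\<And>c. linear_on s (*) (sp N x) (l c)"
      "\<And>z. z \<in> sp N x \<Longrightarrow> (\<And>c. c \<in> C \<Longrightarrow> l c z = 0) \<Longrightarrow> z \<in> {0}"
    then have "coord1 x C l" unfolding coord1_def by blast
    then show ?thesis by blast
  qed
  then obtain C1 l1 where coord1: "\<And>x. x \<in> verts Q \<Longrightarrow> coord1 x (C1 x) (l1 x)" by metis
  obtain gs where gs: "set gs = Sigma F C1" "distinct gs"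
    using finite_distinct_list[of "Sigma F C1"] F(1,2) coord1 unfolding coord1_def by (metis finite_SigmaI subsetD)
  define as l where "as = map fst gs" and "l i = l1 (fst (gs ! i)) (snd (gs ! i))" for i
  have as: "set as \<subseteq> verts Q" "set as \<subseteq> F" using gs F by (auto simp: as_def)
  have l: "linear_on s (*) (sp N (as ! i)) (l i)" if "i < length as" for i
  proof -
    have "as ! i \<in> verts Q" using as(1) nth_mem[OF that] by blast
    then show ?thesis using coord1[of "as ! i"] that by (simp add: coord1_def l_def as_def)
  qed
  define f where "f = cofree_map Q N as l"
  define I where "I = (I_sum Q as :: ('v, 'e, nat \<Rightarrow> 'e list \<Rightarrow> 'k) quiver_rep)"
  have I: "I \<in> rep Q path_scale" unfolding I_def by (rule I_sum_rep[OF as(1)])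
  have f: "f \<in> Hom Q s path_scale N I" unfolding f_def I_def by (rule cofree_map_Hom[OF s N as(1) l])
  have f_ker: "{v \<in> sp N x. f x v = 0} = {0}" if x: "x \<in> verts Q" for x
    unfolding f_def
  proof (rule cofree_map_kernel[where U = "\<lambda>_. {0}" and B = B])
    fix x v assume x: "x \<in> verts Q" and v: "v \<in> sp N x"
      and a: "\<And>\<alpha>. \<alpha> \<in> out_arcs Q x \<Longrightarrow> act N \<alpha> v \<in> {0}"
      and lv: "\<And>i. i < length as \<Longrightarrow> as ! i = x \<Longrightarrow> l i v = 0"
    show "v \<in> {0}"
    proof (cases "x \<in> F")
      case True
      have "l1 x c v = 0" if c: "c \<in> C1 x" for c
      proof -
        have "(x, c) \<in> set gs" using True c gs(1) by simp
        then obtain i where "i < length gs" "gs ! i = (x, c)" by (auto simp: in_set_conv_nth)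
        then show ?thesis using lv[of i] by (simp add: as_def l_def)
      qed
      then show ?thesis using coord1[OF x] v unfolding coord1_def by blast
    next
      case False
      then show ?thesis using out_iso_inj[OF F(3)[OF x] v] a by blast
    qed
  next
    fix i u assume "i < length as" "u \<in> {0 :: 'w}"
    moreover from this have "as ! i \<in> verts Q" using as(1) nth_mem[of i as] by blast
    ultimately show "l i u = 0"
      using linear_on_zero[OF s vector_space_field rep_subspace[OF N] l] by simp
  qed (use s N as(1) l B x rep_zero[OF s N] rep_act_zero[OF s N wf] in \<open>auto\<close>)
  have f_inj: "inj_on (f x) (sp N x)" if x: "x \<in> verts Q" for x
  proof (rule inj_onI)
    fix u v assume uv: "u \<in> sp N x" "v \<in> sp N x" "f x u = f x v"
    then have "u - v \<in> {v \<in> sp N x. f x v = 0}"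
      using Hom_diff[OF s N ps f x uv(1,2)] rep_diff[OF s N x] by simp
    then show "u = v" unfolding f_ker[OF x] by simp
  qed
  define U where "U x = f x ` sp N x" for x
  have UI: "U x \<subseteq> sp I x" if "x \<in> verts Q" for x using Hom_in_sp[OF f that] by (auto simp: U_def)
  have U_sub: "ps.subspace (U x)" if "x \<in> verts Q" for x
    unfolding U_def by (rule subspace_linear_image[OF s ps rep_subspace[OF N that] Hom_linear[OF f that]])
  have U_act: "act I \<alpha> u \<in> U (head Q \<alpha>)" if "\<alpha> \<in> arcs Q" "u \<in> U (tail Q \<alpha>)" for \<alpha> u
    using that Hom_act[OF f that(1), symmetric] rep_act_in_sp[OF N that(1)] by (auto simp: U_def)
  \<comment> \<open>\<open>Z x\<close> modulo \<open>U x\<close> is the kernel of the out-arc map at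
    \<open>x\<close> of the quotient of \<open>I\<close> by \<open>U\<close>.\<close>
  define Z where "Z x = {v \<in> sp I x. \<forall>\<alpha>\<in>out_arcs Q x. act I \<alpha> v \<in> U (head Q \<alpha>)}" for x
  have Z_sub: "ps.subspace (Z x)" if x: "x \<in> verts Q" for x
  proof (rule ps.subspaceI)
    show "0 \<in> Z x"
      using rep_zero[OF ps I x] rep_act_zero[OF ps I wf] ps.subspace_0[OF U_sub] by (auto simp: Z_def)
  next
    fix u v assume uv: "u \<in> Z x" "v \<in> Z x"
    have "act I \<alpha> (u + v) \<in> U (head Q \<alpha>)" if a: "\<alpha> \<in> out_arcs Q x" for \<alpha>
      using rep_act_add[OF ps I wf, of \<alpha> u v] ps.subspace_add[OF U_sub[of "head Q \<alpha>"], of "act I \<alpha> u" "act I \<alpha> v"] uv a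
      by (auto simp: Z_def)
    then show "u + v \<in> Z x" using uv rep_add[OF ps I x] by (auto simp: Z_def)
  next
    fix c u assume u: "u \<in> Z x"
    have "act I \<alpha> (path_scale c u) \<in> U (head Q \<alpha>)" if a: "\<alpha> \<in> out_arcs Q x" for \<alpha>
      using rep_act_scale[OF ps I wf, of \<alpha> u c] ps.subspace_scale[OF U_sub[of "head Q \<alpha>"], of "act I \<alpha> u" c] u a
      by (auto simp: Z_def)
    then show "path_scale c u \<in> Z x" using u rep_scale[OF ps I x] by (auto simp: Z_def)
  qed
  define coord where "coord x C l \<longleftrightarrow> finite C \<and> C \<subseteq> Z x \<and> (\<forall>c. linear_on path_scale (*) (sp I x) (l c)) \<and>
      (\<forall>c\<in>C. \<forall>v\<in>U x. l c v = 0) \<and> (\<forall>c\<in>C. \<forall>d\<in>C. l c d = (if c = d then 1 else 0)) \<and>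
      (\<forall>z\<in>Z x. (\<forall>c\<in>C. l c z = 0) \<longrightarrow> z \<in> U x)"
    for x and C :: "(nat \<Rightarrow> 'e list \<Rightarrow> 'k) set" and l :: "_ \<Rightarrow> _ \<Rightarrow> 'k"
  have "\<exists>C l. coord x C l" if x: "x \<in> verts Q" for x
  proof (rule ps.fin_dim_relative_coordinates[OF rep_fin_dim[OF I x] rep_subspace[OF I x] U_sub[OF x] Z_sub[OF x]])
    show "U x \<subseteq> Z x" using UI[OF x] U_act by (auto simp: Z_def)
    show "Z x \<subseteq> sp I x" by (auto simp: Z_def)
    fix C and l :: "_ \<Rightarrow> _ \<Rightarrow> 'k"
    assume "finite C" "C \<subseteq> Z x" "\<And>c. linear_on path_scale (*) (sp I x) (l c)"
      "\<And>c v. c \<in> C \<Longrightarrow> v \<in> U x \<Longrightarrow> l c v = 0"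
      "\<And>c d. c \<in> C \<Longrightarrow> d \<in> C \<Longrightarrow> l c d = (if c = d then 1 else 0)"
      "\<And>z. z \<in> Z x \<Longrightarrow> (\<And>c. c \<in> C \<Longrightarrow> l c z = 0) \<Longrightarrow> z \<in> U x"
    then have "coord x C l" unfolding coord_def by blast
    then show ?thesis by blast
  qed
  then obtain C k where coord: "\<And>x. x \<in> verts Q \<Longrightarrow> coord x (C x) (k x)" by metis
  have C: "finite (C x) \<and> C x \<subseteq> Z x" and k_lin: "linear_on path_scale (*) (sp I x) (k x c)"
    and kU: "c \<in> C x \<Longrightarrow> v \<in> U x \<Longrightarrow> k x c v = 0"
    and kC: "c \<in> C x \<Longrightarrow> d \<in> C x \<Longrightarrow> k x c d = (if c = d then 1 else 0)"
    and kZ: "z \<in> Z x \<Longrightarrow> (\<And>c. c \<in> C x \<Longrightarrow> k x c z = 0) \<Longrightarrow> z \<in> U x"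
    if "x \<in> verts Q" for x c d v z
    using coord[OF that] unfolding coord_def by blast+
  obtain hs where hs: "set hs = Sigma F C" "distinct hs"
    using finite_distinct_list[of "Sigma F C"] F(1,2) C by (metis finite_SigmaI subsetD)
  define bs m where "bs = map fst hs" and "m i = k (fst (hs ! i)) (snd (hs ! i))" for i
  have bs: "set bs \<subseteq> verts Q" "set bs \<subseteq> F" using hs F by (auto simp: bs_def)
  have hs_nth: "bs ! i \<in> F" "snd (hs ! i) \<in> C (bs ! i)" "m i = k (bs ! i) (snd (hs ! i))" if "i < length bs" for i
  proof -
    have "hs ! i \<in> Sigma F C" using that hs(1) nth_mem[of i hs] by (simp add: bs_def)
    then show "bs ! i \<in> F" "snd (hs ! i) \<in> C (bs ! i)" "m i = k (bs ! i) (snd (hs ! i))"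
      using that by (auto simp: bs_def m_def)
  qed
  have m: "linear_on path_scale (*) (sp I (bs ! i)) (m i)" if "i < length bs" for i
    using hs_nth[OF that] k_lin F(2) by auto
  define g where "g = cofree_map Q I bs m"
  have g: "g \<in> Hom Q path_scale path_scale I (I_sum Q bs)"
    unfolding g_def by (rule cofree_map_Hom[OF ps I bs(1) m])
  have g_ker: "{v \<in> sp I x. g x v = 0} = U x" if x: "x \<in> verts Q" for x
    unfolding g_def
  proof (rule cofree_map_kernel[where U = U and B = "set as"])
    fix x v assume x: "x \<in> verts Q" and v: "v \<in> sp I x"
      and a: "\<And>\<alpha>. \<alpha> \<in> out_arcs Q x \<Longrightarrow> act I \<alpha> v \<in> U (head Q \<alpha>)"
      and mv: "\<And>i. i < length bs \<Longrightarrow> bs ! i = x \<Longrightarrow> m i v = 0"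
    show "v \<in> U x"
    proof (cases "x \<in> F")
      case True
      show ?thesis
      proof (rule kZ[OF x])
        show "v \<in> Z x" using v a by (simp add: Z_def)
        fix c assume "c \<in> C x"
        then have "(x, c) \<in> set hs" using True hs(1) by simp
        then obtain i where "i < length hs" "hs ! i = (x, c)" by (auto simp: in_set_conv_nth)
        then show "k x c v = 0" using mv[of i] by (simp add: bs_def m_def)
      qed
    next
      case False
      \<comment> \<open>Outside \<open>F\<close> the spaces \<open>Z x\<close> and
        \<open>U x\<close> coincide: the preimages in \<open>N\<close> of the values of
        \<open>v\<close> along the arrows come from a single \<open>w\<close>, and
        \<open>v - f x w\<close> is killed by all outgoing arrows of \<open>I\<close>.\<close>
      then have iso: "out_iso Q I x" "out_iso Q N x"
        using I_sum_out_iso[OF as(1) x] as(2) F(3)[OF x] by (auto simp: I_def)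
      have "\<forall>\<alpha>\<in>out_arcs Q x. \<exists>u\<in>sp N (head Q \<alpha>). act I \<alpha> v = f (head Q \<alpha>) u"
        using a unfolding U_def by blast
      then obtain u where u: "\<And>\<alpha>. \<alpha> \<in> out_arcs Q x \<Longrightarrow> u \<alpha> \<in> sp N (head Q \<alpha>)"
        "\<And>\<alpha>. \<alpha> \<in> out_arcs Q x \<Longrightarrow> act I \<alpha> v = f (head Q \<alpha>) (u \<alpha>)" by metis
      obtain w where w: "w \<in> sp N x" "\<And>\<alpha>. \<alpha> \<in> out_arcs Q x \<Longrightarrow> act N \<alpha> w = u \<alpha>"
        using out_iso_surj[OF iso(2) u(1)] by blast
      have fw: "f x w \<in> sp I x" by (rule Hom_in_sp[OF f x w(1)])
      have "v - f x w = 0"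
      proof (rule out_iso_inj[OF iso(1) rep_diff[OF ps I x v fw]])
        fix \<alpha> assume al: "\<alpha> \<in> out_arcs Q x"
        then have aQ: "\<alpha> \<in> arcs Q" "tail Q \<alpha> = x" by auto
        have "act I \<alpha> (v - f x w) = act I \<alpha> v - act I \<alpha> (f x w)"
          using rep_act_diff[OF ps I wf aQ(1), of v "f x w"] v fw aQ(2) by simp
        then show "act I \<alpha> (v - f x w) = 0"
          using Hom_act[OF f aQ(1), of w] w u(2)[OF al] w(2)[OF al] aQ(2) by simp
      qed
      then show ?thesis using w(1) by (simp add: U_def)
    qed
  next
    fix i u assume "i < length bs" "u \<in> U (bs ! i)"
    then show "m i u = 0" using hs_nth[of i] kU F(2) by auto
  next
    fix x assume "x \<in> verts Q" "x \<notin> preds (set as)"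
    then show "sp I x \<subseteq> {0}" unfolding I_def by (rule I_sum_zero_outside[OF as(1)])
  next
    fix x assume "x \<in> verts Q"
    then show "0 \<in> U x" by (rule ps.subspace_0[OF U_sub])
  qed (use ps I bs(1) m UI U_act x finite_set in blast)+
  have g_surj: "g x ` sp I x = sp (I_sum Q bs) x" if x: "x \<in> verts Q" for x
    unfolding g_def
  proof (rule cofree_map_surj[where U = U])
    show "cofree_map Q I bs m x u = 0" if "x \<in> verts Q" "u \<in> U x" for x u
      using g_ker[OF that(1)] that(2) by (auto simp: g_def)
  next
    fix x v and t :: "nat \<Rightarrow> 'k"
    assume x: "x \<in> verts Q" and v: "\<And>\<alpha>. \<alpha> \<in> out_arcs Q x \<Longrightarrow> v \<alpha> \<in> sp I (head Q \<alpha>)"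
    obtain w where w: "w \<in> sp I x" "\<And>\<alpha>. \<alpha> \<in> out_arcs Q x \<Longrightarrow> act I \<alpha> w = v \<alpha>"
      using I_sum_surj[OF as(1) x] v unfolding I_def by blast
    \<comment> \<open>Each form \<open>m i\<close> at \<open>x\<close> belongs to exactly one vector
      of \<open>C x\<close>, so the prescribed values \<open>t\<close> can be indexed by these
      vectors.\<close>
    define t' where "t' c = t (inv_into {..<length hs} ((!) hs) (x, c))" for c
    have t': "t' (snd (hs ! i)) = t i" if "i < length bs" "bs ! i = x" for i
    proof -
      have "hs ! i = (x, snd (hs ! i))" using that by (simp add: bs_def prod_eq_iff)
      moreover have "inv_into {..<length hs} ((!) hs) (hs ! i) = i"
        using that hs(2) by (intro inv_into_f_f) (auto simp: bs_def inj_on_nth)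
      ultimately show ?thesis by (simp add: t'_def)
    qed
    \<comment> \<open>A correction inside \<open>Z x\<close>: it gives the forms their prescribed
      values and changes the images along outgoing arrows only by elements of
      \<open>U\<close>.\<close>
    define z where "z = (\<Sum>c\<in>C x. path_scale (t' c - k x c w) c)"
    have cz: "path_scale c d \<in> Z x" if "d \<in> C x" for c d
      using C[OF x] that ps.subspace_scale[OF Z_sub[OF x]] by blast
    have z: "z \<in> Z x" unfolding z_def by (rule ps.subspace_sum[OF Z_sub[OF x] cz])
    then have zI: "z \<in> sp I x" by (simp add: Z_def)
    have kz: "k x c (w + z) = t' c" if c: "c \<in> C x" for c
    proof -
      have "k x c z = (\<Sum>d\<in>C x. k x c (path_scale (t' d - k x d w) d))"
        unfolding z_def
        by (rule linear_on_sum[OF ps vector_space_field rep_subspace[OF I x] k_lin[OF x]])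
          (use cz in \<open>auto simp: Z_def\<close>)
      also have "\<dots> = (\<Sum>d\<in>C x. if d = c then t' c - k x c w else 0)"
        using C[OF x] kC[OF x c] by (intro sum.cong) (auto simp: linear_on_scale[OF k_lin[OF x]] Z_def)
      also have "\<dots> = t' c - k x c w" using C[OF x] c by simp
      finally show ?thesis using linear_on_add[OF k_lin[OF x] w(1) zI] by simp
    qed
    show "\<exists>u\<in>sp I x. (\<forall>\<alpha>\<in>out_arcs Q x. act I \<alpha> u - v \<alpha> \<in> U (head Q \<alpha>)) \<and>
        (\<forall>i<length bs. bs ! i = x \<longrightarrow> m i u = t i)"
    proof (intro bexI[of _ "w + z"] conjI ballI allI impI)
      show "w + z \<in> sp I x" using rep_add[OF ps I x w(1) zI] .
      show "act I \<alpha> (w + z) - v \<alpha> \<in> U (head Q \<alpha>)" if a: "\<alpha> \<in> out_arcs Q x" for \<alpha>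
      proof -
        have "act I \<alpha> (w + z) = act I \<alpha> w + act I \<alpha> z"
          using rep_act_add[OF ps I wf, of \<alpha> w z] w(1) zI a by auto
        then show ?thesis using w(2)[OF a] z a by (simp add: Z_def)
      qed
      show "m i (w + z) = t i" if "i < length bs" "bs ! i = x" for i
        using kz[of "snd (hs ! i)"] hs_nth[OF that(1)] t'[OF that] that(2) by simp
    qed
  qed (use ps I bs(1) m x in blast)+
  have "short_exact Q s path_scale path_scale N f I g (I_sum Q bs)"
    unfolding short_exact_def using f g f_inj g_ker g_surj by (simp add: U_def)
  then show ?thesis unfolding rep_minus_def I_def using N as(1) bs(1) by blast
qed

end

section \<open>Finite extensions\<close>

text \<open>Arrows with an endpoint outside \<open>S\<close> act as zero, so every \<open>S\<close>
  gives a representation. If \<open>S\<close> is closed under successors, the result is a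
  subrepresentation of \<open>M\<close>, and the restriction to the complement is the corresponding
  quotient, realised in the same ambient space.\<close>

definition restrict_rep :: "('v, 'e) pre_digraph \<Rightarrow> ('v, 'e, 'w::zero) quiver_rep \<Rightarrow> 'v set \<Rightarrow> ('v, 'e, 'w) quiver_rep" where
  "restrict_rep Q M S = \<lparr>
     sp = (\<lambda>x. if x \<in> S then sp M x else {0}),
     act = (\<lambda>\<alpha> u. if tail Q \<alpha> \<in> S \<and> head Q \<alpha> \<in> S then act M \<alpha> u else 0)\<rparr>"

lemma restrict_rep_simps:
  "sp (restrict_rep Q M S) x = (if x \<in> S then sp M x else {0})"
  "act (restrict_rep Q M S) \<alpha> u = (if tail Q \<alpha> \<in> S \<and> head Q \<alpha> \<in> S then act M \<alpha> u else 0)"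
  by (simp_all add: restrict_rep_def)

lemma supports_direct_sum_pair:
  assumes s: "vector_space s" and Q: "wf_digraph Q" and L: "L \<in> rep Q s" and N: "N \<in> rep Q s"
  shows "supports Q \<alpha> (direct_sum [L, N]) \<longleftrightarrow> supports Q \<alpha> L \<or> supports Q \<alpha> N"
proof -
  interpret wf_digraph Q by (rule Q)
  show ?thesis
  proof
    assume "supports Q \<alpha> (direct_sum [L, N])"
    then obtain u where a: "\<alpha> \<in> arcs Q" and u: "u \<in> sp (direct_sum [L, N]) (tail Q \<alpha>)"
      and ne: "act (direct_sum [L, N]) \<alpha> u \<noteq> 0" by (auto simp: supports_def)
    obtain i where i: "act (direct_sum [L, N]) \<alpha> u i \<noteq> 0" using ne by (auto simp: fun_eq_iff)
    then have "i = 0 \<or> i = 1" by (auto simp: direct_sum_simps split: if_splits)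
    moreover have "u 0 \<in> sp L (tail Q \<alpha>)" "u 1 \<in> sp N (tail Q \<alpha>)"
      using u by (force simp: direct_sum_simps)+
    ultimately show "supports Q \<alpha> L \<or> supports Q \<alpha> N"
      using a i by (auto simp: supports_def direct_sum_simps)
  next
    assume LN: "supports Q \<alpha> L \<or> supports Q \<alpha> N"
    then have a: "\<alpha> \<in> arcs Q" by (auto simp: supports_def)
    have z: "0 \<in> sp L (tail Q \<alpha>)" "0 \<in> sp N (tail Q \<alpha>)"
      using rep_zero[OF s L] rep_zero[OF s N] a by auto
    from LN obtain j u where j: "j < (2::nat)" "u \<in> sp ([L, N] ! j) (tail Q \<alpha>)" "act ([L, N] ! j) \<alpha> u \<noteq> 0"
      unfolding supports_def by (metis One_nat_def nth_Cons_0 nth_Cons_Suc one_less_numeral_iff semiring_norm(76) zero_less_numeral)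
    define w where "w i = (if i = j then u else 0)" for i :: nat
    have "w \<in> sp (direct_sum [L, N]) (tail Q \<alpha>)"
      using j z by (auto simp: direct_sum_simps w_def less_2_cases_iff less_Suc_eq)
    moreover have "act (direct_sum [L, N]) \<alpha> w j \<noteq> 0" using j by (simp add: direct_sum_simps w_def)
    then have "act (direct_sum [L, N]) \<alpha> w \<noteq> 0" by auto
    ultimately show "supports Q \<alpha> (direct_sum [L, N])" using a by (auto simp: supports_def)
  qed
qed

context strongly_locally_finite_quiver
begin

text \<open>Only \<open>A\<close> is chosen; subobject and quotient are determined by
  \<open>M\<close> and \<open>A\<close>. This makes the conditions functorial in
  \<open>M\<close>.\<close>

definition bar_shape :: "'v set \<Rightarrow> ('v, 'e, 'w::ab_group_add) quiver_rep \<Rightarrow> bool" where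
  "bar_shape A M \<longleftrightarrow> finite A \<and> A \<subseteq> verts Q \<and>
    eventually_in_iso (restrict_rep Q M (succs A)) \<and> eventually_out_iso (restrict_rep Q M (- succs A)) \<and>
    finite {\<alpha>. supports Q \<alpha> M \<and> tail Q \<alpha> \<notin> succs A \<and> head Q \<alpha> \<in> succs A}"

lemma restrict_rep_rep:
  assumes s: "vector_space s" and M: "M \<in> rep Q s"
  shows "restrict_rep Q M S \<in> rep Q s"
proof -
  interpret s: vector_space s by (rule s)
  show ?thesis
  proof (rule repI)
    fix \<alpha> assume a: "\<alpha> \<in> arcs Q"
    show "act (restrict_rep Q M S) \<alpha> u \<in> sp (restrict_rep Q M S) (head Q \<alpha>)"
      if "u \<in> sp (restrict_rep Q M S) (tail Q \<alpha>)" for u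
      using that a rep_act_in_sp[OF M a] rep_zero[OF s M] by (auto simp: restrict_rep_simps split: if_splits)
    show "linear_on s s (sp (restrict_rep Q M S) (tail Q \<alpha>)) (act (restrict_rep Q M S) \<alpha>)"
      using a rep_act_linear[OF M a] by (auto simp: restrict_rep_simps linear_on_def)
  qed (use rep_subspace[OF M] rep_fin_dim[OF M] s.fin_dim_zero in \<open>auto simp: restrict_rep_simps\<close>)
qed

text \<open>As \<open>succs A\<close> is closed under successors, the two restrictions of
  \<open>M\<close> form a short exact sequence with \<open>M\<close>. An arrow supporting
  \<open>M\<close> but neither restriction enters \<open>succs A\<close> from outside.\<close>

lemma rep_bar_if_bar_shape:
  assumes s: "vector_space s" and M: "M \<in> rep Q s" and A: "bar_shape A M"
  shows "M \<in> rep_bar Q s"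
proof -
  interpret s: vector_space s by (rule s)
  define S where "S = succs A"
  let ?L = "restrict_rep Q M S" and ?N = "restrict_rep Q M (- S)"
  note L = restrict_rep_rep[OF s M, of S] and N = restrict_rep_rep[OF s M, of "- S"]
  have head_S: "head Q \<alpha> \<in> S" if "\<alpha> \<in> arcs Q" "tail Q \<alpha> \<in> S" for \<alpha>
    using that head_in_succs by (simp add: S_def)
  define g where "g = (\<lambda>x u. if x \<in> verts Q \<and> x \<notin> S \<and> u \<in> sp M x then u else 0)"
  have f: "id_mor Q ?L \<in> Hom Q s s ?L M"
  proof (rule id_mor_Hom[OF s L _ _ wf])
    fix \<alpha> u assume "\<alpha> \<in> arcs Q" "u \<in> sp ?L (tail Q \<alpha>)"
    then show "act M \<alpha> u = act ?L \<alpha> u"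
      using head_S rep_act_zero[OF s M wf] by (auto simp: restrict_rep_simps split: if_splits)
  qed (use rep_zero[OF s M] in \<open>auto simp: restrict_rep_simps\<close>)
  have g: "g \<in> Hom Q s s M ?N"
  proof (rule HomI)
    fix \<alpha> u assume "\<alpha> \<in> arcs Q" "u \<in> sp M (tail Q \<alpha>)"
    then show "g (head Q \<alpha>) (act M \<alpha> u) = act ?N \<alpha> (g (tail Q \<alpha>) u)"
      using head_S rep_act_in_sp[OF M] by (auto simp: restrict_rep_simps g_def)
  qed (use rep_add[OF s M] rep_scale[OF s M] in \<open>auto simp: restrict_rep_simps g_def linear_on_def\<close>)
  have ex: "short_exact Q s s s ?L (id_mor Q ?L) M g ?N"
    unfolding short_exact_def
  proof (intro conjI ballI f g)
    fix x assume x: "x \<in> verts Q"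
    note z = rep_zero[OF s M x]
    show "inj_on (id_mor Q ?L x) (sp ?L x)" using x by (auto simp: inj_on_def id_mor_def)
    have "id_mor Q ?L x ` sp ?L x = sp ?L x" using x by (force simp: id_mor_def)
    also have "\<dots> = {u \<in> sp M x. g x u = 0}" using x z by (auto simp: restrict_rep_simps g_def)
    finally show "id_mor Q ?L x ` sp ?L x = {u \<in> sp M x. g x u = 0}" .
    show "g x ` sp M x = sp ?N x" using x z by (force simp: restrict_rep_simps g_def)
  qed
  have "{\<alpha>. supports Q \<alpha> M \<and> \<not> supports Q \<alpha> (direct_sum [?L, ?N])} \<subseteq>
      {\<alpha>. supports Q \<alpha> M \<and> tail Q \<alpha> \<notin> S \<and> head Q \<alpha> \<in> S}"
    unfolding supports_direct_sum_pair[OF s wf L N]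
    using head_S by (auto simp: supports_def restrict_rep_simps)
  then have "finite_extension Q s ?L (id_mor Q ?L) M g ?N"
    unfolding finite_extension_def using L N M ex A finite_subset by (auto simp: bar_shape_def S_def)
  moreover have "?L \<in> rep_plus Q s" "?N \<in> rep_minus Q s"
    using rep_plus_if_eventually_in_iso[OF s L] rep_minus_if_eventually_out_iso[OF s N] A
    by (auto simp: bar_shape_def S_def)
  ultimately show ?thesis using M unfolding rep_bar_def by blast
qed

text \<open>\<open>L\<close> lives on \<open>S = succs A\<close> and \<open>N\<close> on
  \<open>preds B\<close>. Outside \<open>S\<close> the map \<open>g\<close> identifies
  \<open>M\<close> with \<open>N\<close>; inside \<open>S\<close> the map \<open>f\<close>
  identifies \<open>L\<close> with \<open>M\<close>, except on the finite set \<open>F0\<close>. The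
  bijectivity conditions therefore carry over at vertices away from \<open>F0\<close> and its
  neighbours.\<close>

lemma bar_shape_if_rep_bar:
  assumes s: "vector_space s" and "M \<in> rep_bar Q s"
  obtains A where "bar_shape A M"
proof -
  interpret s: vector_space s by (rule s)
  obtain L N f g where M: "M \<in> rep Q s" and LP: "L \<in> rep_plus Q s" and NM: "N \<in> rep_minus Q s"
    and ext: "finite_extension Q s L f M g N"
    using assms(2) by (auto simp: rep_bar_def)
  have L: "L \<in> rep Q s" and N: "N \<in> rep Q s" and ex: "short_exact Q s s s L f M g N"
    and fin: "finite {\<alpha>. supports Q \<alpha> M \<and> \<not> supports Q \<alpha> (direct_sum [L, N])}"
    using ext by (auto simp: finite_extension_def)
  have f: "f \<in> Hom Q s s L M" and g: "g \<in> Hom Q s s M N"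
    and f_inj: "\<And>x. x \<in> verts Q \<Longrightarrow> inj_on (f x) (sp L x)"
    and ker: "\<And>x. x \<in> verts Q \<Longrightarrow> f x ` sp L x = {u \<in> sp M x. g x u = 0}"
    and g_surj: "\<And>x. x \<in> verts Q \<Longrightarrow> g x ` sp M x = sp N x"
    using ex by (auto simp: short_exact_def)
  have f0: "f x 0 = 0" and g0: "g x 0 = 0" for x using Hom_zero[OF s L s f] Hom_zero[OF s M s g] by auto
  obtain A F1 where A: "finite A" "A \<subseteq> verts Q" "finite F1"
    and L0: "\<And>x. x \<in> verts Q \<Longrightarrow> x \<notin> succs A \<Longrightarrow> sp L x \<subseteq> {0}"
    and L_iso: "\<And>x. x \<in> verts Q \<Longrightarrow> x \<notin> F1 \<Longrightarrow> in_iso Q L x"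
    using eventually_in_iso_if_rep_plus[OF s LP] unfolding eventually_in_iso_def by blast
  obtain B F2 where B: "finite B" "B \<subseteq> verts Q" "finite F2"
    and N0: "\<And>x. x \<in> verts Q \<Longrightarrow> x \<notin> preds B \<Longrightarrow> sp N x \<subseteq> {0}"
    and N_iso: "\<And>x. x \<in> verts Q \<Longrightarrow> x \<notin> F2 \<Longrightarrow> out_iso Q N x"
    using eventually_out_iso_if_rep_minus[OF s NM] unfolding eventually_out_iso_def by blast
  define S where "S = succs A"
  define F0 where "F0 = S \<inter> preds B"
  \<comment> \<open>\<open>G\<close> adds to \<open>F0\<close> the neighbours of its vertices: at a
    vertex outside \<open>G\<close> neither it nor the other end of any arrow attached to it lies in
    \<open>F0\<close>.\<close>
  define G where "G = F0 \<union> (\<Union>x\<in>F0. head Q ` out_arcs Q x) \<union> (\<Union>x\<in>F0. tail Q ` in_arcs Q x)"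
  have F0: "finite F0" using finite_succs_Int_preds A(1) B(1) by (simp add: F0_def S_def)
  then have G: "finite G" using finite_in_arcs finite_out_arcs by (simp add: G_def)
  have head_S: "head Q \<alpha> \<in> S" if "\<alpha> \<in> arcs Q" "tail Q \<alpha> \<in> S" for \<alpha>
    using that head_in_succs by (simp add: S_def)
  have L_zero: "u = 0" if "x \<in> verts Q" "x \<notin> S" "u \<in> sp L x" for x u using L0 that by (auto simp: S_def)
  have N_zero: "u = 0" if "x \<in> verts Q" "x \<in> S" "x \<notin> F0" "u \<in> sp N x" for x u
    using N0[OF that(1)] that by (auto simp: F0_def)
  have f_surj: "\<exists>w\<in>sp L x. u = f x w" if "x \<in> verts Q" "x \<in> S" "x \<notin> F0" "u \<in> sp M x" for x u
  proof -
    have "g x u = 0" using N_zero that(1-3) Hom_in_sp[OF g that(1,4)] by blast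
    then show ?thesis using ker[OF that(1)] that(4) by blast
  qed
  have g_inj: "u = 0" if "x \<in> verts Q" "x \<notin> S" "u \<in> sp M x" "g x u = 0" for x u
  proof -
    have "u \<in> f x ` sp L x" using ker[OF that(1)] that(3,4) by blast
    then show ?thesis using L_zero[OF that(1,2)] f0 by auto
  qed
  let ?R = "restrict_rep Q M S" and ?T = "restrict_rep Q M (- S)"
  have R_iso: "in_iso Q ?R x" if x: "x \<in> verts Q" "x \<notin> F1 \<union> G" for x
  proof (cases "x \<in> S")
    case False
    \<comment> \<open>Arrows starting in \<open>S\<close> end in \<open>S\<close>. So for
      \<open>x\<close> outside \<open>S\<close> the restriction is zero at \<open>x\<close> and at
      all tails, and the condition is trivial.\<close>
    then have out: "tail Q \<alpha> \<notin> S" if "\<alpha> \<in> in_arcs Q x" for \<alpha> using head_S[of \<alpha>] that by auto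
    show ?thesis
    proof (rule in_isoI)
      fix u assume "u \<in> sp ?R x"
      then show "\<exists>v. (\<forall>\<alpha>\<in>in_arcs Q x. v \<alpha> \<in> sp ?R (tail Q \<alpha>)) \<and> u = (\<Sum>\<alpha>\<in>in_arcs Q x. act ?R \<alpha> (v \<alpha>))"
        using False out by (intro exI[of _ "\<lambda>_. 0"]) (auto simp: restrict_rep_simps)
    next
      fix v \<alpha> assume v: "\<And>\<alpha>. \<alpha> \<in> in_arcs Q x \<Longrightarrow> v \<alpha> \<in> sp ?R (tail Q \<alpha>)" and "\<alpha> \<in> in_arcs Q x"
      then show "v \<alpha> = 0" using v[of \<alpha>] out[of \<alpha>] by (simp add: restrict_rep_simps)
    qed
  next
    case True
    have tailF0: "tail Q \<alpha> \<notin> F0" "tail Q \<alpha> \<in> verts Q" "\<alpha> \<in> arcs Q" "head Q \<alpha> = x" if "\<alpha> \<in> in_arcs Q x" for \<alpha>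
      using that x by (auto simp: G_def)
    have xF0: "x \<notin> F0" using x by (auto simp: G_def)
    have actR: "act ?R \<alpha> v = act M \<alpha> v" if "\<alpha> \<in> in_arcs Q x" "v \<in> sp ?R (tail Q \<alpha>)" for \<alpha> v
      using that True tailF0[OF that(1)] rep_act_zero[OF s M wf] by (auto simp: restrict_rep_simps split: if_splits)
    have fR: "f (tail Q \<alpha>) v \<in> sp ?R (tail Q \<alpha>)" if "\<alpha> \<in> in_arcs Q x" "v \<in> sp L (tail Q \<alpha>)" for \<alpha> v
      using Hom_in_sp[OF f tailF0(2)[OF that(1)] that(2)] L_zero[OF tailF0(2)[OF that(1)] _ that(2)] f0
      by (auto simp: restrict_rep_simps)
    show ?thesis
    proof (rule in_isoI)
      fix u assume "u \<in> sp ?R x"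
      then have "u \<in> sp M x" using True by (simp add: restrict_rep_simps)
      then obtain w where w: "w \<in> sp L x" "u = f x w" using f_surj[OF x(1) True xF0] by blast
      obtain v where v: "\<And>\<alpha>. \<alpha> \<in> in_arcs Q x \<Longrightarrow> v \<alpha> \<in> sp L (tail Q \<alpha>)"
        and wv: "w = (\<Sum>\<alpha>\<in>in_arcs Q x. act L \<alpha> (v \<alpha>))"
        using in_iso_surj[OF L_iso w(1)] x by blast
      have "u = (\<Sum>\<alpha>\<in>in_arcs Q x. act M \<alpha> (f (tail Q \<alpha>) (v \<alpha>)))"
        using Hom_sum_in_arcs(2)[OF s s L f x(1) v] w(2) wv by simp
      also have "\<dots> = (\<Sum>\<alpha>\<in>in_arcs Q x. act ?R \<alpha> (f (tail Q \<alpha>) (v \<alpha>)))"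
        using actR fR v by (intro sum.cong) auto
      finally show "\<exists>v. (\<forall>\<alpha>\<in>in_arcs Q x. v \<alpha> \<in> sp ?R (tail Q \<alpha>)) \<and> u = (\<Sum>\<alpha>\<in>in_arcs Q x. act ?R \<alpha> (v \<alpha>))"
        using fR v by (intro exI[of _ "\<lambda>\<alpha>. f (tail Q \<alpha>) (v \<alpha>)"]) blast
    next
      fix v \<alpha> assume v: "\<And>\<alpha>. \<alpha> \<in> in_arcs Q x \<Longrightarrow> v \<alpha> \<in> sp ?R (tail Q \<alpha>)"
        and 0: "(\<Sum>\<alpha>\<in>in_arcs Q x. act ?R \<alpha> (v \<alpha>)) = 0" and a: "\<alpha> \<in> in_arcs Q x"
      have "\<forall>\<alpha>\<in>in_arcs Q x. \<exists>w\<in>sp L (tail Q \<alpha>). v \<alpha> = f (tail Q \<alpha>) w"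
      proof
        fix \<alpha> assume a: "\<alpha> \<in> in_arcs Q x"
        show "\<exists>w\<in>sp L (tail Q \<alpha>). v \<alpha> = f (tail Q \<alpha>) w"
        proof (cases "tail Q \<alpha> \<in> S")
          case True
          then show ?thesis using f_surj tailF0[OF a] v[OF a] by (simp add: restrict_rep_simps)
        next
          case False
          then have "v \<alpha> = 0" using v[OF a] by (simp add: restrict_rep_simps)
          then show ?thesis using f0 rep_zero[OF s L tailF0(2)[OF a]] by metis
        qed
      qed
      then obtain w where w: "\<And>\<alpha>. \<alpha> \<in> in_arcs Q x \<Longrightarrow> w \<alpha> \<in> sp L (tail Q \<alpha>)"
        and vw: "\<And>\<alpha>. \<alpha> \<in> in_arcs Q x \<Longrightarrow> v \<alpha> = f (tail Q \<alpha>) (w \<alpha>)" by metis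
      have "f x (\<Sum>\<alpha>\<in>in_arcs Q x. act L \<alpha> (w \<alpha>)) = (\<Sum>\<alpha>\<in>in_arcs Q x. act M \<alpha> (v \<alpha>))"
        using Hom_sum_in_arcs(2)[OF s s L f x(1) w] vw by simp
      also have "\<dots> = (\<Sum>\<alpha>\<in>in_arcs Q x. act ?R \<alpha> (v \<alpha>))"
        using actR[OF _ v] by (intro sum.cong) auto
      finally have "f x (\<Sum>\<alpha>\<in>in_arcs Q x. act L \<alpha> (w \<alpha>)) = f x 0" using 0 f0 by simp
      then have "(\<Sum>\<alpha>\<in>in_arcs Q x. act L \<alpha> (w \<alpha>)) = 0"
        using inj_onD[OF f_inj[OF x(1)]] Hom_sum_in_arcs(1)[OF s s L f x(1) w] rep_zero[OF s L x(1)] by blast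
      then have "w \<alpha> = 0" using in_iso_inj[OF L_iso[OF x(1)] w _ a] x(2) by simp
      then show "v \<alpha> = 0" using vw[OF a] f0 by simp
    qed
  qed
  have T_iso: "out_iso Q ?T x" if x: "x \<in> verts Q" "x \<notin> F2 \<union> G" for x
  proof (cases "x \<in> S")
    case True
    then have inn: "head Q \<alpha> \<in> S" if "\<alpha> \<in> out_arcs Q x" for \<alpha> using head_S[of \<alpha>] that by auto
    show ?thesis
    proof (rule out_isoI)
      fix v assume v: "\<And>\<alpha>. \<alpha> \<in> out_arcs Q x \<Longrightarrow> v \<alpha> \<in> sp ?T (head Q \<alpha>)"
      show "\<exists>u\<in>sp ?T x. \<forall>\<alpha>\<in>out_arcs Q x. act ?T \<alpha> u = v \<alpha>"
        using v inn True by (intro bexI[of _ 0]) (auto simp: restrict_rep_simps)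
    qed (use True in \<open>simp add: restrict_rep_simps\<close>)
  next
    case False
    have h: "head Q \<alpha> \<notin> F0" "head Q \<alpha> \<in> verts Q" "\<alpha> \<in> arcs Q" "tail Q \<alpha> = x" if "\<alpha> \<in> out_arcs Q x" for \<alpha>
      using that x by (auto simp: G_def)
    show ?thesis
    proof (rule out_isoI)
      fix v assume v: "\<And>\<alpha>. \<alpha> \<in> out_arcs Q x \<Longrightarrow> v \<alpha> \<in> sp ?T (head Q \<alpha>)"
      have vM: "v \<alpha> \<in> sp M (head Q \<alpha>)" if "\<alpha> \<in> out_arcs Q x" for \<alpha>
        using v[OF that] rep_zero[OF s M h(2)[OF that]] by (auto simp: restrict_rep_simps split: if_splits)
      obtain w where w: "w \<in> sp N x" "\<And>\<alpha>. \<alpha> \<in> out_arcs Q x \<Longrightarrow> act N \<alpha> w = g (head Q \<alpha>) (v \<alpha>)"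
        using out_iso_surj[OF N_iso[OF x(1)], of "\<lambda>\<alpha>. g (head Q \<alpha>) (v \<alpha>)"] x(2) Hom_in_sp[OF g h(2) vM] by blast
      obtain u where u: "u \<in> sp M x" "w = g x u" using w(1) g_surj[OF x(1)] by blast
      have "act ?T \<alpha> u = v \<alpha>" if a: "\<alpha> \<in> out_arcs Q x" for \<alpha>
      proof (cases "head Q \<alpha> \<in> S")
        case True
        then show ?thesis using v[OF a] by (simp add: restrict_rep_simps)
      next
        case hS: False
        have au: "act M \<alpha> u \<in> sp M (head Q \<alpha>)" using rep_act_in_sp[OF M h(3)[OF a]] u(1) h(4)[OF a] by simp
        have "g (head Q \<alpha>) (act M \<alpha> u - v \<alpha>) = 0"
          using Hom_diff[OF s M s g h(2)[OF a] au vM[OF a]] Hom_act[OF g h(3)[OF a], of u] u w(2)[OF a] h(4)[OF a]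
          by simp
        then have "act M \<alpha> u - v \<alpha> = 0"
          using g_inj[OF h(2)[OF a] hS rep_diff[OF s M h(2)[OF a] au vM[OF a]]] by simp
        then show ?thesis using False hS h(4)[OF a] by (simp add: restrict_rep_simps)
      qed
      then show "\<exists>u\<in>sp ?T x. \<forall>\<alpha>\<in>out_arcs Q x. act ?T \<alpha> u = v \<alpha>"
        using u(1) False by (intro bexI[of _ u]) (auto simp: restrict_rep_simps)
    next
      fix u assume "u \<in> sp ?T x" and 0: "\<And>\<alpha>. \<alpha> \<in> out_arcs Q x \<Longrightarrow> act ?T \<alpha> u = 0"
      then have u: "u \<in> sp M x" using False by (simp add: restrict_rep_simps)
      have gu: "g x u \<in> sp N x" by (rule Hom_in_sp[OF g x(1) u])
      have "g x u = 0"
      proof (rule out_iso_inj[OF N_iso[OF x(1)] gu])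
        show "x \<notin> F2" using x by simp
        fix \<alpha> assume a: "\<alpha> \<in> out_arcs Q x"
        show "act N \<alpha> (g x u) = 0"
        proof (cases "head Q \<alpha> \<in> S")
          case True
          then show ?thesis
            using N_zero[OF h(2)[OF a] True h(1)[OF a]] rep_act_in_sp[OF N h(3)[OF a]] gu h(4)[OF a] by simp
        next
          case hS: False
          then have "act M \<alpha> u = 0" using 0[OF a] False h(4)[OF a] by (simp add: restrict_rep_simps)
          then show ?thesis using Hom_act[OF g h(3)[OF a], of u] u h(4)[OF a] g0 by simp
        qed
      qed
      then show "u = 0" using g_inj[OF x(1) False u] by simp
    qed
  qed
  \<comment> \<open>An arrow crossing into \<open>S\<close> cannot support \<open>L\<close>, which
    is zero at its tail, and supports \<open>N\<close> only if its head lies in \<open>F0\<close>.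
    All others are among the finitely many exceptions that a finite extension permits.\<close>
  have "{\<alpha>. supports Q \<alpha> M \<and> tail Q \<alpha> \<notin> S \<and> head Q \<alpha> \<in> S} \<subseteq>
      {\<alpha>. supports Q \<alpha> M \<and> \<not> supports Q \<alpha> (direct_sum [L, N])} \<union> (\<Union>x\<in>F0. in_arcs Q x)"
  proof
    fix \<alpha> assume "\<alpha> \<in> {\<alpha>. supports Q \<alpha> M \<and> tail Q \<alpha> \<notin> S \<and> head Q \<alpha> \<in> S}"
    then have a: "supports Q \<alpha> M" "tail Q \<alpha> \<notin> S" "head Q \<alpha> \<in> S" "\<alpha> \<in> arcs Q" by (auto simp: supports_def)
    have "\<not> supports Q \<alpha> L"
      using L_zero[OF tail_in_verts[OF a(4)] a(2)] rep_act_zero[OF s L wf a(4)] by (auto simp: supports_def)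
    moreover have "head Q \<alpha> \<in> F0" if "supports Q \<alpha> N"
      using N_zero[OF head_in_verts[OF a(4)] a(3)] rep_act_in_sp[OF N a(4)] that unfolding supports_def by blast
    ultimately show "\<alpha> \<in> {\<alpha>. supports Q \<alpha> M \<and> \<not> supports Q \<alpha> (direct_sum [L, N])} \<union> (\<Union>x\<in>F0. in_arcs Q x)"
      using a(1,4) unfolding supports_direct_sum_pair[OF s wf L N] by auto
  qed
  then have crossing: "finite {\<alpha>. supports Q \<alpha> M \<and> tail Q \<alpha> \<notin> S \<and> head Q \<alpha> \<in> S}"
    by (rule finite_subset) (use fin F0 finite_in_arcs in auto)
  have T0: "sp ?T x \<subseteq> {0}" if x: "x \<in> verts Q" "x \<notin> preds B" for x
  proof (cases "x \<in> S")
    case False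
    have "u = 0" if u: "u \<in> sp M x" for u
    proof (rule g_inj[OF x(1) False u])
      show "g x u = 0" using Hom_in_sp[OF g x(1) u] N0[OF x] by blast
    qed
    then show ?thesis using False by (auto simp: restrict_rep_simps)
  qed (simp add: restrict_rep_simps)
  have "eventually_in_iso ?R"
    unfolding eventually_in_iso_def
    using A R_iso G by (intro exI[of _ A] exI[of _ "F1 \<union> G"]) (auto simp: restrict_rep_simps S_def)
  moreover have "eventually_out_iso ?T"
    unfolding eventually_out_iso_def
    using B T_iso G T0 by (intro exI[of _ B] exI[of _ "F2 \<union> G"]) auto
  ultimately have "bar_shape A M"
    unfolding bar_shape_def using A crossing by (simp add: S_def)
  then show thesis by (rule that)
qed

section \<open>Closure under direct summands\<close>

lemma restrict_Hom:
  assumes M: "M \<in> rep Q s" and N: "N \<in> rep Q s" and s: "vector_space s" and f: "f \<in> Hom Q s s M N"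
  shows "(\<lambda>x u. if x \<in> S then f x u else 0) \<in> Hom Q s s (restrict_rep Q M S) (restrict_rep Q N S)"
proof -
  interpret vector_space s by (rule s)
  show ?thesis
  proof (rule HomI)
    fix \<alpha> u assume a: "\<alpha> \<in> arcs Q" and "u \<in> sp (restrict_rep Q M S) (tail Q \<alpha>)"
    then show "(if head Q \<alpha> \<in> S then f (head Q \<alpha>) (act (restrict_rep Q M S) \<alpha> u) else 0) =
        act (restrict_rep Q N S) \<alpha> (if tail Q \<alpha> \<in> S then f (tail Q \<alpha>) u else 0)"
      using Hom_act[OF f a] Hom_zero[OF s M s f] by (auto simp: restrict_rep_simps)
  qed (use Hom_in_sp[OF f] Hom_linear[OF f] Hom_outside[OF f] in
        \<open>auto simp: restrict_rep_simps linear_on_def Hom_zero[OF s M s f]\<close>)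
qed

text \<open>The injection carries a vector or a family from \<open>X\<close> to \<open>R\<close>,
  where the bijection is available, and the projection brings the result back.\<close>

lemma in_iso_retract:
  assumes s: "vector_space s" and X: "X \<in> rep Q s" and R: "R \<in> rep Q s"
    and i: "i \<in> Hom Q s s X R" and p: "p \<in> Hom Q s s R X"
    and pi: "\<And>x u. x \<in> verts Q \<Longrightarrow> u \<in> sp X x \<Longrightarrow> p x (i x u) = u"
    and x: "x \<in> verts Q" and iso: "in_iso Q R x"
  shows "in_iso Q X x"
proof (rule in_isoI)
  fix u assume u: "u \<in> sp X x"
  obtain v where v: "\<And>\<alpha>. \<alpha> \<in> in_arcs Q x \<Longrightarrow> v \<alpha> \<in> sp R (tail Q \<alpha>)" "i x u = (\<Sum>\<alpha>\<in>in_arcs Q x. act R \<alpha> (v \<alpha>))"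
    using in_iso_surj[OF iso Hom_in_sp[OF i x u]] by blast
  have "u = (\<Sum>\<alpha>\<in>in_arcs Q x. act X \<alpha> (p (tail Q \<alpha>) (v \<alpha>)))"
    using Hom_sum_in_arcs(2)[OF s s R p x v(1)] v(2) pi[OF x u] by simp
  moreover have "\<forall>\<alpha>\<in>in_arcs Q x. p (tail Q \<alpha>) (v \<alpha>) \<in> sp X (tail Q \<alpha>)"
    using Hom_in_sp[OF p _ v(1)] by auto
  ultimately show "\<exists>v. (\<forall>\<alpha>\<in>in_arcs Q x. v \<alpha> \<in> sp X (tail Q \<alpha>)) \<and> u = (\<Sum>\<alpha>\<in>in_arcs Q x. act X \<alpha> (v \<alpha>))"
    by (intro exI[of _ "\<lambda>\<alpha>. p (tail Q \<alpha>) (v \<alpha>)"] conjI)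
next
  fix v \<alpha> assume v: "\<And>\<alpha>. \<alpha> \<in> in_arcs Q x \<Longrightarrow> v \<alpha> \<in> sp X (tail Q \<alpha>)"
    and 0: "(\<Sum>\<alpha>\<in>in_arcs Q x. act X \<alpha> (v \<alpha>)) = 0" and a: "\<alpha> \<in> in_arcs Q x"
  have "(\<Sum>\<alpha>\<in>in_arcs Q x. act R \<alpha> (i (tail Q \<alpha>) (v \<alpha>))) = 0"
    using Hom_sum_in_arcs(2)[OF s s X i x v] 0 Hom_zero[OF s X s i] by simp
  moreover have "i (tail Q \<alpha>) (v \<alpha>) \<in> sp R (tail Q \<alpha>)" if "\<alpha> \<in> in_arcs Q x" for \<alpha>
    using Hom_in_sp[OF i _ v[OF that]] that by auto
  ultimately have "i (tail Q \<alpha>) (v \<alpha>) = 0"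
    using in_iso_inj[OF iso, of "\<lambda>\<alpha>. i (tail Q \<alpha>) (v \<alpha>)"] a by blast
  then show "v \<alpha> = 0" using pi[OF _ v[OF a]] a Hom_zero[OF s R s p] by auto
qed

lemma out_iso_retract:
  assumes s: "vector_space s" and X: "X \<in> rep Q s" and R: "R \<in> rep Q s"
    and i: "i \<in> Hom Q s s X R" and p: "p \<in> Hom Q s s R X"
    and pi: "\<And>x u. x \<in> verts Q \<Longrightarrow> u \<in> sp X x \<Longrightarrow> p x (i x u) = u"
    and x: "x \<in> verts Q" and iso: "out_iso Q R x"
  shows "out_iso Q X x"
proof (rule out_isoI)
  fix v assume v: "\<And>\<alpha>. \<alpha> \<in> out_arcs Q x \<Longrightarrow> v \<alpha> \<in> sp X (head Q \<alpha>)"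
  have "i (head Q \<alpha>) (v \<alpha>) \<in> sp R (head Q \<alpha>)" if "\<alpha> \<in> out_arcs Q x" for \<alpha>
    using Hom_in_sp[OF i _ v[OF that]] that by auto
  then obtain w where w: "w \<in> sp R x" "\<And>\<alpha>. \<alpha> \<in> out_arcs Q x \<Longrightarrow> act R \<alpha> w = i (head Q \<alpha>) (v \<alpha>)"
    using out_iso_surj[OF iso, of "\<lambda>\<alpha>. i (head Q \<alpha>) (v \<alpha>)"] by blast
  have "act X \<alpha> (p x w) = v \<alpha>" if a: "\<alpha> \<in> out_arcs Q x" for \<alpha>
    using Hom_act[OF p, of \<alpha> w] w pi[OF _ v[OF a]] a by auto
  then show "\<exists>u\<in>sp X x. \<forall>\<alpha>\<in>out_arcs Q x. act X \<alpha> u = v \<alpha>" using Hom_in_sp[OF p x w(1)] by blast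
next
  fix u assume u: "u \<in> sp X x" and 0: "\<And>\<alpha>. \<alpha> \<in> out_arcs Q x \<Longrightarrow> act X \<alpha> u = 0"
  have "act R \<alpha> (i x u) = 0" if a: "\<alpha> \<in> out_arcs Q x" for \<alpha>
    using Hom_act[OF i, of \<alpha> u] u 0[OF a] a Hom_zero[OF s X s i] by auto
  then have "i x u = 0" using out_iso_inj[OF iso Hom_in_sp[OF i x u]] by blast
  then show "u = 0" using pi[OF x u] Hom_zero[OF s R s p] by simp
qed

text \<open>The same set \<open>A\<close> works for the summand: injection and projection restrict
  to \<open>succs A\<close> and to its complement, each condition of \<open>bar_shape\<close> passes
  to retracts, and an arrow supporting \<open>X\<close> supports \<open>M\<close>.\<close>

lemma rep_bar_retract:
  assumes s: "vector_space s" and M: "M \<in> rep_bar Q s" and X: "X \<in> rep Q s"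
    and i: "i \<in> Hom Q s s X M" and p: "p \<in> Hom Q s s M X" and pi: "comp_mor p i = id_mor Q X"
  shows "X \<in> rep_bar Q s"
proof -
  obtain A where A: "bar_shape A M" using bar_shape_if_rep_bar[OF s M] by blast
  have MR: "M \<in> rep Q s" using M by (simp add: rep_bar_def)
  have pix: "p x (i x u) = u" if "x \<in> verts Q" "u \<in> sp X x" for x u
    using fun_cong[OF fun_cong[OF pi]] that by (simp add: comp_mor_apply id_mor_def)
  have i0: "i x 0 = 0" and p0: "p x 0 = 0" for x
    using Hom_zero[OF s X s i] Hom_zero[OF s MR s p] by auto
  let ?r = "\<lambda>f S x u. if x \<in> S then f x u else 0"
  note XS = restrict_rep_rep[OF s X] and MS = restrict_rep_rep[OF s MR]
  have iS: "?r i S \<in> Hom Q s s (restrict_rep Q X S) (restrict_rep Q M S)" for S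
    by (rule restrict_Hom[OF X MR s i])
  have pS: "?r p S \<in> Hom Q s s (restrict_rep Q M S) (restrict_rep Q X S)" for S
    by (rule restrict_Hom[OF MR X s p])
  have piS: "?r p S x (?r i S x u) = u" if "x \<in> verts Q" "u \<in> sp (restrict_rep Q X S) x" for S x u
    using that pix by (auto simp: restrict_rep_simps split: if_splits)
  have zero: "sp (restrict_rep Q X S) x \<subseteq> {0}" if "x \<in> verts Q" "sp (restrict_rep Q M S) x \<subseteq> {0}" for S x
  proof
    fix u assume u: "u \<in> sp (restrict_rep Q X S) x"
    then have "?r i S x u = 0" using Hom_in_sp[OF iS that(1) u] that(2) by blast
    then show "u \<in> {0}" using piS[OF that(1) u] p0 by (metis singletonI)
  qed
  have "eventually_in_iso (restrict_rep Q M (succs A))" using A by (simp add: bar_shape_def)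
  then obtain A1 F1 where A1: "finite A1 \<and> A1 \<subseteq> verts Q \<and> finite F1"
    "\<And>x. x \<in> verts Q - succs A1 \<Longrightarrow> sp (restrict_rep Q M (succs A)) x \<subseteq> {0}"
    "\<And>x. x \<in> verts Q - F1 \<Longrightarrow> in_iso Q (restrict_rep Q M (succs A)) x"
    unfolding eventually_in_iso_def by blast
  have "in_iso Q (restrict_rep Q X (succs A)) x" if "x \<in> verts Q - F1" for x
    by (rule in_iso_retract[OF s XS MS iS pS piS _ A1(3)[OF that]]) (use that in auto)
  moreover have "sp (restrict_rep Q X (succs A)) x \<subseteq> {0}" if "x \<in> verts Q - succs A1" for x
    by (rule zero[OF _ A1(2)[OF that]]) (use that in auto)
  ultimately have X1: "eventually_in_iso (restrict_rep Q X (succs A))"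
    unfolding eventually_in_iso_def using A1(1) by (intro exI[of _ A1] exI[of _ F1]) simp
  have "eventually_out_iso (restrict_rep Q M (- succs A))" using A by (simp add: bar_shape_def)
  then obtain B2 F2 where B2: "finite B2 \<and> B2 \<subseteq> verts Q \<and> finite F2"
    "\<And>x. x \<in> verts Q - preds B2 \<Longrightarrow> sp (restrict_rep Q M (- succs A)) x \<subseteq> {0}"
    "\<And>x. x \<in> verts Q - F2 \<Longrightarrow> out_iso Q (restrict_rep Q M (- succs A)) x"
    unfolding eventually_out_iso_def by blast
  have "out_iso Q (restrict_rep Q X (- succs A)) x" if "x \<in> verts Q - F2" for x
    by (rule out_iso_retract[OF s XS MS iS pS piS _ B2(3)[OF that]]) (use that in auto)
  moreover have "sp (restrict_rep Q X (- succs A)) x \<subseteq> {0}" if "x \<in> verts Q - preds B2" for x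
    by (rule zero[OF _ B2(2)[OF that]]) (use that in auto)
  ultimately have X2: "eventually_out_iso (restrict_rep Q X (- succs A))"
    unfolding eventually_out_iso_def using B2(1) by (intro exI[of _ B2] exI[of _ F2]) simp
  have "supports Q \<alpha> M" if "supports Q \<alpha> X" for \<alpha>
  proof -
    obtain u where a: "\<alpha> \<in> arcs Q" and u: "u \<in> sp X (tail Q \<alpha>)" "act X \<alpha> u \<noteq> 0"
      using \<open>supports Q \<alpha> X\<close> by (auto simp: supports_def)
    have "act M \<alpha> (i (tail Q \<alpha>) u) = i (head Q \<alpha>) (act X \<alpha> u)" using Hom_act[OF i a u(1)] by simp
    moreover have "i (head Q \<alpha>) (act X \<alpha> u) \<noteq> 0"
      using pix[OF head_in_verts[OF a] rep_act_in_sp[OF X a u(1)]] u(2) p0 by metis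
    ultimately show ?thesis using a Hom_in_sp[OF i tail_in_verts[OF a] u(1)] unfolding supports_def by metis
  qed
  then have "{\<alpha>. supports Q \<alpha> X \<and> tail Q \<alpha> \<notin> succs A \<and> head Q \<alpha> \<in> succs A} \<subseteq>
      {\<alpha>. supports Q \<alpha> M \<and> tail Q \<alpha> \<notin> succs A \<and> head Q \<alpha> \<in> succs A}" by blast
  then have "finite {\<alpha>. supports Q \<alpha> X \<and> tail Q \<alpha> \<notin> succs A \<and> head Q \<alpha> \<in> succs A}"
    by (rule finite_subset) (use A in \<open>simp add: bar_shape_def\<close>)
  then have "bar_shape A X" using A X1 X2 by (simp add: bar_shape_def)
  then show ?thesis by (rule rep_bar_if_bar_shape[OF s X])
qed

text \<open>Outside \<open>F\<close> a vector over \<open>S\<close> is a sum of images of vectors at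
  tails in \<open>S\<close>, on which \<open>f\<close> vanishes by induction. Arrows entering
  \<open>S\<close> from outside act as zero in the restriction and contribute nothing.\<close>

lemma Hom_zero_on_succs:
  assumes s: "vector_space s" and M: "M \<in> rep Q s" and N: "N \<in> rep Q s" and f: "f \<in> Hom Q s s M N"
    and A: "finite A" "\<And>x. x \<in> verts Q \<Longrightarrow> x \<notin> succs A \<Longrightarrow> sp (restrict_rep Q M S) x \<subseteq> {0}"
    and F: "\<And>x. x \<in> verts Q \<Longrightarrow> x \<notin> F \<Longrightarrow> in_iso Q (restrict_rep Q M S) x"
    and 0: "\<And>x u. x \<in> F \<Longrightarrow> f x u = 0"
    and x: "x \<in> verts Q" "x \<in> S"
  shows "f x u = 0"
proof -
  let ?R = "restrict_rep Q M S"
  have f0: "f x 0 = 0" for x using Hom_zero[OF s M s f] .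
  have "\<forall>u. x \<in> S \<longrightarrow> f x u = 0"
    using A(1) x(1)
  proof (induction x rule: succs_induct)
    case (outside x)
    have "f x u = 0" if "x \<in> S" for u
    proof (cases "u \<in> sp M x")
      case True
      then have "u = 0" using A(2)[OF outside] that by (auto simp: restrict_rep_simps)
      then show ?thesis using f0 by simp
    qed (rule Hom_outside[OF f], simp)
    then show ?case by blast
  next
    case (step x)
    have "f x u = 0" if "x \<in> S" for u
    proof (cases "x \<in> F \<or> u \<notin> sp M x")
      case False
      then have "u \<in> sp ?R x" "x \<notin> F" using that by (auto simp: restrict_rep_simps)
      then obtain v where v: "\<And>\<alpha>. \<alpha> \<in> in_arcs Q x \<Longrightarrow> v \<alpha> \<in> sp ?R (tail Q \<alpha>)"
        and u: "u = (\<Sum>\<alpha>\<in>in_arcs Q x. act ?R \<alpha> (v \<alpha>))"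
        using in_iso_surj[OF F[OF step.hyps]] by blast
      have av: "act ?R \<alpha> (v \<alpha>) \<in> sp M x \<and> f x (act ?R \<alpha> (v \<alpha>)) = 0" if a: "\<alpha> \<in> in_arcs Q x" for \<alpha>
      proof (cases "tail Q \<alpha> \<in> S")
        case True
        have aQ: "\<alpha> \<in> arcs Q" "head Q \<alpha> = x" using a by auto
        have vM: "v \<alpha> \<in> sp M (tail Q \<alpha>)" using v[OF a] True by (simp add: restrict_rep_simps)
        have "act ?R \<alpha> (v \<alpha>) = act M \<alpha> (v \<alpha>)" using True aQ \<open>x \<in> S\<close> by (simp add: restrict_rep_simps)
        moreover have "f x (act M \<alpha> (v \<alpha>)) = 0"
          using Hom_act[OF f aQ(1) vM] step.IH[OF a] True aQ rep_act_zero[OF s N wf aQ(1)] by simp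
        ultimately show ?thesis using rep_act_in_sp[OF M aQ(1) vM] aQ(2) by simp
      next
        case False
        then show ?thesis using f0 rep_zero[OF s M step.hyps] by (simp add: restrict_rep_simps)
      qed
      then show ?thesis
        unfolding u using Hom_sum[OF s M s f step.hyps, of "in_arcs Q x" "\<lambda>\<alpha>. act ?R \<alpha> (v \<alpha>)"]
        by simp
    qed (use 0 Hom_outside[OF f] in auto)
    then show ?case by blast
  qed
  then show ?thesis using x(2) by blast
qed

text \<open>Outside \<open>F\<close> the value \<open>f x u\<close> is zero as soon as every arrow
  within \<open>S\<close> kills it; such an arrow carries it to a value of \<open>f\<close> at its
  head, which is zero by induction.\<close>

lemma Hom_zero_on_preds:
  assumes s: "vector_space s" and M: "M \<in> rep Q s" and N: "N \<in> rep Q s" and f: "f \<in> Hom Q s s M N"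
    and B: "finite B" "\<And>x. x \<in> verts Q \<Longrightarrow> x \<notin> preds B \<Longrightarrow> sp (restrict_rep Q N S) x \<subseteq> {0}"
    and F: "\<And>x. x \<in> verts Q \<Longrightarrow> x \<notin> F \<Longrightarrow> out_iso Q (restrict_rep Q N S) x"
    and 0: "\<And>x u. x \<in> F \<Longrightarrow> f x u = 0"
    and x: "x \<in> verts Q" "x \<in> S"
  shows "f x u = 0"
proof -
  let ?R = "restrict_rep Q N S"
  have fN: "f x u \<in> sp ?R x" if "x \<in> verts Q" "x \<in> S" for x u
    using that Hom_in_sp[OF f that(1)] Hom_outside[OF f] rep_zero[OF s N that(1)]
    by (cases "u \<in> sp M x") (auto simp: restrict_rep_simps)
  have "\<forall>u. x \<in> S \<longrightarrow> f x u = 0"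
    using B(1) x(1)
  proof (induction x rule: preds_induct)
    case (outside x)
    then show ?case using fN[OF outside(1)] B(2)[OF outside] by blast
  next
    case (step x)
    have "f x u = 0" if xS: "x \<in> S" for u
    proof (cases "x \<in> F \<or> u \<notin> sp M x")
      case False
      show ?thesis
      proof (rule out_iso_inj[OF F[OF step.hyps] fN[OF step.hyps xS]])
        show "x \<notin> F" using False by simp
        fix \<alpha> assume a: "\<alpha> \<in> out_arcs Q x"
        then have aQ: "\<alpha> \<in> arcs Q" "tail Q \<alpha> = x" by auto
        show "act ?R \<alpha> (f x u) = 0"
          using Hom_act[OF f aQ(1), of u] step.IH[OF a] aQ False by (auto simp: restrict_rep_simps)
      qed
    qed (use 0 Hom_outside[OF f] in auto)
    then show ?case by blast
  qed
  then show ?thesis using x(2) by blast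
qed

text \<open>
  With \<open>S\<close> and \<open>T\<close> the successor-closed sets belonging to \<open>M\<close> and \<open>N\<close>, a morphism vanishing at
  sufficiently many vertices vanishes on \<open>S\<close> by generation and outside \<open>T\<close> by cogeneration; the
  support of \<open>M\<close> meets the rest in a finite set, by interval-finiteness.
\<close>

lemma Hom_determined_on_finite:
  assumes s: "vector_space s" and MB: "M \<in> rep_bar Q s" and NB: "N \<in> rep_bar Q s"
  obtains F where "finite F" "F \<subseteq> verts Q"
    "\<And>f. f \<in> Hom Q s s M N \<Longrightarrow> (\<And>x u. x \<in> F \<Longrightarrow> u \<in> sp M x \<Longrightarrow> f x u = 0) \<Longrightarrow> f = 0"
proof -
  have M: "M \<in> rep Q s" and N: "N \<in> rep Q s" using MB NB by (auto simp: rep_bar_def)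
  obtain A where A: "bar_shape A M" using bar_shape_if_rep_bar[OF s MB] by blast
  have "eventually_in_iso (restrict_rep Q M (succs A))" using A by (simp add: bar_shape_def)
  then obtain A1 F1 where A1: "finite A1"
      "\<And>x. x \<in> verts Q \<Longrightarrow> x \<notin> succs A1 \<Longrightarrow> sp (restrict_rep Q M (succs A)) x \<subseteq> {0}"
    and F1: "finite F1" "\<And>x. x \<in> verts Q \<Longrightarrow> x \<notin> F1 \<Longrightarrow> in_iso Q (restrict_rep Q M (succs A)) x"
    unfolding eventually_in_iso_def by blast
  have "eventually_out_iso (restrict_rep Q M (- succs A))" using A by (simp add: bar_shape_def)
  then obtain B1 where B1: "finite B1"
      "\<And>x. x \<in> verts Q \<Longrightarrow> x \<notin> preds B1 \<Longrightarrow> sp (restrict_rep Q M (- succs A)) x \<subseteq> {0}"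
    unfolding eventually_out_iso_def by blast
  obtain A' where A': "bar_shape A' N" using bar_shape_if_rep_bar[OF s NB] by blast
  then have A'f: "finite A'" by (simp add: bar_shape_def)
  have "eventually_out_iso (restrict_rep Q N (- succs A'))" using A' by (simp add: bar_shape_def)
  then obtain B2 F2 where B2: "finite B2"
      "\<And>x. x \<in> verts Q \<Longrightarrow> x \<notin> preds B2 \<Longrightarrow> sp (restrict_rep Q N (- succs A')) x \<subseteq> {0}"
    and F2: "finite F2" "\<And>x. x \<in> verts Q \<Longrightarrow> x \<notin> F2 \<Longrightarrow> out_iso Q (restrict_rep Q N (- succs A')) x"
    unfolding eventually_out_iso_def by blast
  \<comment> \<open>\<open>F1\<close> contains the vertices where \<open>M\<close> over
    \<open>succs A\<close> may need generators, \<open>F2\<close> those where \<open>N\<close>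
    outside \<open>succs A'\<close> may need cogenerators. The third set contains every remaining
    vertex at which \<open>M\<close> can be nonzero.\<close>
  let ?F = "(F1 \<union> F2 \<union> (succs A' \<inter> preds B1)) \<inter> verts Q"
  show thesis
  proof
    show "finite ?F" using F1 F2 finite_succs_Int_preds[OF A'f B1(1)] by simp
    fix f assume f: "f \<in> Hom Q s s M N" and 0: "\<And>x u. x \<in> ?F \<Longrightarrow> u \<in> sp M x \<Longrightarrow> f x u = 0"
    have zero: "f x u = 0" if "x \<in> F1 \<union> F2 \<union> (succs A' \<inter> preds B1)" for x u
      using 0[of x u] Hom_outside[OF f, of x u] that by blast
    show "f = 0"
    proof (intro ext)
      fix x u
      show "f x u = 0 x u"
      proof (cases "x \<in> verts Q \<and> u \<in> sp M x")
        case True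
        then have x: "x \<in> verts Q" "u \<in> sp M x" by auto
        consider "x \<in> succs A" | "x \<in> - succs A'" | "x \<in> - succs A" "x \<in> succs A'" by blast
        then have "f x u = 0"
        proof cases
          case 1
          show ?thesis by (rule Hom_zero_on_succs[OF s M N f A1 F1(2) zero x(1) 1]) auto
        next
          case 2
          show ?thesis by (rule Hom_zero_on_preds[OF s M N f B2 F2(2) zero x(1) 2]) auto
        next
          case 3
          show ?thesis
          proof (cases "x \<in> preds B1")
            case True
            then show ?thesis using 3 zero by blast
          next
            case False
            then have "u = 0" using B1(2)[OF x(1)] 3(1) x(2) by (auto simp: restrict_rep_simps)
            then show ?thesis using Hom_zero[OF s M s f] by simp
          qed
        qed
        then show ?thesis by simp
      next
        case False
        then have "f x u = 0" by (intro Hom_outside[OF f]) auto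
        then show ?thesis by simp
      qed
    qed
  qed auto
qed

text \<open>Evaluations at finite spanning sets of the spaces \<open>sp M x\<close>, for
  \<open>x\<close> in the finite determining set \<open>F\<close>, are jointly injective and take
  values in finite-dimensional spaces of \<open>N\<close>.\<close>

lemma hom_finite_rep_bar:
  fixes s :: "'k::field \<Rightarrow> 'w::ab_group_add \<Rightarrow> 'w"
  assumes s: "vector_space s"
  shows "hom_finite Q s (rep_bar Q s)"
  unfolding hom_finite_def
proof (intro ballI)
  fix M N assume MB: "M \<in> rep_bar Q s" and NB: "N \<in> rep_bar Q s"
  have M: "M \<in> rep Q s" and N: "N \<in> rep Q s" using MB NB by (auto simp: rep_bar_def)
  interpret s: vector_space s by (rule s)
  interpret h: vector_space "pointwise (pointwise s) :: 'k \<Rightarrow> ('v \<Rightarrow> 'w \<Rightarrow> 'w) \<Rightarrow> _"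
    by (intro vector_space_pointwise s)
  obtain F where F: "finite F" "F \<subseteq> verts Q"
    and det: "\<And>f. f \<in> Hom Q s s M N \<Longrightarrow> (\<And>x u. x \<in> F \<Longrightarrow> u \<in> sp M x \<Longrightarrow> f x u = 0) \<Longrightarrow> f = 0"
    using Hom_determined_on_finite[OF s MB NB] by blast
  have "\<forall>x\<in>F. \<exists>B. finite B \<and> B \<subseteq> sp M x \<and> s.span B = sp M x"
    using s.fin_dim_basis[OF rep_fin_dim[OF M] rep_subspace[OF M]] F(2) by (metis subsetD)
  then obtain B where B: "\<And>x. x \<in> F \<Longrightarrow> finite (B x) \<and> B x \<subseteq> sp M x \<and> s.span (B x) = sp M x"
    by metis
  show "fin_dim (pointwise (pointwise s)) (Hom Q s s M N)"
  proof (rule h.fin_dim_jointly_injective[where I = "Sigma F B" and f = "\<lambda>j f. f (fst j) (snd j)"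
        and U = "\<lambda>j. sp N (fst j)" and t = s])
    show "vector_space s" "finite (Sigma F B)" "h.subspace (Hom Q s s M N)"
      using s F B subspace_Hom[OF s s M N wf] by auto
  next
    fix j assume j: "j \<in> Sigma F B"
    then have "fst j \<in> F" "snd j \<in> B (fst j)" by auto
    then have x: "fst j \<in> verts Q" "snd j \<in> sp M (fst j)" using F(2) B by blast+
    show "linear_on (pointwise (pointwise s)) s (Hom Q s s M N) (\<lambda>f. f (fst j) (snd j))"
      by (simp add: linear_on_def pointwise_apply)
    show "fin_dim s (sp N (fst j)) \<and> (\<lambda>f. f (fst j) (snd j)) ` Hom Q s s M N \<subseteq> sp N (fst j)"
      using rep_fin_dim[OF N x(1)] Hom_in_sp[OF _ x] by auto
  next
    fix f assume f: "f \<in> Hom Q s s M N" and 0: "\<And>j. j \<in> Sigma F B \<Longrightarrow> f (fst j) (snd j) = 0"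
    show "f = 0"
    proof (rule det[OF f])
      fix x u assume x: "x \<in> F" and u: "u \<in> sp M x"
      then have xv: "x \<in> verts Q" using F by auto
      have "s.span (B x) \<subseteq> {u \<in> sp M x. f x u = 0}"
      proof (rule s.span_minimal)
        show "B x \<subseteq> {u \<in> sp M x. f x u = 0}" using B[OF x] 0[of "(x, _)"] x by auto
        show "s.subspace {u \<in> sp M x. f x u = 0}"
          by (rule subspace_linear_kernel[OF s s rep_subspace[OF M xv] Hom_linear[OF f xv]])
      qed
      then show "f x u = 0" using B[OF x] u by auto
    qed
  qed
qed

lemma krull_schmidt_rep_bar:
  fixes s :: "'k::field \<Rightarrow> 'w::ab_group_add \<Rightarrow> 'w"
  assumes s: "vector_space s"
  shows "krull_schmidt Q s (rep_bar Q s)"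
proof -
  let ?C = "rep_bar Q s"
  have sub: "?C \<subseteq> rep Q s" by (auto simp: rep_bar_def)
  interpret C0: linear_category "pointwise (pointwise s)" "rep Q s" "Hom Q s s" comp_mor "id_mor Q"
    by (rule linear_category_rep[OF s wf])
  interpret C: linear_category "pointwise (pointwise s)" ?C "Hom Q s s" comp_mor "id_mor Q"
    by (rule C0.full_subcategory[OF sub])
  have End: "C.End X = End_ring Q s X" for X by (simp add: C.End_def End_ring_def)
  have iso: "C.iso X Y \<longleftrightarrow> isomorphic Q s s X Y" for X Y by (simp add: C.iso_def isomorphic_def)
  show ?thesis
    unfolding krull_schmidt_def
  proof (intro ballI conjI allI impI)
    fix M assume M: "M \<in> ?C"
    then have MR: "M \<in> rep Q s" using sub by blast
    \<comment> \<open>Idempotents split through their images, and an image stays in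
      \<open>rep_bar\<close> as a retract of \<open>M\<close>.\<close>
    have split: "\<exists>Y\<in>?C. \<exists>p\<in>Hom Q s s M Y. \<exists>i\<in>Hom Q s s Y M. comp_mor p i = id_mor Q Y \<and> comp_mor i p = e"
      if e: "e \<in> Hom Q s s M M" "comp_mor e e = e" for e
    proof -
      note Y = image_rep_splits[OF s wf MR e]
      have "image_rep e M \<in> ?C" by (rule rep_bar_retract[OF s M Y(1,3,2,4)])
      then show ?thesis using Y(2-5) by blast
    qed
    have fd: "fin_dim (pointwise (pointwise s)) (Hom Q s s X X)" if "X \<in> ?C" for X
      using hom_finite_rep_bar[OF s] that by (simp add: hom_finite_def)
    define D where "D n X i p \<longleftrightarrow> (\<forall>j<n. X j \<in> ?C \<and> is_local_ring (C.End (X j)) \<and>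
        i j \<in> Hom Q s s (X j) M \<and> p j \<in> Hom Q s s M (X j)) \<and>
        (\<forall>j<n. \<forall>l<n. comp_mor (p j) (i l) = (if j = l then id_mor Q (X j) else 0)) \<and>
        (\<Sum>j<n. comp_mor (i j) (p j)) = id_mor Q M"
      for n :: nat and X i p
    have "\<exists>n X i p. D n X i p"
      unfolding D_def by (rule C.local_decomposition_exists[OF M fd split])
    then obtain n X i p where "D n X i p" by blast
    then have X: "\<And>j. j < n \<Longrightarrow> X j \<in> ?C \<and> is_local_ring (C.End (X j)) \<and>
        i j \<in> Hom Q s s (X j) M \<and> p j \<in> Hom Q s s M (X j)"
      and pi: "\<And>j l. j < n \<Longrightarrow> l < n \<Longrightarrow> comp_mor (p j) (i l) = (if j = l then id_mor Q (X j) else 0)"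
      and ip: "(\<Sum>j<n. comp_mor (i j) (p j)) = id_mor Q M"
      unfolding D_def by blast+
    let ?Ms = "map X [0..<n]"
    have Ms: "set ?Ms \<subseteq> ?C" using X by auto
    have "isomorphic Q s (pointwise s) M (direct_sum ?Ms)"
      unfolding isomorphic_direct_sum_iff[OF s wf MR subset_trans[OF Ms sub]]
      using X pi ip by (intro exI[of _ i] exI[of _ p]) simp
    then show "\<exists>Ms. KS_decomposition Q s ?C M Ms"
      using X Ms by (intro exI[of _ ?Ms]) (auto simp: KS_decomposition_def End)
  next
    fix M Ms Ns
    assume M: "M \<in> ?C" and KM: "KS_decomposition Q s ?C M Ms" and KN: "KS_decomposition Q s ?C M Ns"
    have MR: "M \<in> rep Q s" using M sub by blast
    have Ms: "set Ms \<subseteq> ?C" "\<And>X. X \<in> set Ms \<Longrightarrow> is_local_ring (C.End X)" "isomorphic Q s (pointwise s) M (direct_sum Ms)"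
      and Ns: "set Ns \<subseteq> ?C" "\<And>X. X \<in> set Ns \<Longrightarrow> is_local_ring (C.End X)" "isomorphic Q s (pointwise s) M (direct_sum Ns)"
      using KM KN by (auto simp: KS_decomposition_def End)
    obtain i p where ip: "\<And>j. j < length Ms \<Longrightarrow> i j \<in> Hom Q s s (Ms ! j) M \<and> p j \<in> Hom Q s s M (Ms ! j)"
      "\<And>j l. j < length Ms \<Longrightarrow> l < length Ms \<Longrightarrow> comp_mor (p j) (i l) = (if j = l then id_mor Q (Ms ! j) else 0)"
      "(\<Sum>j<length Ms. comp_mor (i j) (p j)) = id_mor Q M"
      using Ms(3) unfolding isomorphic_direct_sum_iff[OF s wf MR subset_trans[OF Ms(1) sub]] by blast
    obtain i' p' where ip': "\<And>j. j < length Ns \<Longrightarrow> i' j \<in> Hom Q s s (Ns ! j) M \<and> p' j \<in> Hom Q s s M (Ns ! j)"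
      "\<And>j l. j < length Ns \<Longrightarrow> l < length Ns \<Longrightarrow> comp_mor (p' j) (i' l) = (if j = l then id_mor Q (Ns ! j) else 0)"
      "(\<Sum>j<length Ns. comp_mor (i' j) (p' j)) = id_mor Q M"
      using Ns(3) unfolding isomorphic_direct_sum_iff[OF s wf MR subset_trans[OF Ns(1) sub]] by blast
    have MsC: "Ms ! j \<in> ?C \<and> is_local_ring (C.End (Ms ! j))" if "j < length Ms" for j
      using Ms(1,2) nth_mem[OF that] by blast
    have NsC: "Ns ! j \<in> ?C \<and> is_local_ring (C.End (Ns ! j))" if "j < length Ns" for j
      using Ns(1,2) nth_mem[OF that] by blast
    have "\<exists>c. bij_betw c {..<length Ms} {..<length Ns} \<and> (\<forall>a\<in>{..<length Ms}. C.iso (Ms ! a) (Ns ! c a))"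
      by (rule C.local_biproducts_unique[OF M, where i = i and p = p and i' = i' and p' = p'])
        (use MsC NsC ip ip' in auto)
    then obtain c where c: "bij_betw c {..<length Ms} {..<length Ns}"
      and ci: "\<And>a. a < length Ms \<Longrightarrow> isomorphic Q s s (Ms ! a) (Ns ! c a)"
      by (auto simp: iso)
    show len: "length Ms = length Ns" using bij_betw_same_card[OF c] by simp
    \<comment> \<open>The bijection \<open>c\<close> is extended by the identity, as
      \<open>permutes\<close> asks for a map fixing all other numbers.\<close>
    define \<pi> where "\<pi> a = (if a < length Ms then c a else a)" for a
    have "bij_betw \<pi> {..<length Ms} {..<length Ms}"
      using c len by (subst bij_betw_cong[of _ \<pi> c]) (auto simp: \<pi>_def)
    then have "\<pi> permutes {..<length Ms}" by (rule bij_imp_permutes) (auto simp: \<pi>_def)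
    then show "\<exists>\<pi>. \<pi> permutes {..<length Ms} \<and> (\<forall>i<length Ms. isomorphic Q s s (Ms ! i) (Ns ! \<pi> i))"
      using ci by (intro exI[of _ \<pi>]) (auto simp: \<pi>_def)
  qed
qed

end

theorem proposition3p2:
  fixes Q :: "('v, 'e) pre_digraph"
    and s :: "'k::field \<Rightarrow> 'w::ab_group_add \<Rightarrow> 'w"
  assumes "strongly_locally_finite_quiver Q"
    and "vector_space s"
  shows "hom_finite Q s (rep_bar Q s) \<and> krull_schmidt Q s (rep_bar Q s)"
  using strongly_locally_finite_quiver.hom_finite_rep_bar[OF assms]
    strongly_locally_finite_quiver.krull_schmidt_rep_bar[OF assms] by blast

end
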